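(* Let $\alpha\in(0,1)$, $\lambda>0$ and let $m\ge1$ be an integer. If $(P^{[m]}_{\ell}(\lambda))\sim\mathbb{P}^{[m]}_{\alpha}(\lambda)$, then the sequence $(\tilde{P}_{k}(\lambda))$ obtained by size-biased sampling from $(P^{[m]}_{\ell}(\lambda))$ can be represented (in joint distribution) as $\tilde{P}_{k}(\lambda)=(1-W_{k})\prod_{l=1}^{k-1}W_{l}$, $k\ge1$, with the following properties, where $(R_{\ell,m}(\lambda),N_{\ell,m}(\lambda))_{\ell\ge1}$ is the sequence of variables described in the context. (i) Given $(R_{1,m}(\lambda)=r_{1},R_{2,m}(\lambda)=r_{2},\ldots)$, the $(W_{\ell})$ are conditionally independent, with respective densities $B_{m,\alpha}(w_{\ell}|r_{\ell})$, $\ell\ge1$, given by $$B_{m,\alpha}(w_{\ell}|r_{\ell})=\frac{1}{\Gamma(1-\alpha)\Gamma(\alpha)}\,\frac{w_{\ell}^{-m}(1-w_{\ell})^{-\alpha}(w_{\ell}-r_{\ell})^{\alpha-1}r_{\ell}^{m-\alpha}}{\mathbb{E}[(\beta_{1-\alpha,\alpha}(1-r_{\ell})+r_{\ell})^{m-1}]},\qquad r_{\ell}<w_{\ell}<1,$$ not depending on $\lambda$. (ii) The density $B_{m,\alpha}(w|r)$ can be expressed as an $m$-component mixture, and it follows that, given $(R_{1,m}(\lambda)=r,\,N_{1,m}(\lambda)=k)$, for $k=1,\ldots,m$, $$W_{1}\overset{d}{=}\left[\beta^{(1)}_{k-\alpha,\alpha}\,\frac{1-r}{r}+1\right]^{-1},$$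 with density, for $r<w<1$, $$\frac{\Gamma(k)}{\Gamma(k-\alpha)\Gamma(\alpha)}\,w^{-k}(1-w)^{k-\alpha-1}(w-r)^{\alpha-1}r^{k-\alpha}(1-r)^{1-k}.$$ (iii) Hence, the $(W_{\ell})$ are generally dependent random variables represented as $$W_{\ell}=\left[\beta^{(\ell)}_{N_{\ell,m}(\lambda)-\alpha,\alpha}\,\frac{1-R_{\ell,m}(\lambda)}{R_{\ell,m}(\lambda)}+1\right]^{-1},\qquad \ell\ge1.$$
   Context: $S_\alpha$ is the positive $\alpha$-stable random variable with $\mathbb{E}[e^{-\lambda S_\alpha}]=e^{-\lambda^\alpha}$ and density $f_\alpha$. Let $(A_k)$ be the ranked jumps on $[0,1]$ of a stable subordinator with L\'evy density $\alpha s^{-\alpha-1}/\Gamma(1-\alpha)$, so $\sum_kA_k=S_\alpha$; $\mathrm{PD}(\alpha,0)$ is the law of $(A_\ell/S_\alpha,\ell\ge1)$ and $\mathrm{PD}(\alpha|t)$ its conditional law given $S_\alpha=t$. Set $\mathbb{P}^{[m]}_{\alpha}(\lambda)=\int_{0}^{\infty}\mathrm{PD}(\alpha|t)f^{[m]}_\alpha(t|\lambda)\,dt$ with $f_\alpha^{[m]}(t|\lambda)=t^me^{-\lambda t}f_\alpha(t)/\mathbb{E}[S_\alpha^me^{-\lambda S_\alpha}]$; this is the conditional law of $(P_\ell)\sim\mathrm{PD}(\alpha,0)$ given $N_{S_\alpha}(\lambda)=m$, where, given $S_\alpha$ and $(P_\ell)$, $N_{S_\alpha}(\lambda)$ is Poisson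 with mean $\lambda S_\alpha$. Size-biased sampling means sampling masses without replacement, successively, with probability proportional to size. Define $\Omega_m$ by $\mathbb{E}[S^{m}_{\alpha}e^{-\lambda S_{\alpha}}]=\alpha e^{-\lambda^{\alpha}}\lambda^{\alpha-m}\,\Omega_{m}(\lambda^{\alpha})$ for $m=0,1,2,\dots$ Explicitly, $\Omega_0(x)=1/(\alpha x)$ and, for $m\ge1$, $\Omega_{m}(x)=\Gamma(m)\sum_{\ell=1}^{m}\mathrm{P}^{(m)}_{\alpha,0}(\ell)\,x^{\ell-1}/\Gamma(\ell)$, where $\mathrm{P}^{(m)}_{\alpha,0}(k)=\frac{\alpha^{k-1}\Gamma(k)}{\Gamma(m)}S_\alpha(m,k)$, $S_\alpha(m,k)=\frac{1}{\alpha^k k!}\sum_{j=1}^k(-1)^j\binom{k}{j}(-j\alpha)_m$, and $(x)_m=x(x+1)\cdots(x+m-1)$. $\beta_{a,b}$ denotes a $\mathrm{Beta}(a,b)$ variable. Put $f_{R_1}(r|\lambda)=\alpha\lambda^\alpha e^{\lambda^\alpha}e^{-\lambda^\alpha/r^\alpha}r^{-\alpha-1}$, $0<r<1$, and $$f_{m}(r|\lambda)=\frac{\Omega_{m}(\lambda^{\alpha}/r^{\alpha})}{\Omega_{m}(\lambda^{\alpha})}\,\mathbb{E}[(\beta_{1-\alpha,\alpha}(1-r)+r)^{m-1}]\,f_{R_{1}}(r|\lambda),\qquad 0<r<1.$$ The sequence $(R_{\ell,m}(\lambda))_{\ell\ge1}$ is such that $R_{1,m}(\lambda)$ has density $f_m(\cdot|\lambda)$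 and, given $R_{1,m}(\lambda)=r_1,\dots,R_{\ell-1,m}(\lambda)=r_{\ell-1}$, $R_{\ell,m}(\lambda)$ has density $f_m(\cdot\,|\lambda/\prod_{i=1}^{\ell-1}r_i)$. Given $(R_{\ell,m}(\lambda)=r_\ell)_{\ell\ge1}$, the variables $N_{\ell,m}(\lambda)\in\{1,\dots,m\}$ are conditionally independent with $$\mathbb{P}(N_{\ell,m}(\lambda)=k\mid R_{\ell,m}(\lambda)=r)=\frac{\frac{\Gamma(k-\alpha)}{\Gamma(k)\Gamma(1-\alpha)}\binom{m-1}{k-1}(1-r)^{k-1}r^{m-k}}{\mathbb{E}[(\beta_{1-\alpha,\alpha}(1-r)+r)^{m-1}]}.$$ In (iii), given the sequence $(R_{\ell,m}(\lambda),N_{\ell,m}(\lambda))_{\ell\ge1}$, the variables $\beta^{(\ell)}_{N_{\ell,m}(\lambda)-\alpha,\alpha}$ are conditionally independent, with $\beta^{(\ell)}_{N_{\ell,m}(\lambda)-\alpha,\alpha}\sim\mathrm{Beta}(k-\alpha,\alpha)$ when $N_{\ell,m}(\lambda)=k$. *)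

theory Defs
  imports "HOL-Probability.Probability"
begin

(* Sequences are indexed from 0, so index l stands for l + 1 in the usual notation. *)

section \<open>Conditional laws\<close>

abbreviation real_seq :: "(nat \<Rightarrow> real) measure" where
  "real_seq \<equiv> \<Pi>\<^sub>M l\<in>UNIV. borel"

abbreviation nat_seq :: "(nat \<Rightarrow> nat) measure" where
  "nat_seq \<equiv> \<Pi>\<^sub>M l\<in>UNIV. count_space UNIV"

(* K is a version of the regular conditional distribution of Y given X.
   K x need only be meaningful for almost every value x of X. *)
definition cond_law ::
  "'a measure \<Rightarrow> ('a \<Rightarrow> 'b) \<Rightarrow> 'b measure \<Rightarrow> ('b \<Rightarrow> 'c measure) \<Rightarrow> ('a \<Rightarrow> 'c) \<Rightarrow> 'c measure \<Rightarrow> bool"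
where
  "cond_law M X MX K Y MY \<longleftrightarrow>
     X \<in> M \<rightarrow>\<^sub>M MX \<and> Y \<in> M \<rightarrow>\<^sub>M MY \<and>
     (\<forall>B\<in>sets MY.
        (\<lambda>\<omega>. emeasure (K (X \<omega>)) B) \<in> borel_measurable M \<and>
        (\<forall>A\<in>sets MX.
           emeasure M {\<omega>\<in>space M. X \<omega> \<in> A \<and> Y \<omega> \<in> B} =
           (\<integral>\<^sup>+\<omega>. indicator A (X \<omega>) * emeasure (K (X \<omega>)) B \<partial>M)))"

(* Given X, the Y l (l = 0, 1, ...) are conditionally independent, Y l having law K l X. *)
definition cond_indep_laws ::
  "'a measure \<Rightarrow> ('a \<Rightarrow> 'b) \<Rightarrow> 'b measure \<Rightarrow> (nat \<Rightarrow> 'b \<Rightarrow> 'c measure) \<Rightarrow> (nat \<Rightarrow> 'a \<Rightarrow> 'c) \<Rightarrow> 'c measure \<Rightarrow> bool"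
where
  "cond_indep_laws M X MX K Y MY \<longleftrightarrow>
     X \<in> M \<rightarrow>\<^sub>M MX \<and> (\<forall>l. Y l \<in> M \<rightarrow>\<^sub>M MY) \<and>
     (\<forall>l. \<forall>B\<in>sets MY. (\<lambda>\<omega>. emeasure (K l (X \<omega>)) B) \<in> borel_measurable M) \<and>
     (\<forall>n. \<forall>A\<in>sets MX. \<forall>B. (\<forall>l. B l \<in> sets MY) \<longrightarrow>
        emeasure M {\<omega>\<in>space M. X \<omega> \<in> A \<and> (\<forall>l<n. Y l \<omega> \<in> B l)} =
        (\<integral>\<^sup>+\<omega>. indicator A (X \<omega>) * (\<Prod>l<n. emeasure (K l (X \<omega>)) (B l)) \<partial>M))"

section \<open>The stable subordinator, its ranked jumps and Poisson-Dirichlet laws\<close>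

definition stable_density :: "real \<Rightarrow> (real \<Rightarrow> real) \<Rightarrow> bool" where
  "stable_density \<alpha> f \<longleftrightarrow>
     f \<in> borel_measurable borel \<and> (\<forall>t. 0 \<le> f t) \<and> (\<forall>t\<le>0. f t = 0) \<and>
     (\<forall>s\<ge>0. (\<integral>\<^sup>+t. ennreal (exp (- (s * t)) * f t) \<partial>lborel) = ennreal (exp (- (s powr \<alpha>))))"

definition poisson_random_measure ::
  "'a measure \<Rightarrow> 'b measure \<Rightarrow> ('a \<Rightarrow> 'b set \<Rightarrow> ennreal) \<Rightarrow> bool"
where
  "poisson_random_measure M \<nu> N \<longleftrightarrow>
     (\<forall>E\<in>sets \<nu>. emeasure \<nu> E < \<infinity> \<longrightarrow>
        (\<lambda>\<omega>. N \<omega> E) \<in> borel_measurable M \<and>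
        (\<forall>n::nat. measure M {\<omega>\<in>space M. N \<omega> E = of_nat n} =
           exp (- measure \<nu> E) * measure \<nu> E ^ n / fact n)) \<and>
     (\<forall>n. \<forall>E :: nat \<Rightarrow> 'b set.
        (\<forall>i<n. E i \<in> sets \<nu> \<and> emeasure \<nu> (E i) < \<infinity>) \<and> disjoint_family_on E {..<n} \<longrightarrow>
        prob_space.indep_vars M (\<lambda>_. borel) (\<lambda>i \<omega>. N \<omega> (E i)) {..<n})"

definition jump :: "(real \<Rightarrow> real) \<Rightarrow> real \<Rightarrow> real" where
  "jump x s = x s - Lim (at_left s) x"

definition stable_levy_measure :: "real \<Rightarrow> real measure" where
  "stable_levy_measure \<alpha> =
     density lborel (\<lambda>s. ennreal (indicator {0<..} s * (\<alpha> * s powr (- \<alpha> - 1) / Gamma (1 - \<alpha>))))"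

(* A nondecreasing right-continuous pure-jump process whose jumps (time, size) form a Poisson
   random measure with intensity ds x (Levy measure): the Levy-Ito description of the driftless
   subordinator with the given Levy density. *)
definition stable_subordinator :: "'a measure \<Rightarrow> real \<Rightarrow> (real \<Rightarrow> 'a \<Rightarrow> real) \<Rightarrow> bool" where
  "stable_subordinator M \<alpha> \<tau> \<longleftrightarrow>
     prob_space M \<and>
     (\<forall>t\<ge>0. \<tau> t \<in> borel_measurable M) \<and>
     (AE \<omega> in M. \<tau> 0 \<omega> = 0 \<and> mono_on {0..} (\<lambda>t. \<tau> t \<omega>) \<and>
        (\<forall>t\<ge>0. continuous (at_right t) (\<lambda>t. \<tau> t \<omega>)) \<and>
        (\<forall>t\<ge>0. (jump (\<lambda>s. \<tau> s \<omega>) has_sum \<tau> t \<omega>) {0<..t})) \<and>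
     poisson_random_measure M
       (density lborel (indicator {0<..}) \<Otimes>\<^sub>M stable_levy_measure \<alpha>)
       (\<lambda>\<omega> E. emeasure (count_space UNIV)
          {(s, x) \<in> E. 0 < s \<and> 0 < x \<and> x = jump (\<lambda>u. \<tau> u \<omega>) s})"

(* The A k list, in nonincreasing order and with multiplicity, the jumps on the time interval [0,1]. *)
definition ranked_jumps ::
  "'a measure \<Rightarrow> (real \<Rightarrow> 'a \<Rightarrow> real) \<Rightarrow> (nat \<Rightarrow> 'a \<Rightarrow> real) \<Rightarrow> bool"
where
  "ranked_jumps M \<tau> A \<longleftrightarrow>
     (\<forall>k. A k \<in> borel_measurable M) \<and>
     (AE \<omega> in M. decseq (\<lambda>k. A k \<omega>) \<and>
        (\<exists>T. bij_betw T UNIV {s\<in>{0<..1}. 0 < jump (\<lambda>u. \<tau> u \<omega>) s} \<and>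
             (\<forall>k. A k \<omega> = jump (\<lambda>u. \<tau> u \<omega>) (T k))))"

definition total_mass :: "(nat \<Rightarrow> 'a \<Rightarrow> real) \<Rightarrow> 'a \<Rightarrow> real" where
  "total_mass A \<omega> = (\<Sum>k. A k \<omega>)"

(* kappa t is PD(alpha|t): the conditional law of the normalised ranked jumps, which have law
   PD(alpha,0), given that their sum is t. *)
definition PD_given ::
  "'a measure \<Rightarrow> (nat \<Rightarrow> 'a \<Rightarrow> real) \<Rightarrow> (real \<Rightarrow> (nat \<Rightarrow> real) measure) \<Rightarrow> bool"
where
  "PD_given M A \<kappa> \<longleftrightarrow>
     \<kappa> \<in> borel \<rightarrow>\<^sub>M prob_algebra real_seq \<and>
     cond_law M (total_mass A) borel \<kappa> (\<lambda>\<omega> l. A l \<omega> / total_mass A \<omega>) real_seq"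

definition tilted_density :: "(real \<Rightarrow> real) \<Rightarrow> nat \<Rightarrow> real \<Rightarrow> real \<Rightarrow> real" where
  "tilted_density f m lam t =
     t ^ m * exp (- (lam * t)) * f t / (\<integral>u. u ^ m * exp (- (lam * u)) * f u \<partial>lborel)"

(* The mixture of the laws kappa t over t with respect to the tilted density. *)
definition PD_tilted ::
  "(real \<Rightarrow> real) \<Rightarrow> (real \<Rightarrow> (nat \<Rightarrow> real) measure) \<Rightarrow> nat \<Rightarrow> real \<Rightarrow> (nat \<Rightarrow> real) measure"
where
  "PD_tilted f \<kappa> m lam = density lborel (\<lambda>t. ennreal (tilted_density f m lam t)) \<bind> \<kappa>"

section \<open>Size-biased sampling\<close>

(* sigma k is the index of the mass picked at step k. Given the masses and the earlier picks,
   index j is picked with probability proportional to P j among the indices not yet picked. *)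
definition size_biased_sampling ::
  "'a measure \<Rightarrow> (nat \<Rightarrow> 'a \<Rightarrow> real) \<Rightarrow> (nat \<Rightarrow> 'a \<Rightarrow> nat) \<Rightarrow> bool"
where
  "size_biased_sampling M P \<sigma> \<longleftrightarrow>
     (\<forall>k. cond_law M
        (\<lambda>\<omega>. (\<lambda>l. P l \<omega>, \<lambda>i\<in>{..<k}. \<sigma> i \<omega>))
        (real_seq \<Otimes>\<^sub>M (\<Pi>\<^sub>M i\<in>{..<k}. count_space UNIV))
        (\<lambda>(p, s). density (count_space UNIV)
           (\<lambda>j. ennreal (if j \<in> s ` {..<k} then 0
                         else p j / (\<Sum>i. if i \<in> s ` {..<k} then 0 else p i))))
        (\<sigma> k) (count_space UNIV))"

section \<open>The variables R and N\<close>

definition gen_stirling :: "real \<Rightarrow> nat \<Rightarrow> nat \<Rightarrow> real" where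
  "gen_stirling \<alpha> m k =
     1 / (\<alpha> ^ k * fact k) *
     (\<Sum>j=1..k. (-1) ^ j * real (k choose j) * pochhammer (- (real j * \<alpha>)) m)"

definition block_prob :: "real \<Rightarrow> nat \<Rightarrow> nat \<Rightarrow> real" where
  "block_prob \<alpha> m k = \<alpha> ^ (k - 1) * Gamma (real k) / Gamma (real m) * gen_stirling \<alpha> m k"

(* E[S^m exp(-lam S)] = alpha exp(-lam^alpha) lam^(alpha - m) Omega alpha m (lam^alpha)
   for S positive alpha-stable. *)
definition Omega :: "real \<Rightarrow> nat \<Rightarrow> real \<Rightarrow> real" where
  "Omega \<alpha> m x =
     (if m = 0 then 1 / (\<alpha> * x)
      else Gamma (real m) * (\<Sum>l=1..m. block_prob \<alpha> m l * x ^ (l - 1) / Gamma (real l)))"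

definition beta_law :: "real \<Rightarrow> real \<Rightarrow> real measure" where
  "beta_law a b =
     density lborel
       (\<lambda>x. ennreal (indicator {0<..<1} x * (x powr (a - 1) * (1 - x) powr (b - 1) / Beta a b)))"

definition beta_moment :: "real \<Rightarrow> nat \<Rightarrow> real \<Rightarrow> real" where
  "beta_moment \<alpha> m r = (\<integral>b. (b * (1 - r) + r) ^ (m - 1) \<partial>beta_law (1 - \<alpha>) \<alpha>)"

definition f_R1 :: "real \<Rightarrow> real \<Rightarrow> real \<Rightarrow> real" where
  "f_R1 \<alpha> lam r =
     \<alpha> * lam powr \<alpha> * exp (lam powr \<alpha>) * exp (- (lam powr \<alpha> / r powr \<alpha>)) * r powr (- \<alpha> - 1)"

definition f_R :: "real \<Rightarrow> nat \<Rightarrow> real \<Rightarrow> real \<Rightarrow> real" where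
  "f_R \<alpha> m lam r =
     Omega \<alpha> m (lam powr \<alpha> / r powr \<alpha>) / Omega \<alpha> m (lam powr \<alpha>) * beta_moment \<alpha> m r * f_R1 \<alpha> lam r"

definition R_law :: "real \<Rightarrow> nat \<Rightarrow> real \<Rightarrow> real measure" where
  "R_law \<alpha> m lam = density lborel (\<lambda>r. ennreal (indicator {0<..<1} r * f_R \<alpha> m lam r))"

definition N_prob :: "real \<Rightarrow> nat \<Rightarrow> real \<Rightarrow> nat \<Rightarrow> real" where
  "N_prob \<alpha> m r k =
     Gamma (real k - \<alpha>) / (Gamma (real k) * Gamma (1 - \<alpha>)) * real ((m - 1) choose (k - 1))
       * (1 - r) ^ (k - 1) * r ^ (m - k) / beta_moment \<alpha> m r"

definition N_law :: "real \<Rightarrow> nat \<Rightarrow> real \<Rightarrow> nat measure" where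
  "N_law \<alpha> m r =
     density (count_space UNIV) (\<lambda>k. ennreal (if k \<in> {1..m} then N_prob \<alpha> m r k else 0))"

definition RN_sequence ::
  "'a measure \<Rightarrow> real \<Rightarrow> nat \<Rightarrow> real \<Rightarrow> (nat \<Rightarrow> 'a \<Rightarrow> real) \<Rightarrow> (nat \<Rightarrow> 'a \<Rightarrow> nat) \<Rightarrow> bool"
where
  "RN_sequence M \<alpha> m lam R N \<longleftrightarrow>
     (\<forall>l. cond_law M (\<lambda>\<omega>. \<lambda>i\<in>{..<l}. R i \<omega>) (\<Pi>\<^sub>M i\<in>{..<l}. borel)
            (\<lambda>r. R_law \<alpha> m (lam / (\<Prod>i<l. r i))) (R l) borel) \<and>
     cond_indep_laws M (\<lambda>\<omega> l. R l \<omega>) real_seq (\<lambda>l r. N_law \<alpha> m (r l)) N (count_space UNIV)"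

section \<open>The conditional densities of the W variables\<close>

definition W_density :: "real \<Rightarrow> nat \<Rightarrow> real \<Rightarrow> real \<Rightarrow> real" where
  "W_density \<alpha> m r w =
     1 / (Gamma (1 - \<alpha>) * Gamma \<alpha>) *
     (w powr (- real m) * (1 - w) powr (- \<alpha>) * (w - r) powr (\<alpha> - 1) * r powr (real m - \<alpha>)
       / beta_moment \<alpha> m r)"

definition W_component_density :: "real \<Rightarrow> nat \<Rightarrow> real \<Rightarrow> real \<Rightarrow> real" where
  "W_component_density \<alpha> k r w =
     Gamma (real k) / (Gamma (real k - \<alpha>) * Gamma \<alpha>) *
     (w powr (- real k) * (1 - w) powr (real k - \<alpha> - 1) * (w - r) powr (\<alpha> - 1)
       * r powr (real k - \<alpha>) * (1 - r) powr (1 - real k))"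

definition W_of :: "real \<Rightarrow> real \<Rightarrow> real" where
  "W_of b r = inverse (b * ((1 - r) / r) + 1)"

end

theory Submission
  imports Defs
begin

text \<open>Write \<open>A\<close> for the ranked jumps, \<open>S\<close> for their sum and \<open>\<rho>\<close> for the Levy density. By definition
  the masses \<open>P\<close> have the law of \<open>A / S\<close> when the underlying probability is weighted proportionally
  to \<open>S^m exp (- lam S)\<close>. Size-biased sampling is insensitive to scale, so the picks may be made from
  the jumps themselves, and the sampled sequence is determined by the ratios \<open>W\<close>, where each ratio
  compares the mass left after a pick with the mass left before it. The theorem is therefore about the joint
  law of these ratios.

  The reason for the structure is Mecke's equation (\<open>mecke\<close>): in expectations of sums over all jumps, the pair
  of a jump and the remaining configuration may be replaced by an independent pair, in which the jump has
  intensity \<open>\<rho>\<close> and the configuration its original law. Hence, when the first pick \<open>x\<close> is removed and \<open>s\<close> is the sum of the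
  other jumps, the weight \<open>x / (x + s)\<close> of a size-biased pick turns the density into
  \<open>x \<rho>(x) (x + s)^(m-1) exp (- lam (x + s))\<close>, and the remaining configuration is otherwise distributed like
  \<open>A\<close>. In the variable \<open>w = s / (x + s)\<close> the dependence on \<open>s\<close> is through
  \<open>s^(m-\<alpha>) exp (- lam s / w)\<close>. The factor \<open>s^(-\<alpha>)\<close> is a Gamma integral, and inserting it gives a mixture over
  \<open>r < w\<close> of \<open>s^m exp (- (lam / r) s)\<close>, which is the original weight with \<open>lam / r\<close> instead of \<open>lam\<close>. The
  mixing measure factors as \<open>R_law\<close> for \<open>r\<close> times \<open>W_density\<close> for \<open>w\<close> given \<open>r\<close>
  (\<open>size_biased_jump_kernel\<close>). So given \<open>R = r\<close> the first ratio is independent of what is left, and what is left is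
  again a configuration of the same kind with parameter \<open>lam / r\<close>. Iteration yields the chain \<open>R\<close> and the
  conditional independence of the ratios (\<open>size_biased_tilted_expectation\<close>).

  The normalising constants are the moments of the tilted stable law, that is, up to sign, the
  derivatives of \<open>exp (- lam^\<alpha>)\<close>; the recurrence of the generalised Stirling numbers identifies them with
  \<open>Omega\<close> (\<open>stable_moment_eq\<close>). The mixture form of \<open>W_density\<close> is the binomial theorem for
  \<open>(w + (1 - w))^(m-1)\<close>, and its components are images of Beta laws (\<open>distr_W_of_beta_law\<close>).

  Conversely the sequences \<open>R\<close>, \<open>N\<close> and the Beta variables are constructed on one space
  (\<open>exists_R_N_beta_sequences\<close>): first the chain \<open>R\<close>, then \<open>N\<close> and the Beta variables as conditionally independent
  extensions. The ratios built from them have the same cylinder probabilities as those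
  of the size-biased sequence, so the two sequences have the same law.\<close>

section \<open>Beta laws and the mixture of densities\<close>

text \<open>The change of variables formula for absolutely integrable functions says that one side is integrable
  if and only if the other is, with equal integrals. For indicator functions this already gives equality of
  the two measures, including the value \<open>\<infinity>\<close>.\<close>
lemma nn_integral_change_of_variables:
  fixes g g' :: "real \<Rightarrow> real" and h :: "real \<Rightarrow> ennreal"
  assumes S [measurable]: "S \<in> sets borel" and gS [measurable]: "g ` S \<in> sets borel"
    and g [measurable]: "g \<in> borel_measurable borel" and g' [measurable]: "g' \<in> borel_measurable borel"
    and der: "\<And>x. x \<in> S \<Longrightarrow> (g has_field_derivative g' x) (at x within S)"
    and inj: "inj_on g S" and h [measurable]: "h \<in> borel_measurable borel"
  shows "(\<integral>\<^sup>+y. indicator (g ` S) y * h y \<partial>lborel) =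
         (\<integral>\<^sup>+x. indicator S x * (ennreal \<bar>g' x\<bar> * h (g x)) \<partial>lborel)"
proof -
  have eq: "density lborel (indicator (g ` S)) =
      distr (density lborel (\<lambda>x. indicator S x * ennreal \<bar>g' x\<bar>)) borel g"
  proof (rule measure_eqI)
    fix A :: "real set" assume "A \<in> sets (density lborel (indicator (g ` S)))"
    then have A [measurable]: "A \<in> sets borel" by simp
    define F where "F y = indicator (g ` S) y * (indicator A y :: real)" for y
    define G where "G x = indicator S x * (\<bar>g' x\<bar> * indicator A (g x))" for x
    have Fm [measurable]: "F \<in> borel_measurable borel" and Gm [measurable]: "G \<in> borel_measurable borel"
      unfolding F_def G_def by measurable
    have gA [measurable]: "g -` A \<in> sets borel" using measurable_sets[OF g A] by simp
    have F0: "0 \<le> F y" and G0: "0 \<le> G y" for y by (auto simp: F_def G_def indicator_def)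
    have F1: "((indicator A :: real \<Rightarrow> real) absolutely_integrable_on g ` S) = integrable lborel F"
      unfolding set_integrable_def F_def real_scaleR_def
      by (subst integrable_completion) auto
    have F2: "integral (g ` S) (indicator A :: real \<Rightarrow> real) = integral\<^sup>L lborel F" if "integrable lborel F"
    proof -
      have "integral (g ` S) (indicator A :: real \<Rightarrow> real) = (LINT x:g ` S|lebesgue. indicator A x)"
        by (rule set_lebesgue_integral_eq_integral(2)[symmetric]) (use F1 that in auto)
      also have "\<dots> = integral\<^sup>L lborel F"
        unfolding set_lebesgue_integral_def F_def real_scaleR_def
        by (subst integral_completion) auto
      finally show ?thesis .
    qed
    have G1: "((\<lambda>x. \<bar>g' x\<bar> *\<^sub>R (indicator A (g x) :: real)) absolutely_integrable_on S) = integrable lborel G"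
      unfolding set_integrable_def G_def real_scaleR_def
      by (subst integrable_completion) auto
    have G2: "integral S (\<lambda>x. \<bar>g' x\<bar> *\<^sub>R (indicator A (g x) :: real)) = integral\<^sup>L lborel G" if "integrable lborel G"
    proof -
      have "integral S (\<lambda>x. \<bar>g' x\<bar> *\<^sub>R (indicator A (g x) :: real)) = (LINT x:S|lebesgue. \<bar>g' x\<bar> *\<^sub>R indicator A (g x) :: real)"
        by (rule set_lebesgue_integral_eq_integral(2)[symmetric]) (use G1 that in auto)
      also have "\<dots> = integral\<^sup>L lborel G"
        unfolding set_lebesgue_integral_def G_def real_scaleR_def
        by (subst integral_completion) auto
      finally show ?thesis .
    qed
    have key: "((\<lambda>x. \<bar>g' x\<bar> *\<^sub>R (indicator A (g x) :: real)) absolutely_integrable_on S \<and>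
          integral S (\<lambda>x. \<bar>g' x\<bar> *\<^sub>R indicator A (g x)) = b) \<longleftrightarrow>
        ((indicator A :: real \<Rightarrow> real) absolutely_integrable_on g ` S \<and> integral (g ` S) (indicator A :: real \<Rightarrow> real) = b)" for b
      unfolding real_scaleR_def using S by (intro has_absolute_integral_change_of_variables_1'[OF _ der inj]) auto
    have *: "(\<integral>\<^sup>+y. F y \<partial>lborel) = (\<integral>\<^sup>+x. G x \<partial>lborel)"
    proof (cases "integrable lborel F")
      case True
      then have "integrable lborel G" "integral\<^sup>L lborel G = integral\<^sup>L lborel F"
        using key[of "integral\<^sup>L lborel F"] F1 F2 G1 G2 by auto
      then show ?thesis using True F0 G0
        by (subst (1 2) nn_integral_eq_integral) auto
    next
      case False
      then have "\<not> integrable lborel G" using key F1 G1 by blast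
      then show ?thesis using False F0 G0
        by (auto simp: integrable_iff_bounded not_less top_unique)
    qed
    have "emeasure (density lborel (indicator (g ` S))) A = (\<integral>\<^sup>+y. F y \<partial>lborel)"
      by (auto simp: emeasure_density F_def intro!: nn_integral_cong split: split_indicator)
    also note *
    also have "(\<integral>\<^sup>+x. G x \<partial>lborel) =
      emeasure (distr (density lborel (\<lambda>x. indicator S x * ennreal \<bar>g' x\<bar>)) borel g) A"
      by (subst emeasure_distr)
         (auto simp: emeasure_density G_def intro!: nn_integral_cong split: split_indicator)
    finally show "emeasure (density lborel (indicator (g ` S))) A =
      emeasure (distr (density lborel (\<lambda>x. indicator S x * ennreal \<bar>g' x\<bar>)) borel g) A" .
  qed simp
  have "(\<integral>\<^sup>+y. indicator (g ` S) y * h y \<partial>lborel) = (\<integral>\<^sup>+y. h y \<partial>density lborel (indicator (g ` S)))"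
    by (subst nn_integral_density) auto
  also have "\<dots> = (\<integral>\<^sup>+x. indicator S x * ennreal \<bar>g' x\<bar> * h (g x) \<partial>lborel)"
    unfolding eq by (subst nn_integral_distr, simp, simp) (subst nn_integral_density, auto)
  finally show ?thesis by (simp add: mult.assoc)
qed

lemma nn_integral_Beta_density:
  assumes "0 < a" "0 < b"
  shows "(\<integral>\<^sup>+x. ennreal (indicator {0<..<1} x * (x powr (a - 1) * (1 - x) powr (b - 1))) \<partial>lborel) = ennreal (Beta a b)"
proof -
  have "((\<lambda>x. x powr (a - 1) * (1 - x) powr (b - 1)) has_integral Beta a b) {0<..<1}"
    using has_integral_Beta_real[of a b] assms by (simp add: has_integral_Icc_iff_Ioo)
  from nn_integral_has_integral_lebesgue[OF _ this] show ?thesis by (simp add: )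
qed

lemma Beta_real_pos: "0 < a \<Longrightarrow> 0 < b \<Longrightarrow> 0 < Beta a (b :: real)"
  by (simp add: Beta_def Gamma_real_pos)

lemma sets_beta_law [measurable_cong, simp]: "sets (beta_law a b) = sets borel"
  by (simp add: beta_law_def)

lemma prob_space_beta_law:
  assumes "0 < a" "0 < b"
  shows "prob_space (beta_law a b)"
proof
  have "emeasure (beta_law a b) (space (beta_law a b)) =
      (\<integral>\<^sup>+x. ennreal (1 / Beta a b) * ennreal (indicator {0<..<1} x * (x powr (a - 1) * (1 - x) powr (b - 1))) \<partial>lborel)"
    unfolding beta_law_def using Beta_real_pos[OF assms]
    by (subst emeasure_density)
       (auto intro!: nn_integral_cong simp: ennreal_mult[symmetric] split: split_indicator)
  also have "\<dots> = ennreal (1 / Beta a b) * ennreal (Beta a b)"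
    by (subst nn_integral_cmult) (auto simp: nn_integral_Beta_density[OF assms])
  also have "\<dots> = 1" using Beta_real_pos[OF assms] by (simp add: ennreal_mult[symmetric])
  finally show "emeasure (beta_law a b) (space (beta_law a b)) = 1" .
qed

lemma beta_law_moment:
  fixes \<alpha> :: real
  assumes "0 < \<alpha>" "\<alpha> < 1"
  shows "integrable (beta_law (1 - \<alpha>) \<alpha>) (\<lambda>b. b ^ j)"
    and "(\<integral>b. b ^ j \<partial>beta_law (1 - \<alpha>) \<alpha>) = Gamma (real (Suc j) - \<alpha>) / (Gamma (real (Suc j)) * Gamma (1 - \<alpha>))"
proof -
  have "(\<integral>\<^sup>+b. ennreal (b ^ j) \<partial>beta_law (1 - \<alpha>) \<alpha>) =
     (\<integral>\<^sup>+x. ennreal (1 / Beta (1 - \<alpha>) \<alpha>) * ennreal (indicator {0<..<1} x * (x powr (real (Suc j) - \<alpha> - 1) * (1 - x) powr (\<alpha> - 1))) \<partial>lborel)"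
    unfolding beta_law_def using Beta_real_pos[of "1 - \<alpha>" \<alpha>] assms
    by (subst nn_integral_density)
       (auto intro!: nn_integral_cong split: split_indicator
         simp: ennreal_mult[symmetric] powr_realpow[symmetric] powr_add[symmetric] algebra_simps)
  also have "\<dots> = ennreal (1 / Beta (1 - \<alpha>) \<alpha>) * ennreal (Beta (real (Suc j) - \<alpha>) \<alpha>)"
    using assms by (subst nn_integral_cmult) (auto simp: nn_integral_Beta_density simp del: of_nat_Suc)
  also have "\<dots> = ennreal (Beta (real (Suc j) - \<alpha>) \<alpha> / Beta (1 - \<alpha>) \<alpha>)"
    using assms Beta_real_pos[of "1 - \<alpha>" \<alpha>] Beta_real_pos[of "real (Suc j) - \<alpha>" \<alpha>]
    by (simp add: ennreal_mult[symmetric])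
  also have "Beta (real (Suc j) - \<alpha>) \<alpha> / Beta (1 - \<alpha>) \<alpha> =
      Gamma (real (Suc j) - \<alpha>) / (Gamma (real (Suc j)) * Gamma (1 - \<alpha>))"
    using less_imp_neq[OF Gamma_real_pos[of \<alpha>]] assms by (simp add: Beta_def divide_simps)
  finally have *: "(\<integral>\<^sup>+b. ennreal (b ^ j) \<partial>beta_law (1 - \<alpha>) \<alpha>) =
     ennreal (Gamma (real (Suc j) - \<alpha>) / (Gamma (real (Suc j)) * Gamma (1 - \<alpha>)))" .
  have AE: "AE b in beta_law (1 - \<alpha>) \<alpha>. 0 \<le> b ^ j"
    unfolding beta_law_def by (subst AE_density) (auto split: split_indicator)
  have "0 \<le> Gamma (real (Suc j) - \<alpha>) / (Gamma (real (Suc j)) * Gamma (1 - \<alpha>))"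
    using Gamma_real_pos[of "real (Suc j) - \<alpha>"] Gamma_real_pos[of "real (Suc j)"]
      Gamma_real_pos[of "1 - \<alpha>"] assms by (simp add: less_imp_le)
  from nn_integral_eq_integrable[of "\<lambda>b. b ^ j" "beta_law (1 - \<alpha>) \<alpha>", OF _ AE this] *
  show "integrable (beta_law (1 - \<alpha>) \<alpha>) (\<lambda>b. b ^ j)"
    and "(\<integral>b. b ^ j \<partial>beta_law (1 - \<alpha>) \<alpha>) = Gamma (real (Suc j) - \<alpha>) / (Gamma (real (Suc j)) * Gamma (1 - \<alpha>))"
    by auto
qed

text \<open>The binomial expansion of the moment; its terms are the numerators of \<open>N_prob\<close>, which is why
  these probabilities add up to one.\<close>
lemma beta_moment_eq_sum:
  assumes "0 < \<alpha>" "\<alpha> < 1" "1 \<le> m"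
  shows "beta_moment \<alpha> m r =
    (\<Sum>k=1..m. Gamma (real k - \<alpha>) / (Gamma (real k) * Gamma (1 - \<alpha>)) * real ((m - 1) choose (k - 1))
       * (1 - r) ^ (k - 1) * r ^ (m - k))"
proof -
  have "beta_moment \<alpha> m r = (\<integral>b. (\<Sum>j\<le>m - 1. (real ((m - 1) choose j) * (1 - r) ^ j * r ^ (m - 1 - j)) * b ^ j) \<partial>beta_law (1 - \<alpha>) \<alpha>)"
    unfolding beta_moment_def by (subst binomial_ring) (simp add: power_mult_distrib mult_ac)
  also have "\<dots> = (\<Sum>j\<le>m - 1. (real ((m - 1) choose j) * (1 - r) ^ j * r ^ (m - 1 - j)) *
      (Gamma (real (Suc j) - \<alpha>) / (Gamma (real (Suc j)) * Gamma (1 - \<alpha>))))"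
    by (subst Bochner_Integration.integral_sum)
       (simp_all add: beta_law_moment[OF assms(1,2)] del: of_nat_Suc)
  also have "\<dots> = (\<Sum>k=1..m. Gamma (real k - \<alpha>) / (Gamma (real k) * Gamma (1 - \<alpha>)) * real ((m - 1) choose (k - 1))
       * (1 - r) ^ (k - 1) * r ^ (m - k))"
    using assms(3)
    by (intro sum.reindex_bij_witness[of _ "\<lambda>k. k - 1" Suc]) (auto simp: mult_ac simp del: of_nat_Suc)
  finally show ?thesis .
qed

lemma beta_moment_pos:
  assumes "0 < \<alpha>" "\<alpha> < 1" "1 \<le> m" "0 < r" "r < 1"
  shows "0 < beta_moment \<alpha> m r"
  unfolding beta_moment_eq_sum[OF assms(1-3)]
  using assms by (intro sum_pos) (auto intro!: mult_pos_pos divide_pos_pos Gamma_real_pos)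

lemma N_prob_nonneg:
  assumes "0 < \<alpha>" "\<alpha> < 1" "1 \<le> m" "0 < r" "r < 1" "1 \<le> k"
  shows "0 \<le> N_prob \<alpha> m r k"
  using beta_moment_pos[OF assms(1-5)] assms unfolding N_prob_def
  by (intro divide_nonneg_pos mult_nonneg_nonneg mult_pos_pos) (auto intro!: less_imp_le Gamma_real_pos)

lemma sum_N_prob:
  assumes "0 < \<alpha>" "\<alpha> < 1" "1 \<le> m" "0 < r" "r < 1"
  shows "(\<Sum>k=1..m. N_prob \<alpha> m r k) = 1"
proof -
  have "(\<Sum>k=1..m. N_prob \<alpha> m r k) = beta_moment \<alpha> m r / beta_moment \<alpha> m r"
    unfolding N_prob_def sum_divide_distrib[symmetric] using beta_moment_eq_sum[OF assms(1-3), of r] by simp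
  then show ?thesis using beta_moment_pos[OF assms] by simp
qed

text \<open>The powers of \<open>r\<close> and \<open>1 - r\<close> in \<open>N_prob\<close> cancel those of the component densities, and what depends
  on \<open>k\<close> is summed by the binomial theorem for \<open>((1 - w) + w)^(m-1)\<close>.\<close>
lemma W_density_mixture:
  assumes "0 < \<alpha>" "\<alpha> < 1" "1 \<le> m" "0 < r" "r < w" "w < 1"
  shows "W_density \<alpha> m r w = (\<Sum>k=1..m. N_prob \<alpha> m r k * W_component_density \<alpha> k r w)"
proof -
  define c where "c = 1 / (Gamma (1 - \<alpha>) * Gamma \<alpha>) * (1 - w) powr (- \<alpha>) * (w - r) powr (\<alpha> - 1)
    * r powr (real m - \<alpha>) / beta_moment \<alpha> m r"
  have pos: "0 < w" "0 < 1 - w" "0 < 1 - r" "0 < beta_moment \<alpha> m r"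
    using assms beta_moment_pos[of \<alpha> m r] by auto
  have "N_prob \<alpha> m r k * W_component_density \<alpha> k r w =
      c * (w powr - real m * (real ((m - 1) choose (k - 1)) * (1 - w) ^ (k - 1) * w ^ (m - k)))"
    if k: "k \<in> {1..m}" for k
  proof -
    have G: "Gamma (real k - \<alpha>) > 0" "Gamma (real k) > 0"
      using k assms by (auto intro!: Gamma_real_pos)
    have 1: "(1 - r) ^ (k - 1) * (1 - r) powr (1 - real k) = 1"
      using pos k by (simp add: powr_realpow[symmetric] powr_add[symmetric])
    have 2: "r ^ (m - k) * r powr (real k - \<alpha>) = r powr (real m - \<alpha>)"
      using assms k by (simp add: powr_realpow[symmetric] powr_add[symmetric] of_nat_diff)
    have 3: "(1 - w) powr (real k - \<alpha> - 1) = (1 - w) powr (- \<alpha>) * (1 - w) ^ (k - 1)"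
      using pos k by (simp add: powr_realpow[symmetric] powr_add[symmetric] of_nat_diff algebra_simps)
    have 4: "w powr (- real k) = w powr - real m * w ^ (m - k)"
      using pos k by (simp add: powr_realpow[symmetric] powr_add[symmetric] of_nat_diff)
    have "N_prob \<alpha> m r k * W_component_density \<alpha> k r w =
      1 / (Gamma (1 - \<alpha>) * Gamma \<alpha>) * real ((m - 1) choose (k - 1)) *
       ((1 - r) ^ (k - 1) * (1 - r) powr (1 - real k)) * (r ^ (m - k) * r powr (real k - \<alpha>)) *
       (1 - w) powr (real k - \<alpha> - 1) * w powr (- real k) * (w - r) powr (\<alpha> - 1) / beta_moment \<alpha> m r"
      unfolding N_prob_def W_component_density_def using G pos by (simp add: field_simps)
    also have "\<dots> = c * (w powr - real m * (real ((m - 1) choose (k - 1)) * (1 - w) ^ (k - 1) * w ^ (m - k)))"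
      unfolding 1 2 3 4 c_def by (simp add: mult_ac)
    finally show ?thesis .
  qed
  then have "(\<Sum>k=1..m. N_prob \<alpha> m r k * W_component_density \<alpha> k r w) =
    c * (w powr - real m * (\<Sum>k=1..m. real ((m - 1) choose (k - 1)) * (1 - w) ^ (k - 1) * w ^ (m - k)))"
    by (simp add: sum_distrib_left)
  also have "(\<Sum>k=1..m. real ((m - 1) choose (k - 1)) * (1 - w) ^ (k - 1) * w ^ (m - k)) =
     (\<Sum>j\<le>m - 1. real ((m - 1) choose j) * (1 - w) ^ j * w ^ (m - 1 - j))"
    using assms(3)
    by (intro sum.reindex_bij_witness[of _ Suc "\<lambda>k. k - 1"]) auto
  also have "\<dots> = ((1 - w) + w) ^ (m - 1)"
    by (rule binomial_ring[symmetric])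
  finally show ?thesis by (simp add: c_def W_density_def mult_ac)
qed

lemma W_component_density_nonneg:
  "0 < \<alpha> \<Longrightarrow> \<alpha> < 1 \<Longrightarrow> 1 \<le> k \<Longrightarrow> 0 \<le> W_component_density \<alpha> k r w"
  unfolding W_component_density_def
  by (intro mult_nonneg_nonneg divide_nonneg_nonneg powr_ge_zero mult_nonneg_nonneg less_imp_le Gamma_real_pos) auto

lemma W_component_density_measurable [measurable]:
  "W_component_density \<alpha> k r \<in> borel_measurable borel"
  unfolding W_component_density_def by measurable

text \<open>The substitution \<open>b = r (1 - w) / (w (1 - r))\<close> inverts \<open>W_of\<close> and carries the Beta density
  to the component density.\<close>
lemma distr_W_of_beta_law:
  assumes "0 < \<alpha>" "\<alpha> < 1" "1 \<le> k" and r: "0 < r" "r < 1"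
  shows "distr (beta_law (real k - \<alpha>) \<alpha>) borel (\<lambda>b. W_of b r) =
      density lborel (\<lambda>w. ennreal (indicator {r<..<1} w * W_component_density \<alpha> k r w))"
proof (rule measure_eqI)
  fix A assume "A \<in> sets (distr (beta_law (real k - \<alpha>) \<alpha>) borel (\<lambda>b. W_of b r))"
  then have A [measurable]: "A \<in> sets borel" by simp
  have Wm [measurable]: "(\<lambda>b. W_of b r) \<in> borel_measurable borel" unfolding W_of_def by measurable
  have WA [measurable]: "(\<lambda>b. W_of b r) -` A \<in> sets borel" using measurable_sets[OF Wm A] by simp
  define g where "g w = r / (1 - r) * (1 / w - 1)" for w
  define g' where "g' w = - r / (w\<^sup>2 * (1 - r))" for w
  have g_eq: "g w = r * (1 - w) / (w * (1 - r))" if "0 < w" for w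
    using that r by (simp add: g_def field_simps)
  have gm [measurable]: "g \<in> borel_measurable borel" "g' \<in> borel_measurable borel"
    unfolding g_def g'_def by measurable
  have Wg: "W_of (g w) r = w" if "w \<in> {r<..<1}" for w
    using that r by (simp add: W_of_def g_eq field_simps)
  have g01: "g w \<in> {0<..<1}" if "w \<in> {r<..<1}" for w
  proof -
    have "r * (1 - w) < w * (1 - r)" using that by (simp add: algebra_simps)
    then show ?thesis using that r by (auto simp: g_eq divide_simps)
  qed
  have gW: "g (W_of b r) = b" "W_of b r \<in> {r<..<1}" if "b \<in> {0<..<1}" for b
  proof -
    have e: "W_of b r = r / (b * (1 - r) + r)" using r by (simp add: W_of_def field_simps)
    have p: "0 < b * (1 - r)" using that r by simp
    have "b * (1 - r) < 1 * (1 - r)" using that r by (intro mult_strict_right_mono) auto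
    then have p2: "b * (1 - r) + r < 1" by simp
    have "r * (b * (1 - r) + r) < r" using p2 r by simp
    then show "W_of b r \<in> {r<..<1}" unfolding e using p r by (auto simp: divide_simps)
    have "1 - W_of b r = b * (1 - r) / (b * (1 - r) + r)"
      unfolding e using p r by (simp add: field_simps)
    then have "g (W_of b r) = r * (b * (1 - r) / (b * (1 - r) + r)) / (r / (b * (1 - r) + r) * (1 - r))"
      using e p r by (subst g_eq) auto
    also have "\<dots> = b" using p r add_pos_pos[OF p r(1)]
      by (simp only: times_divide_eq_left times_divide_eq_right divide_divide_eq_left divide_divide_eq_right) simp
    finally show "g (W_of b r) = b" .
  qed
  have img: "g ` {r<..<1} = {0<..<1}"
  proof
    show "g ` {r<..<1} \<subseteq> {0<..<1}" using g01 by blast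
    show "{0<..<1} \<subseteq> g ` {r<..<1}" using gW by (metis image_eqI subsetI)
  qed
  have inj: "inj_on g {r<..<1}" by (rule inj_on_inverseI[of _ "\<lambda>b. W_of b r"]) (rule Wg)
  have der: "(g has_field_derivative g' w) (at w within {r<..<1})" if "w \<in> {r<..<1}" for w
    unfolding g_def g'_def using that r
    by (auto intro!: derivative_eq_intros simp: power2_eq_square)
  have k: "real k - \<alpha> > 0" using assms by linarith
  have dens: "\<bar>g' w\<bar> * (g w powr (real k - \<alpha> - 1) * (1 - g w) powr (\<alpha> - 1) / Beta (real k - \<alpha>) \<alpha>)
     = W_component_density \<alpha> k r w" if w: "w \<in> {r<..<1}" for w
  proof -
    have w0: "0 < w" "0 < 1 - w" "0 < 1 - r" "0 < w - r" using w r by auto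
    have 1: "1 - g w = (w - r) / (w * (1 - r))" using w0 by (simp add: g_eq field_simps)
    have gen: "(x / y) powr p = x powr p * y powr (- p)" for x y p :: real
      unfolding powr_divide powr_minus by (rule divide_inverse)
    have 2: "g w powr (real k - \<alpha> - 1) = r powr (real k - \<alpha> - 1) * (1 - w) powr (real k - \<alpha> - 1)
       * w powr (- (real k - \<alpha> - 1)) * (1 - r) powr (- (real k - \<alpha> - 1))"
      unfolding g_eq[OF w0(1)] gen powr_mult by (simp only: mult.assoc)
    have 3: "(1 - g w) powr (\<alpha> - 1) = (w - r) powr (\<alpha> - 1) * w powr (- (\<alpha> - 1)) * (1 - r) powr (- (\<alpha> - 1))"
      unfolding 1 gen powr_mult by (simp only: mult.assoc)
    have 4: "\<bar>g' w\<bar> = r powr 1 * w powr (-2) * (1 - r) powr (-1)"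
      unfolding g'_def using w0 r
      by (simp add: powr_minus divide_inverse abs_mult)
    have e1: "w powr (- (real k - \<alpha> - 1)) * w powr (- (\<alpha> - 1)) * w powr (-2) = w powr (- real k)"
      unfolding powr_add[symmetric] by (rule arg_cong[where f = "\<lambda>e. w powr e"]) simp
    have e2: "(1 - r) powr (- (real k - \<alpha> - 1)) * (1 - r) powr (- (\<alpha> - 1)) * (1 - r) powr (-1) = (1 - r) powr (1 - real k)"
      unfolding powr_add[symmetric] by (rule arg_cong[where f = "\<lambda>e. (1 - r) powr e"]) simp
    have e3: "r powr (real k - \<alpha> - 1) * r powr 1 = r powr (real k - \<alpha>)"
      unfolding powr_add[symmetric] by (rule arg_cong[where f = "\<lambda>e. r powr e"]) simp
    have "\<bar>g' w\<bar> * (g w powr (real k - \<alpha> - 1) * (1 - g w) powr (\<alpha> - 1) / Beta (real k - \<alpha>) \<alpha>) =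
      (r powr (real k - \<alpha> - 1) * r powr 1) * (w powr (- (real k - \<alpha> - 1)) * w powr (- (\<alpha> - 1)) * w powr (-2))
       * ((1 - r) powr (- (real k - \<alpha> - 1)) * (1 - r) powr (- (\<alpha> - 1)) * (1 - r) powr (-1))
       * (1 - w) powr (real k - \<alpha> - 1) * (w - r) powr (\<alpha> - 1) / Beta (real k - \<alpha>) \<alpha>"
      unfolding 2 3 4 by (simp only: mult_ac times_divide_eq_right times_divide_eq_left)
    also have "\<dots> = W_component_density \<alpha> k r w"
      unfolding e1 e2 e3 W_component_density_def
      by (simp add: Beta_def mult_ac)
    finally show ?thesis .
  qed
  define h where "h b = ennreal (b powr (real k - \<alpha> - 1) * (1 - b) powr (\<alpha> - 1) / Beta (real k - \<alpha>) \<alpha>)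
     * indicator A (W_of b r)" for b
  have hm [measurable]: "h \<in> borel_measurable borel" unfolding h_def by measurable
  have "emeasure (distr (beta_law (real k - \<alpha>) \<alpha>) borel (\<lambda>b. W_of b r)) A =
     (\<integral>\<^sup>+b. indicator (g ` {r<..<1}) b * h b \<partial>lborel)"
    unfolding beta_law_def img h_def
    by (subst emeasure_distr)
       (auto simp: emeasure_density intro!: nn_integral_cong split: split_indicator)
  also have "\<dots> = (\<integral>\<^sup>+w. indicator {r<..<1} w * (ennreal \<bar>g' w\<bar> * h (g w)) \<partial>lborel)"
    using img inj der by (intro nn_integral_change_of_variables) auto
  also have "\<dots> = (\<integral>\<^sup>+w. ennreal (indicator {r<..<1} w * W_component_density \<alpha> k r w) * indicator A w \<partial>lborel)"
  proof (rule nn_integral_cong)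
    fix w
    show "indicator {r<..<1} w * (ennreal \<bar>g' w\<bar> * h (g w)) =
      ennreal (indicator {r<..<1} w * W_component_density \<alpha> k r w) * indicator A w"
    proof (cases "w \<in> {r<..<1}")
      case True
      show ?thesis unfolding h_def Wg[OF True] dens[OF True, symmetric] mult.assoc[symmetric]
        using True Beta_real_pos[OF k assms(1)]
        by (simp add: ennreal_mult'[symmetric])
    qed simp
  qed
  also have "\<dots> = emeasure (density lborel (\<lambda>w. ennreal (indicator {r<..<1} w * W_component_density \<alpha> k r w))) A"
    by (subst emeasure_density) auto
  finally show "emeasure (distr (beta_law (real k - \<alpha>) \<alpha>) borel (\<lambda>b. W_of b r)) A =
    emeasure (density lborel (\<lambda>w. ennreal (indicator {r<..<1} w * W_component_density \<alpha> k r w))) A" .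
qed simp

section \<open>Moments of the tilted stable law\<close>

lemma gen_stirling_0 [simp]: "gen_stirling \<alpha> m 0 = 0"
  by (simp add: gen_stirling_def)

text \<open>Split the last factor of the rising factorial as \<open>m - j \<alpha> = (m - (k+1) \<alpha>) + (k + 1 - j) \<alpha>\<close> and absorb
  \<open>k + 1 - j\<close> into the binomial coefficient.\<close>
lemma gen_stirling_Suc:
  assumes "\<alpha> \<noteq> 0"
  shows "gen_stirling \<alpha> (Suc m) (Suc k) =
     (real m - real (Suc k) * \<alpha>) * gen_stirling \<alpha> m (Suc k) + gen_stirling \<alpha> m k"
proof -
  define p where "p j = pochhammer (- (real j * \<alpha>)) m" for j
  define c where "c = \<alpha> ^ Suc k * fact (Suc k)"
  have split: "(-1) ^ j * real (Suc k choose j) * pochhammer (- (real j * \<alpha>)) (Suc m) =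
     (real m - real (Suc k) * \<alpha>) * ((-1) ^ j * real (Suc k choose j) * p j) +
     (\<alpha> * real (Suc k)) * ((-1) ^ j * real (k choose j) * p j)" (is "?l = ?r") if "j \<in> {1..Suc k}" for j
  proof -
    have b: "real (Suc k choose j) * (real (Suc k) - real j) = real (Suc k) * real (k choose j)"
    proof -
      have "(Suc k - j) * (Suc k choose j) = Suc k * (k choose j)"
        using binomial_absorb_comp[of "Suc k" j] by simp
      then have "real (Suc k - j) * real (Suc k choose j) = real (Suc k) * real (k choose j)"
        by (metis of_nat_mult)
      then show ?thesis using that by (simp add: of_nat_diff mult.commute del: binomial_Suc_Suc)
    qed
    have "?r = (-1) ^ j * p j * ((real m - real (Suc k) * \<alpha>) * real (Suc k choose j) + \<alpha> * (real (Suc k) * real (k choose j)))"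
      by (simp only: algebra_simps)
    also have "\<dots> = (-1) ^ j * p j * (real (Suc k choose j) * (real m - real j * \<alpha>))"
      unfolding b[symmetric] by (simp only: algebra_simps)
    also have "\<dots> = ?l" by (simp add: p_def pochhammer_Suc mult_ac del: binomial_Suc_Suc)
    finally show ?thesis ..
  qed
  have "gen_stirling \<alpha> (Suc m) (Suc k) = 1 / c *
     (\<Sum>j=1..Suc k. (real m - real (Suc k) * \<alpha>) * ((-1) ^ j * real (Suc k choose j) * p j) +
     (\<alpha> * real (Suc k)) * ((-1) ^ j * real (k choose j) * p j))"
    unfolding gen_stirling_def c_def[symmetric] using split by (intro arg_cong2[of _ _ _ _ "(*)"] sum.cong) auto
  also have "\<dots> = 1 / c * ((real m - real (Suc k) * \<alpha>) * (\<Sum>j=1..Suc k. (-1) ^ j * real (Suc k choose j) * p j) +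
     (\<alpha> * real (Suc k)) * (\<Sum>j=1..Suc k. (-1) ^ j * real (k choose j) * p j))"
    by (simp only: sum.distrib sum_distrib_left)
  also have "(\<Sum>j=1..Suc k. (-1) ^ j * real (k choose j) * p j) = (\<Sum>j=1..k. (-1) ^ j * real (k choose j) * p j)"
    by simp
  also have "1 / c * ((real m - real (Suc k) * \<alpha>) * (\<Sum>j=1..Suc k. (-1) ^ j * real (Suc k choose j) * p j) +
     (\<alpha> * real (Suc k)) * (\<Sum>j=1..k. (-1) ^ j * real (k choose j) * p j)) =
     (real m - real (Suc k) * \<alpha>) * gen_stirling \<alpha> m (Suc k) + (\<alpha> * real (Suc k)) / c * (\<Sum>j=1..k. (-1) ^ j * real (k choose j) * p j)"
    unfolding gen_stirling_def c_def p_def by (simp only: algebra_simps) (simp only: mult_ac times_divide_eq_right times_divide_eq_left mult_1_left)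
  also have "(\<alpha> * real (Suc k)) / c = 1 / (\<alpha> ^ k * fact k)"
    using assms unfolding c_def by (simp add: field_simps del: of_nat_Suc)
  finally show ?thesis by (simp add: gen_stirling_def p_def)
qed

lemma gen_stirling_1_1: "\<alpha> \<noteq> 0 \<Longrightarrow> gen_stirling \<alpha> (Suc 0) (Suc 0) = 1"
  by (simp add: gen_stirling_def)

lemma gen_stirling_eq_0:
  assumes "\<alpha> \<noteq> 0"
  shows "Suc m < k \<Longrightarrow> gen_stirling \<alpha> (Suc m) k = 0"
proof (induction m arbitrary: k)
  case 0
  have "(\<Sum>j=1..k. (-1) ^ j * real (k choose j) * pochhammer (- (real j * \<alpha>)) (Suc 0)) =
     - \<alpha> * (\<Sum>j\<le>k. (-1) ^ j * real j * real (k choose j))"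
    by (simp add: sum_distrib_left atMost_atLeast0 sum.atLeast_Suc_atMost[of 0] mult_ac sum_negf)
  also have "(\<Sum>j\<le>k. (-1) ^ j * real j * real (k choose j)) = 0"
    using choose_alternating_linear_sum[of k, where ?'a = real] 0 by (simp add: mult_ac)
  finally show ?case by (simp add: gen_stirling_def)
next
  case (Suc m)
  then obtain k' where k: "k = Suc k'" "Suc m < k'" by (cases k) auto
  show ?case unfolding k(1) gen_stirling_Suc[OF assms, of "Suc m" k'] using Suc.IH[of k'] Suc.IH[of "Suc k'"] k(2) by simp
qed

text \<open>The closed form of \<open>E[S^m exp (- l S)]\<close> for a positive stable variable \<open>S\<close>; see
  \<open>stable_moment_eq\<close>.\<close>
definition stable_moment :: "real \<Rightarrow> nat \<Rightarrow> real \<Rightarrow> real" where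
  "stable_moment \<alpha> m l = \<alpha> * exp (- (l powr \<alpha>)) * l powr (\<alpha> - real m) * Omega \<alpha> m (l powr \<alpha>)"

lemma stable_moment_0: "0 < \<alpha> \<Longrightarrow> 0 < l \<Longrightarrow> stable_moment \<alpha> 0 l = exp (- (l powr \<alpha>))"
  by (simp add: stable_moment_def Omega_def)

text \<open>The factors \<open>Gamma\<close> in \<open>Omega\<close> and \<open>block_prob\<close> cancel, which leaves a form that can be differentiated
  term by term.\<close>
lemma stable_moment_Suc:
  assumes "0 < \<alpha>" "0 < l"
  shows "stable_moment \<alpha> (Suc m) l =
    exp (- (l powr \<alpha>)) * (\<Sum>k\<le>Suc m. \<alpha> ^ k * gen_stirling \<alpha> (Suc m) k * l powr (real k * \<alpha> - real (Suc m)))"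
proof -
  have "stable_moment \<alpha> (Suc m) l = exp (- (l powr \<alpha>)) * (\<Sum>k=1..Suc m. \<alpha> * l powr (\<alpha> - real (Suc m)) *
      (Gamma (real (Suc m)) * (block_prob \<alpha> (Suc m) k * (l powr \<alpha>) ^ (k - 1) / Gamma (real k))))"
    unfolding stable_moment_def Omega_def by (simp add: sum_distrib_left mult_ac del: of_nat_Suc sum.cl_ivl_Suc)
  also have "(\<Sum>k=1..Suc m. \<alpha> * l powr (\<alpha> - real (Suc m)) *
      (Gamma (real (Suc m)) * (block_prob \<alpha> (Suc m) k * (l powr \<alpha>) ^ (k - 1) / Gamma (real k)))) =
      (\<Sum>k=1..Suc m. \<alpha> ^ k * gen_stirling \<alpha> (Suc m) k * l powr (real k * \<alpha> - real (Suc m)))"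
  proof (rule sum.cong[OF refl])
    fix k assume "k \<in> {1..Suc m}"
    then obtain j where k: "k = Suc j" by (cases k) auto
    have G: "Gamma (real (Suc j)) \<noteq> 0" "Gamma (real (Suc m)) \<noteq> 0"
      by (rule less_imp_neq[OF Gamma_real_pos, symmetric], simp)+
    have "l powr (\<alpha> - real (Suc m)) * (l powr \<alpha>) ^ j = l powr (real k * \<alpha> - real (Suc m))"
      using assms by (simp add: k powr_realpow[symmetric] powr_powr powr_add[symmetric] algebra_simps)
    moreover have "Gamma (real (Suc m)) * (block_prob \<alpha> (Suc m) k * (l powr \<alpha>) ^ (k - 1) / Gamma (real k)) =
       \<alpha> ^ j * gen_stirling \<alpha> (Suc m) k * (l powr \<alpha>) ^ j"
      unfolding block_prob_def k using G by (simp add: field_simps del: of_nat_Suc)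
    ultimately show "\<alpha> * l powr (\<alpha> - real (Suc m)) * (Gamma (real (Suc m)) * (block_prob \<alpha> (Suc m) k * (l powr \<alpha>) ^ (k - 1) / Gamma (real k)))
       = \<alpha> ^ k * gen_stirling \<alpha> (Suc m) k * l powr (real k * \<alpha> - real (Suc m))"
      by (simp add: k mult_ac del: of_nat_Suc)
  qed
  also have "\<dots> = (\<Sum>k\<le>Suc m. \<alpha> ^ k * gen_stirling \<alpha> (Suc m) k * l powr (real k * \<alpha> - real (Suc m)))"
    by (simp add: atMost_atLeast0 sum.atLeast_Suc_atMost[of 0] del: of_nat_Suc sum.cl_ivl_Suc)
  finally show ?thesis .
qed

text \<open>Differentiating the sum produces the coefficients \<open>(m - k \<alpha>) S(m, k)\<close> from the powers of \<open>l\<close> and, shifted by one,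
  \<open>S(m, k)\<close> from the exponential; the Stirling recurrence adds them up.\<close>
lemma DERIV_stable_moment:
  assumes "0 < \<alpha>" "0 < l"
  shows "(stable_moment \<alpha> m has_field_derivative - stable_moment \<alpha> (Suc m) l) (at l)"
proof (cases m)
  case 0
  have "((\<lambda>l. exp (- (l powr \<alpha>))) has_field_derivative - stable_moment \<alpha> (Suc 0) l) (at l)"
    unfolding stable_moment_Suc[OF assms] using assms
    by (auto intro!: derivative_eq_intros simp: gen_stirling_1_1)
  then have "(stable_moment \<alpha> 0 has_field_derivative - stable_moment \<alpha> (Suc 0) l) (at l)"
    by (rule has_field_derivative_transform_within_open[where S = "{0<..}"])
       (use assms in \<open>auto simp: stable_moment_0\<close>)
  then show ?thesis by (simp add: 0)
next
  case (Suc n)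
  define c where "c k = \<alpha> ^ k * gen_stirling \<alpha> (Suc n) k" for k
  define d where "d k = \<alpha> ^ k * gen_stirling \<alpha> (Suc (Suc n)) k" for k
  have d: "d (Suc k) = (real (Suc n) - real (Suc k) * \<alpha>) * c (Suc k) + \<alpha> * c k" for k
    unfolding c_def d_def using assms by (simp add: gen_stirling_Suc[of \<alpha> "Suc n" k] algebra_simps del: of_nat_Suc)
  have c0: "c 0 = 0" "d 0 = 0" "c (Suc (Suc n)) = 0"
    using gen_stirling_eq_0[of \<alpha> n "Suc (Suc n)"] assms by (auto simp: c_def d_def)
  define e where "e k = l powr (real k * \<alpha> - real (Suc (Suc n)))" for k
  have ring: "E * - (\<alpha> * p) * (u * q) + u * ((a - b) * v) * E = - (E * (\<alpha> * u * (p * q) + u * ((b - a) * v)))"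
    for E p u q a b v :: real by (simp add: algebra_simps)
  have "((\<lambda>l. exp (- (l powr \<alpha>)) * (\<Sum>k\<le>Suc n. c k * l powr (real k * \<alpha> - real (Suc n)))) has_field_derivative
      exp (- (l powr \<alpha>)) * (- (\<alpha> * l powr (\<alpha> - 1))) * (\<Sum>k\<le>Suc n. c k * l powr (real k * \<alpha> - real (Suc n))) +
      (\<Sum>k\<le>Suc n. c k * ((real k * \<alpha> - real (Suc n)) * l powr (real k * \<alpha> - real (Suc n) - 1))) * exp (- (l powr \<alpha>))) (at l)"
    using assms by (intro DERIV_mult DERIV_sum DERIV_cmult) (auto intro!: derivative_eq_intros simp del: of_nat_Suc)
  also have "exp (- (l powr \<alpha>)) * (- (\<alpha> * l powr (\<alpha> - 1))) * (\<Sum>k\<le>Suc n. c k * l powr (real k * \<alpha> - real (Suc n))) +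
      (\<Sum>k\<le>Suc n. c k * ((real k * \<alpha> - real (Suc n)) * l powr (real k * \<alpha> - real (Suc n) - 1))) * exp (- (l powr \<alpha>)) =
      - (exp (- (l powr \<alpha>)) * ((\<Sum>k\<le>Suc n. \<alpha> * c k * (l powr (\<alpha> - 1) * l powr (real k * \<alpha> - real (Suc n)))) +
      (\<Sum>k\<le>Suc n. c k * ((real (Suc n) - real k * \<alpha>) * l powr (real k * \<alpha> - real (Suc n) - 1)))))"
    unfolding sum_distrib_left sum_distrib_right sum_negf[symmetric] sum.distrib[symmetric]
    by (intro sum.cong refl) (rule ring)
  also have "(\<Sum>k\<le>Suc n. \<alpha> * c k * (l powr (\<alpha> - 1) * l powr (real k * \<alpha> - real (Suc n)))) = (\<Sum>k\<le>Suc n. \<alpha> * c k * e (Suc k))"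
    by (intro sum.cong refl) (auto simp: e_def powr_add[symmetric] algebra_simps)
  also have "(\<Sum>k\<le>Suc n. c k * ((real (Suc n) - real k * \<alpha>) * l powr (real k * \<alpha> - real (Suc n) - 1))) =
     (\<Sum>k\<le>Suc n. (real (Suc n) - real k * \<alpha>) * c k * e k)"
    by (intro sum.cong refl) (auto simp: e_def algebra_simps)
  also have "\<dots> = (\<Sum>k\<le>Suc (Suc n). (real (Suc n) - real k * \<alpha>) * c k * e k)"
    using c0 by simp
  also have "\<dots> = (\<Sum>k\<le>Suc n. (real (Suc n) - real (Suc k) * \<alpha>) * c (Suc k) * e (Suc k))"
    using c0 by (subst sum.atMost_Suc_shift) simp
  also have "(\<Sum>k\<le>Suc n. \<alpha> * c k * e (Suc k)) + (\<Sum>k\<le>Suc n. (real (Suc n) - real (Suc k) * \<alpha>) * c (Suc k) * e (Suc k)) =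
      (\<Sum>k\<le>Suc n. d (Suc k) * e (Suc k))"
    unfolding sum.distrib[symmetric] by (intro sum.cong refl) (simp only: d algebra_simps)
  also have "\<dots> = (\<Sum>k\<le>Suc (Suc n). d k * e k)"
    using c0 by (subst (2) sum.atMost_Suc_shift) simp
  finally have "((\<lambda>l. exp (- (l powr \<alpha>)) * (\<Sum>k\<le>Suc n. c k * l powr (real k * \<alpha> - real (Suc n)))) has_field_derivative
     - stable_moment \<alpha> (Suc (Suc n)) l) (at l)"
    unfolding stable_moment_Suc[OF assms] d_def e_def .
  then have "(stable_moment \<alpha> (Suc n) has_field_derivative - stable_moment \<alpha> (Suc (Suc n)) l) (at l)"
    by (rule has_field_derivative_transform_within_open[where S = "{0<..}"])
       (use assms in \<open>auto simp: stable_moment_Suc c_def\<close>)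
  then show ?thesis by (simp add: Suc)
qed

text \<open>The difference quotients of \<open>F\<close> from the left and from the right bound \<open>P l\<close> from both sides. This replaces
  differentiation under the integral sign in \<open>stable_moment_eq\<close>.\<close>
lemma derivative_sandwich:
  fixes F P :: "real \<Rightarrow> real"
  assumes der: "(F has_field_derivative - D) (at l)" and l: "0 < l"
    and le: "\<And>a b. 0 < a \<Longrightarrow> a < b \<Longrightarrow> (b - a) * P b \<le> F a - F b"
    and ge: "\<And>a b. 0 < a \<Longrightarrow> a < b \<Longrightarrow> F a - F b \<le> (b - a) * P a"
  shows "P l = D"
proof (rule antisym)
  have lim: "((\<lambda>y. (F y - F l) / (y - l)) \<longlongrightarrow> - D) (at l)"
    using der by (simp add: has_field_derivative_iff)
  have "((\<lambda>y. (F y - F l) / (y - l)) \<longlongrightarrow> - D) (at_left l)"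
    using lim by (rule tendsto_mono[rotated]) (simp add: at_le)
  moreover have "eventually (\<lambda>y. (F y - F l) / (y - l) \<le> - P l) (at_left l)"
    using eventually_at_left_real[OF l]
  proof eventually_elim
    case (elim y)
    then have "(l - y) * P l \<le> F y - F l" by (intro le) auto
    then show ?case using elim by (simp add: divide_simps algebra_simps)
  qed
  ultimately have "- D \<le> - P l" by (rule tendsto_upperbound) simp
  then show "P l \<le> D" by simp
  have "((\<lambda>y. (F y - F l) / (y - l)) \<longlongrightarrow> - D) (at_right l)"
    using lim by (rule tendsto_mono[rotated]) (simp add: at_le)
  moreover have "eventually (\<lambda>y. - P l \<le> (F y - F l) / (y - l)) (at_right l)"
    using eventually_at_right_real[of l "l + 1", simplified]
  proof eventually_elim
    case (elim y)
    then have "F l - F y \<le> (y - l) * P l" using l by (intro ge) auto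
    then show ?case using elim by (simp add: divide_simps algebra_simps)
  qed
  ultimately have "- P l \<le> - D" by (rule tendsto_lowerbound) simp
  then show "D \<le> P l" by simp
qed

text \<open>Induction on \<open>m\<close>: by \<open>1 + x \<le> exp x\<close> the difference quotients of the moment of order \<open>m\<close> are enclosed
  by values of the moment of order \<open>m + 1\<close>. This also shows that the latter is finite.\<close>
lemma stable_moment_eq:
  assumes "0 < \<alpha>" "stable_density \<alpha> f" "0 < l"
  shows "(\<integral>\<^sup>+t. ennreal (t ^ m * exp (- (l * t)) * f t) \<partial>lborel) = ennreal (stable_moment \<alpha> m l)"
    and "0 \<le> stable_moment \<alpha> m l"
proof -
  have fm [measurable]: "f \<in> borel_measurable borel" and f0: "\<And>t. 0 \<le> f t" "\<And>t. t \<le> 0 \<Longrightarrow> f t = 0"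
    and lap: "\<And>s. 0 \<le> s \<Longrightarrow> (\<integral>\<^sup>+t. ennreal (exp (- (s * t)) * f t) \<partial>lborel) = ennreal (exp (- (s powr \<alpha>)))"
    using assms(2) by (auto simp: stable_density_def)
  \<comment> \<open>The moment as an extended nonnegative integral: finiteness of the order \<open>m + 1\<close> is part of the induction.\<close>
  define \<Psi> where "\<Psi> m l = (\<integral>\<^sup>+t. ennreal (t ^ m * exp (- (l * t)) * f t) \<partial>lborel)" for m l
  have nn: "0 \<le> t ^ m * exp (- (l * t)) * f t" for m l t
    using f0(1)[of t] f0(2)[of t] by (cases "t \<le> 0") auto
  have up: "\<Psi> m b + ennreal (b - a) * \<Psi> (Suc m) b \<le> \<Psi> m a" if "0 < a" "a < b" for a b m
  proof -
    have "\<Psi> m b + ennreal (b - a) * \<Psi> (Suc m) b =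
      (\<integral>\<^sup>+t. ennreal (t ^ m * exp (- (b * t)) * f t + (b - a) * (t ^ Suc m * exp (- (b * t)) * f t)) \<partial>lborel)"
      unfolding \<Psi>_def using that nn
      by (simp add: nn_integral_cmult[symmetric] nn_integral_add[symmetric] ennreal_mult[symmetric] ennreal_plus[symmetric] del: ennreal_plus power_Suc)
    also have "\<dots> \<le> \<Psi> m a" unfolding \<Psi>_def
    proof (intro nn_integral_mono ennreal_leI)
      fix t :: real
      have "(1 + (b - a) * t) * exp (- (b * t)) \<le> exp ((b - a) * t) * exp (- (b * t))"
        by (intro mult_right_mono) (auto simp: add.commute exp_ge_add_one_self)
      also have "\<dots> = exp (- (a * t))" by (simp add: exp_add[symmetric] algebra_simps)
      finally have "(t ^ m * f t) * ((1 + (b - a) * t) * exp (- (b * t))) \<le> (t ^ m * f t) * exp (- (a * t))"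
        using nn[of t m 0] by (intro mult_left_mono) auto
      then show "t ^ m * exp (- (b * t)) * f t + (b - a) * (t ^ Suc m * exp (- (b * t)) * f t) \<le> t ^ m * exp (- (a * t)) * f t"
        by (simp add: algebra_simps)
    qed
    finally show ?thesis .
  qed
  have lo: "\<Psi> m a \<le> \<Psi> m b + ennreal (b - a) * \<Psi> (Suc m) a" if "0 < a" "a < b" for a b m
  proof -
    have "\<Psi> m a \<le> (\<integral>\<^sup>+t. ennreal (t ^ m * exp (- (b * t)) * f t + (b - a) * (t ^ Suc m * exp (- (a * t)) * f t)) \<partial>lborel)"
      unfolding \<Psi>_def
    proof (intro nn_integral_mono ennreal_leI)
      fix t :: real
      have "(1 - (b - a) * t) * exp (- (a * t)) \<le> exp (- ((b - a) * t)) * exp (- (a * t))"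
        using exp_ge_add_one_self[of "- ((b - a) * t)"] by (intro mult_right_mono) auto
      also have "\<dots> = exp (- (b * t))" by (simp add: exp_add[symmetric] algebra_simps)
      finally have "(t ^ m * f t) * ((1 - (b - a) * t) * exp (- (a * t))) \<le> (t ^ m * f t) * exp (- (b * t))"
        using nn[of t m 0] by (intro mult_left_mono) auto
      then show "t ^ m * exp (- (a * t)) * f t \<le> t ^ m * exp (- (b * t)) * f t + (b - a) * (t ^ Suc m * exp (- (a * t)) * f t)"
        by (simp add: algebra_simps)
    qed
    also have "\<dots> = \<Psi> m b + ennreal (b - a) * \<Psi> (Suc m) a"
      unfolding \<Psi>_def using that nn
      by (simp add: nn_integral_cmult[symmetric] nn_integral_add[symmetric] ennreal_mult[symmetric] ennreal_plus[symmetric] del: ennreal_plus power_Suc)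
    finally show ?thesis .
  qed
  have "\<forall>l>0. \<Psi> m l = ennreal (stable_moment \<alpha> m l) \<and> 0 \<le> stable_moment \<alpha> m l"
  proof (induction m)
    case 0
    show ?case using lap assms(1) by (auto simp: \<Psi>_def stable_moment_0)
  next
    case (Suc m)
    define P where "P b = enn2real (\<Psi> (Suc m) b)" for b
    have fin: "\<Psi> (Suc m) b = ennreal (P b)" if "0 < b" for b
    proof -
      have "ennreal (b - b / 2) * \<Psi> (Suc m) b \<le> \<Psi> m (b / 2)"
        using up[of "b / 2" b m] that by (intro order_trans[OF _ up[of "b / 2" b m]]) auto
      also have "\<dots> < \<infinity>" using Suc that by simp
      finally have "\<Psi> (Suc m) b < \<infinity>" using that by (auto simp: ennreal_mult_less_top)
      then show ?thesis by (simp add: P_def)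
    qed
    have P0: "0 \<le> P b" for b by (simp add: P_def)
    have "P l = stable_moment \<alpha> (Suc m) l" if l: "0 < l" for l
    proof (rule derivative_sandwich[OF DERIV_stable_moment[OF assms(1) l] l])
      fix a b :: real assume ab: "0 < a" "a < b"
      show "(b - a) * P b \<le> stable_moment \<alpha> m a - stable_moment \<alpha> m b"
        using up[OF ab, of m] Suc ab P0[of b] fin[of b]
        by (simp add: ennreal_mult[symmetric] ennreal_plus[symmetric] del: ennreal_plus)
      show "stable_moment \<alpha> m a - stable_moment \<alpha> m b \<le> (b - a) * P a"
        using lo[OF ab, of m] Suc ab P0[of a] fin[of a]
        by (simp add: ennreal_mult[symmetric] ennreal_plus[symmetric] del: ennreal_plus)
    qed
    then show ?case using fin P0 by metis
  qed
  then show "(\<integral>\<^sup>+t. ennreal (t ^ m * exp (- (l * t)) * f t) \<partial>lborel) = ennreal (stable_moment \<alpha> m l)"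
    and "0 \<le> stable_moment \<alpha> m l"
    using assms(3) by (auto simp: \<Psi>_def)
qed

lemma stable_moment_pos:
  assumes "0 < \<alpha>" "stable_density \<alpha> f" "0 < l"
  shows "0 < stable_moment \<alpha> m l"
proof (rule ccontr)
  have fm [measurable]: "f \<in> borel_measurable borel" and f0: "\<And>t. 0 \<le> f t" "\<And>t. t \<le> 0 \<Longrightarrow> f t = 0"
    using assms(2) by (auto simp: stable_density_def)
  assume "\<not> ?thesis"
  then have "(\<integral>\<^sup>+t. ennreal (t ^ m * exp (- (l * t)) * f t) \<partial>lborel) = 0"
    using stable_moment_eq(1)[OF assms, of m] by (simp add: not_less ennreal_neg)
  then have "AE t in lborel. ennreal (t ^ m * exp (- (l * t)) * f t) = 0"
    by (subst (asm) nn_integral_0_iff_AE) auto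
  then have "AE t in lborel. f t = 0"
  proof eventually_elim
    case (elim t)
    show ?case
    proof (cases "t \<le> 0")
      case False
      then have "0 < t ^ m * exp (- (l * t))" by simp
      moreover have "t ^ m * exp (- (l * t)) * f t \<le> 0" using elim by (simp add: ennreal_eq_0_iff)
      ultimately have "\<not> 0 < f t" by (metis mult_pos_pos not_le)
      then show ?thesis using f0(1)[of t] by simp
    qed (use f0 in auto)
  qed
  then have "(\<integral>\<^sup>+t. ennreal (t ^ 0 * exp (- (l * t)) * f t) \<partial>lborel) = (\<integral>\<^sup>+t. 0 \<partial>(lborel :: real measure))"
    by (intro nn_integral_cong_AE) auto
  then show False using stable_moment_eq(1)[OF assms, of 0] stable_moment_0[OF assms(1,3)] by simp
qed

lemma integral_stable_moment:
  assumes "0 < \<alpha>" "stable_density \<alpha> f" "0 < l"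
  shows "(\<integral>t. t ^ m * exp (- (l * t)) * f t \<partial>lborel) = stable_moment \<alpha> m l"
proof -
  have fm [measurable]: "f \<in> borel_measurable borel" and f0: "\<And>t. 0 \<le> f t" "\<And>t. t \<le> 0 \<Longrightarrow> f t = 0"
    using assms(2) by (auto simp: stable_density_def)
  have nn: "0 \<le> t ^ m * exp (- (l * t)) * f t" for t
    using f0(1)[of t] f0(2)[of t] by (cases "t \<le> 0") auto
  show ?thesis using stable_moment_eq[OF assms, of m] nn by (subst integral_eq_nn_integral) auto
qed

section \<open>The kernel of one size-biased pick\<close>

definition W_law :: "real \<Rightarrow> nat \<Rightarrow> real \<Rightarrow> real measure" where
  "W_law \<alpha> m r = density lborel (\<lambda>w. ennreal (indicator {r<..<1} w * W_density \<alpha> m r w))"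

definition stable_levy_density :: "real \<Rightarrow> real \<Rightarrow> real" where
  "stable_levy_density \<alpha> x = indicator {0<..} x * (\<alpha> * x powr (- \<alpha> - 1) / Gamma (1 - \<alpha>))"

lemma stable_levy_density_nonneg: "0 < \<alpha> \<Longrightarrow> \<alpha> < 1 \<Longrightarrow> 0 \<le> stable_levy_density \<alpha> x"
  unfolding stable_levy_density_def using Gamma_real_pos[of "1 - \<alpha>"] by (auto split: split_indicator)

lemma stable_levy_density_measurable [measurable]: "stable_levy_density \<alpha> \<in> borel_measurable borel"
  unfolding stable_levy_density_def by measurable

lemma beta_moment_measurable:
  assumes "0 < \<alpha>" "\<alpha> < 1" "1 \<le> m"
  shows "beta_moment \<alpha> m \<in> borel_measurable borel"
  unfolding beta_moment_eq_sum[OF assms, abs_def] by measurable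

lemma Omega_measurable [measurable]: "Omega \<alpha> m \<in> borel_measurable borel"
  unfolding Omega_def[abs_def] by (cases "m = 0") simp_all

lemma W_density_measurable:
  assumes "0 < \<alpha>" "\<alpha> < 1" "1 \<le> m"
  shows "(\<lambda>(r, w). W_density \<alpha> m r w) \<in> borel_measurable (borel \<Otimes>\<^sub>M borel)"
  unfolding W_density_def split_beta' using beta_moment_measurable[OF assms, measurable] by measurable

lemma f_R_measurable:
  assumes "0 < \<alpha>" "\<alpha> < 1" "1 \<le> m"
  shows "(\<lambda>(l, r). f_R \<alpha> m l r) \<in> borel_measurable (borel \<Otimes>\<^sub>M borel)"
  unfolding f_R_def f_R1_def split_beta' using beta_moment_measurable[OF assms, measurable] by measurable

lemma Omega_pos:
  assumes "0 < \<alpha>" "stable_density \<alpha> f" "0 < l"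
  shows "0 < Omega \<alpha> m (l powr \<alpha>)"
proof -
  have "0 < \<alpha> * exp (- (l powr \<alpha>)) * l powr (\<alpha> - real m) * Omega \<alpha> m (l powr \<alpha>)"
    using stable_moment_pos[OF assms, of m] by (simp add: stable_moment_def)
  moreover have "0 < \<alpha> * exp (- (l powr \<alpha>)) * l powr (\<alpha> - real m)" using assms by simp
  ultimately show ?thesis by (rule zero_less_mult_pos)
qed

text \<open>In this form the quotient of moments, which the tilting contributes, is separated from an elementary
  factor.\<close>
lemma f_R_eq:
  assumes "0 < \<alpha>" "stable_density \<alpha> f" "0 < lam" "0 < r"
  shows "f_R \<alpha> m lam r =
    stable_moment \<alpha> m (lam / r) / stable_moment \<alpha> m lam * (beta_moment \<alpha> m r * \<alpha> * lam powr \<alpha> * r powr (- real m - 1))"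
proof -
  have O: "Omega \<alpha> m (lam powr \<alpha>) \<noteq> 0" using Omega_pos[OF assms(1-3), of m] by simp
  have p: "r powr (- \<alpha> - 1) = r powr (- real m - 1) / r powr (\<alpha> - real m)"
    unfolding powr_diff[symmetric] by (rule arg_cong[where f = "\<lambda>e. r powr e"]) simp
  have e: "exp (- ((lam / r) powr \<alpha>)) / exp (- (lam powr \<alpha>)) = exp (lam powr \<alpha>) * exp (- (lam powr \<alpha> / r powr \<alpha>))"
    by (simp add: powr_divide exp_minus field_simps)
  have "stable_moment \<alpha> m (lam / r) / stable_moment \<alpha> m lam =
     (exp (- ((lam / r) powr \<alpha>)) / exp (- (lam powr \<alpha>))) * (Omega \<alpha> m ((lam / r) powr \<alpha>) / Omega \<alpha> m (lam powr \<alpha>))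
        / r powr (\<alpha> - real m)"
    unfolding stable_moment_def using assms O by (simp add: powr_divide field_simps)
  then show ?thesis
    unfolding e f_R_def f_R1_def p by (simp add: powr_divide mult_ac)
qed

lemma f_R_nonneg:
  assumes "0 < \<alpha>" "\<alpha> < 1" "1 \<le> m" "stable_density \<alpha> f" "0 < lam" "0 < r" "r < 1"
  shows "0 \<le> f_R \<alpha> m lam r"
proof -
  have "0 < stable_moment \<alpha> m (lam / r)" "0 < stable_moment \<alpha> m lam"
    using assms by (auto intro!: stable_moment_pos[OF assms(1,4)])
  then show ?thesis
    unfolding f_R_eq[OF assms(1,4-6)] using beta_moment_pos[of \<alpha> m r] assms
    by (intro mult_nonneg_nonneg) auto
qed

text \<open>A Gamma integral in the variable \<open>y = lam s (1/r - 1/w)\<close>: it writes a negative power of \<open>s\<close>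
  times \<open>exp (- lam s / w)\<close> as a mixture of the exponentials \<open>exp (- (lam / r) s)\<close>, \<open>r < w\<close>. This is
  where the auxiliary variable \<open>R\<close> comes from.\<close>
lemma power_times_exp_as_mixture:
  assumes "0 < \<alpha>" "0 < s" "0 < lam" "0 < w"
  shows "ennreal (s powr (- \<alpha>) * exp (- (lam * s / w))) =
    (\<integral>\<^sup>+r. ennreal (indicator {0<..<w} r * (lam powr \<alpha> / Gamma \<alpha> * (w - r) powr (\<alpha> - 1) * (w * r) powr (1 - \<alpha>) * r powr (- 2)
       * exp (- (lam / r * s)))) \<partial>lborel)"
proof -
  define g where "g r = lam * s * (1 / r - 1 / w)" for r
  define g' where "g' r = - (lam * s / r\<^sup>2)" for r
  define h where "h y = ennreal (y powr (\<alpha> - 1) / exp y)" for y :: real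
  have [measurable]: "g \<in> borel_measurable borel" "g' \<in> borel_measurable borel" "h \<in> borel_measurable borel"
    unfolding g_def g'_def h_def by measurable
  \<comment> \<open>the inverse of \<open>g\<close>\<close>
  define gi where "gi y = 1 / (y / (lam * s) + 1 / w)" for y
  have gi: "gi (g r) = r" if "r \<in> {0<..<w}" for r
    using that assms by (simp add: gi_def g_def)
  have gg: "g (gi y) = y \<and> gi y \<in> {0<..<w}" if "0 < y" for y
  proof -
    have "0 < y / (lam * s)" "0 < 1 / w" using that assms by auto
    moreover from this have "inverse (y / (lam * s) + 1 / w) < inverse (1 / w)"
      by (intro less_imp_inverse_less) auto
    ultimately show ?thesis using assms by (auto simp: gi_def g_def inverse_eq_divide intro!: add_pos_pos)
  qed
  have img: "g ` {0<..<w} = {0<..}"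
  proof
    show "g ` {0<..<w} \<subseteq> {0<..}" using assms by (auto simp: g_def field_simps)
    show "{0<..} \<subseteq> g ` {0<..<w}" using gg by (metis greaterThan_iff image_eqI subsetI)
  qed
  have inj: "inj_on g {0<..<w}" by (rule inj_on_inverseI[of _ gi]) (rule gi)
  have der: "(g has_field_derivative g' r) (at r within {0<..<w})" if "r \<in> {0<..<w}" for r
    unfolding g_def g'_def using that
    by (auto intro!: derivative_eq_intros simp: power2_eq_square)
  have "ennreal (Gamma \<alpha>) = (\<integral>\<^sup>+y. indicator (g ` {0<..<w}) y * h y \<partial>lborel)"
  proof -
    have "(\<integral>\<^sup>+t. ennreal (indicator {0..} t * t powr (\<alpha> - 1) / exp t) \<partial>lborel) = (\<integral>\<^sup>+y. indicator (g ` {0<..<w}) y * h y \<partial>lborel)"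
      unfolding img h_def by (intro nn_integral_cong) (auto split: split_indicator)
    then show ?thesis by (simp add: Gamma_conv_nn_integral_real[OF assms(1)])
  qed
  also have "\<dots> = (\<integral>\<^sup>+r. indicator {0<..<w} r * (ennreal \<bar>g' r\<bar> * h (g r)) \<partial>lborel)"
    using img inj der by (intro nn_integral_change_of_variables) auto
  finally have G: "ennreal (Gamma \<alpha>) = (\<integral>\<^sup>+r. indicator {0<..<w} r * (ennreal \<bar>g' r\<bar> * h (g r)) \<partial>lborel)" .
  define c where "c = s powr (- \<alpha>) * exp (- (lam * s / w)) / Gamma \<alpha>"
  have G0: "0 < Gamma \<alpha>" using assms by (intro Gamma_real_pos)
  then have c0: "0 \<le> c" by (simp add: c_def)
  have "ennreal (s powr (- \<alpha>) * exp (- (lam * s / w))) = ennreal c * ennreal (Gamma \<alpha>)"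
    using G0 by (simp add: c_def ennreal_mult'[symmetric])
  also have "\<dots> = (\<integral>\<^sup>+r. ennreal c * (indicator {0<..<w} r * (ennreal \<bar>g' r\<bar> * h (g r))) \<partial>lborel)"
    unfolding G by (subst nn_integral_cmult) auto
  also have "\<dots> = (\<integral>\<^sup>+r. ennreal (indicator {0<..<w} r * (lam powr \<alpha> / Gamma \<alpha> * (w - r) powr (\<alpha> - 1) * (w * r) powr (1 - \<alpha>) * r powr (- 2)
       * exp (- (lam / r * s)))) \<partial>lborel)"
  proof (rule nn_integral_cong)
    fix r
    show "ennreal c * (indicator {0<..<w} r * (ennreal \<bar>g' r\<bar> * h (g r))) =
      ennreal (indicator {0<..<w} r * (lam powr \<alpha> / Gamma \<alpha> * (w - r) powr (\<alpha> - 1) * (w * r) powr (1 - \<alpha>) * r powr (- 2)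
       * exp (- (lam / r * s))))"
    proof (cases "r \<in> {0<..<w}")
      case True
      then have r: "0 < r" "0 < w - r" by auto
      have g: "g r = lam * s * ((w - r) / (w * r))" using r assms by (simp add: g_def field_simps)
      have 1: "g r powr (\<alpha> - 1) = lam powr (\<alpha> - 1) * s powr (\<alpha> - 1) * ((w - r) powr (\<alpha> - 1) * (w * r) powr (1 - \<alpha>))"
      proof -
        have "(w * r) powr (1 - \<alpha>) = inverse ((w * r) powr (\<alpha> - 1))"
          by (simp add: powr_minus[symmetric])
        then show ?thesis
          unfolding g powr_mult[of "lam * s"] powr_mult[of lam] powr_divide by (simp only: divide_inverse mult.assoc)
      qed
      have 2: "exp (- (lam * s / w)) / exp (g r) = exp (- (lam / r * s))"
        unfolding exp_diff[symmetric] g_def by (simp add: algebra_simps)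
      have 3: "\<bar>g' r\<bar> = lam * s * r powr (-2)"
        using assms r by (simp add: g'_def powr_minus divide_inverse)
      have 4: "s powr (- \<alpha>) * s powr (\<alpha> - 1) * s = 1" "lam powr (\<alpha> - 1) * lam = lam powr \<alpha>"
        using assms by (auto simp: powr_add[symmetric] powr_diff powr_minus)
      have "c * (\<bar>g' r\<bar> * (g r powr (\<alpha> - 1) / exp (g r))) =
        (s powr (- \<alpha>) * s powr (\<alpha> - 1) * s) * (lam powr (\<alpha> - 1) * lam) / Gamma \<alpha> * (w - r) powr (\<alpha> - 1) * (w * r) powr (1 - \<alpha>) * r powr (- 2)
       * (exp (- (lam * s / w)) / exp (g r))"
        unfolding c_def 1 3 by (simp only: mult_ac times_divide_eq_right times_divide_eq_left divide_divide_eq_left)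
      also have "\<dots> = lam powr \<alpha> / Gamma \<alpha> * (w - r) powr (\<alpha> - 1) * (w * r) powr (1 - \<alpha>) * r powr (- 2)
       * exp (- (lam / r * s))"
        unfolding 2 4 by simp
      finally show ?thesis using True c0 by (simp add: h_def ennreal_mult'[symmetric])
    qed simp
  qed
  finally show ?thesis .
qed

text \<open>The density of the first size-biased jump \<open>x\<close>, when the other jumps add up to \<open>s\<close>, in the ratio
  \<open>w = s / (x + s)\<close>. After substitution the power \<open>s^(-\<alpha>)\<close> is removed by \<open>power_times_exp_as_mixture\<close>. The right-hand
  side depends on \<open>s\<close> only through the weight of a configuration with parameter \<open>lam / r\<close>, divided by its
  expectation.\<close>
lemma size_biased_jump_kernel:
  assumes "0 < \<alpha>" "\<alpha> < 1" "1 \<le> m" "stable_density \<alpha> f" "0 < lam" "0 < s"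
    and G [measurable]: "G \<in> borel_measurable borel"
  shows "(\<integral>\<^sup>+x. ennreal (stable_levy_density \<alpha> x * (x * (x + s) ^ (m - 1) * exp (- (lam * (x + s))))) * G (s / (x + s)) \<partial>lborel) =
    ennreal (stable_moment \<alpha> m lam) * (\<integral>\<^sup>+r. ennreal (s ^ m * exp (- (lam / r * s)) / stable_moment \<alpha> m (lam / r))
      * (\<integral>\<^sup>+w. G w \<partial>W_law \<alpha> m r) \<partial>R_law \<alpha> m lam)"
proof -
  note [measurable] = beta_moment_measurable[OF assms(1-3)] W_density_measurable[OF assms(1-3)] f_R_measurable[OF assms(1-3)]
  have [measurable]: "W_density \<alpha> m r \<in> borel_measurable borel" "f_R \<alpha> m lam \<in> borel_measurable borel" for r
    unfolding W_density_def f_R_def f_R1_def by measurable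
  have [measurable]: "stable_moment \<alpha> m \<in> borel_measurable borel" unfolding stable_moment_def by measurable
  define g where "g w = s * (1 / w - 1)" for w
  define g' where "g' w = - (s / w\<^sup>2)" for w
  define h where "h x = ennreal (stable_levy_density \<alpha> x * (x * (x + s) ^ (m - 1) * exp (- (lam * (x + s))))) * G (s / (x + s))" for x
  have [measurable]: "g \<in> borel_measurable borel" "g' \<in> borel_measurable borel" "h \<in> borel_measurable borel"
    unfolding g_def g'_def h_def by measurable
  have gi: "s / (g w + s) = w" if "w \<in> {0<..<1}" for w
    using that assms by (simp add: g_def field_simps)
  have gg: "g (s / (x + s)) = x \<and> s / (x + s) \<in> {0<..<1}" if "0 < x" for x
    using that assms by (auto simp: g_def field_simps)
  have img: "g ` {0<..<1} = {0<..}"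
  proof
    show "g ` {0<..<1} \<subseteq> {0<..}" using assms by (auto simp: g_def field_simps)
    show "{0<..} \<subseteq> g ` {0<..<1}" using gg by (metis greaterThan_iff image_eqI subsetI)
  qed
  have inj: "inj_on g {0<..<1}" by (rule inj_on_inverseI[of _ "\<lambda>x. s / (x + s)"]) (rule gi)
  have der: "(g has_field_derivative g' w) (at w within {0<..<1})" if "w \<in> {0<..<1}" for w
    unfolding g_def g'_def using that
    by (auto intro!: derivative_eq_intros simp: power2_eq_square)
  define K where "K r w = lam powr \<alpha> / Gamma \<alpha> * (w - r) powr (\<alpha> - 1) * (w * r) powr (1 - \<alpha>) * r powr (- 2)
       * exp (- (lam / r * s))" for r w
  define c where "c w = \<alpha> / Gamma (1 - \<alpha>) * s ^ m * w powr (\<alpha> - real m - 1) * (1 - w) powr (- \<alpha>)" for w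
  have G0: "0 < Gamma (1 - \<alpha>)" "0 < Gamma \<alpha>" using assms by (auto intro!: Gamma_real_pos)
  have c0: "0 \<le> c w" for w unfolding c_def using assms G0 by (intro mult_nonneg_nonneg) auto
  have K0: "0 \<le> K r w" for r w unfolding K_def using assms G0 by (intro mult_nonneg_nonneg) auto
  have "(\<integral>\<^sup>+x. h x \<partial>lborel) = (\<integral>\<^sup>+x. indicator (g ` {0<..<1}) x * h x \<partial>lborel)"
    unfolding img h_def by (intro nn_integral_cong) (auto simp: stable_levy_density_def split: split_indicator)
  also have "\<dots> = (\<integral>\<^sup>+w. indicator {0<..<1} w * (ennreal \<bar>g' w\<bar> * h (g w)) \<partial>lborel)"
    using img inj der by (intro nn_integral_change_of_variables) auto
  also have "\<dots> = (\<integral>\<^sup>+w. indicator {0<..<1} w * (ennreal (c w) * ennreal (s powr (- \<alpha>) * exp (- (lam * s / w))) * G w) \<partial>lborel)"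
  proof (rule nn_integral_cong)
    fix w
    show "indicator {0<..<1} w * (ennreal \<bar>g' w\<bar> * h (g w)) =
      indicator {0<..<1} w * (ennreal (c w) * ennreal (s powr (- \<alpha>) * exp (- (lam * s / w))) * G w)"
    proof (cases "w \<in> {0<..<1}")
      case True
      then have w: "0 < w" "0 < 1 - w" by auto
      have g: "g w = s * (1 - w) / w" using w by (simp add: g_def field_simps)
      have gpos: "0 < g w" unfolding g using w assms by simp
      have gs: "g w + s = s / w" using w by (simp add: g_def field_simps)
      have 1: "g w powr (- \<alpha> - 1) * g w = s powr (- \<alpha>) * (1 - w) powr (- \<alpha>) * w powr \<alpha>"
      proof -
        have "g w powr (- \<alpha> - 1) * g w = g w powr (- \<alpha>)"
          using gpos by (simp add: powr_diff)
        also have "\<dots> = s powr (- \<alpha>) * (1 - w) powr (- \<alpha>) * w powr \<alpha>"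
          unfolding g by (simp add: powr_mult powr_divide powr_minus) (simp add: field_simps)
        finally show ?thesis .
      qed
      have 2: "s / w\<^sup>2 * (s / w) ^ (m - 1) = s ^ m * w powr (- real m - 1)"
      proof -
        have "s / w\<^sup>2 * (s / w) ^ (m - 1) = (s / w) ^ Suc (m - 1) / w"
          by (simp add: power2_eq_square)
        also have "Suc (m - 1) = m" using assms(3) by simp
        also have "(s / w) ^ m / w = s ^ m * (1 / (w ^ m * w))" by (simp add: power_divide)
        also have "1 / (w ^ m * w) = w powr (- real m - 1)"
          using w by (simp add: powr_diff powr_minus powr_realpow divide_simps)
        finally show ?thesis .
      qed
      have 3: "w powr \<alpha> * w powr (- real m - 1) = w powr (\<alpha> - real m - 1)"
        unfolding powr_add[symmetric] by (rule arg_cong[where f = "\<lambda>e. w powr e"]) simp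
      have "\<bar>g' w\<bar> * (stable_levy_density \<alpha> (g w) * (g w * (g w + s) ^ (m - 1) * exp (- (lam * (g w + s))))) =
        \<alpha> / Gamma (1 - \<alpha>) * (g w powr (- \<alpha> - 1) * g w) * (s / w\<^sup>2 * (s / w) ^ (m - 1)) * exp (- (lam * (s / w)))"
        using gpos assms unfolding gs by (simp add: g'_def stable_levy_density_def mult_ac)
      also have "\<dots> = \<alpha> / Gamma (1 - \<alpha>) * s ^ m * (w powr \<alpha> * w powr (- real m - 1)) * (1 - w) powr (- \<alpha>) *
         (s powr (- \<alpha>) * exp (- (lam * s / w)))"
        unfolding 1 2 by (simp add: mult_ac)
      also have "\<dots> = c w * (s powr (- \<alpha>) * exp (- (lam * s / w)))"
        unfolding 3 c_def ..
      finally have e: "\<bar>g' w\<bar> * (stable_levy_density \<alpha> (g w) * (g w * (g w + s) ^ (m - 1) * exp (- (lam * (g w + s))))) =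
        c w * (s powr (- \<alpha>) * exp (- (lam * s / w)))" .
      have "ennreal \<bar>g' w\<bar> * h (g w) = ennreal (\<bar>g' w\<bar> * (stable_levy_density \<alpha> (g w) * (g w * (g w + s) ^ (m - 1) * exp (- (lam * (g w + s)))))) * G w"
        unfolding h_def gi[OF True] by (simp only: mult.assoc[symmetric] ennreal_mult'[symmetric, OF abs_ge_zero])
      then show ?thesis unfolding e using c0 by (simp add: ennreal_mult')
    qed simp
  qed
  also have "\<dots> = (\<integral>\<^sup>+w. (\<integral>\<^sup>+r. indicator {0<..<1} w * (ennreal (c w) * ennreal (indicator {0<..<w} r * K r w) * G w) \<partial>lborel) \<partial>lborel)"
  proof (rule nn_integral_cong)
    fix w :: real
    have Km: "(\<lambda>r. ennreal (indicator {0<..<w} r * K r w)) \<in> borel_measurable borel"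
      unfolding K_def by measurable
    have "(\<integral>\<^sup>+r. indicator {0<..<1} w * (ennreal (c w) * ennreal (indicator {0<..<w} r * K r w) * G w) \<partial>lborel) =
      indicator {0<..<1} w * (ennreal (c w) * (\<integral>\<^sup>+r. ennreal (indicator {0<..<w} r * K r w) \<partial>lborel) * G w)"
      using Km by (simp add: nn_integral_cmult nn_integral_multc)
    also have "\<dots> = indicator {0<..<1} w * (ennreal (c w) * ennreal (s powr (- \<alpha>) * exp (- (lam * s / w))) * G w)"
      using power_times_exp_as_mixture[of \<alpha> s lam w] assms unfolding K_def by (simp split: split_indicator)
    finally show "indicator {0<..<1} w * (ennreal (c w) * ennreal (s powr (- \<alpha>) * exp (- (lam * s / w))) * G w) =
       (\<integral>\<^sup>+r. indicator {0<..<1} w * (ennreal (c w) * ennreal (indicator {0<..<w} r * K r w) * G w) \<partial>lborel)" ..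
  qed
  also have "\<dots> = (\<integral>\<^sup>+r. (\<integral>\<^sup>+w. indicator {0<..<1} w * (ennreal (c w) * ennreal (indicator {0<..<w} r * K r w) * G w) \<partial>lborel) \<partial>lborel)"
  proof (rule lborel_pair.Fubini')
    have *: "(indicator {0<..<w} r :: real) = (if 0 < r \<and> r < w then 1 else 0)" for r w :: real by (simp add: indicator_def)
    show "(\<lambda>(r, w). indicator {0<..<1} w * (ennreal (c w) * ennreal (indicator {0<..<w} r * K r w) * G w)) \<in> borel_measurable (lborel \<Otimes>\<^sub>M lborel)"
      unfolding * K_def c_def split_beta' by measurable
  qed
  also have "\<dots> = (\<integral>\<^sup>+r. ennreal (stable_moment \<alpha> m lam) * (ennreal (indicator {0<..<1} r * f_R \<alpha> m lam r) *
      (ennreal (s ^ m * exp (- (lam / r * s)) / stable_moment \<alpha> m (lam / r)) *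
       (\<integral>\<^sup>+w. ennreal (indicator {r<..<1} w * W_density \<alpha> m r w) * G w \<partial>lborel))) \<partial>lborel)"
  proof (rule nn_integral_cong)
    fix r :: real
    show "(\<integral>\<^sup>+w. indicator {0<..<1} w * (ennreal (c w) * ennreal (indicator {0<..<w} r * K r w) * G w) \<partial>lborel) =
      ennreal (stable_moment \<alpha> m lam) * (ennreal (indicator {0<..<1} r * f_R \<alpha> m lam r) *
      (ennreal (s ^ m * exp (- (lam / r * s)) / stable_moment \<alpha> m (lam / r)) *
       (\<integral>\<^sup>+w. ennreal (indicator {r<..<1} w * W_density \<alpha> m r w) * G w \<partial>lborel)))"
    proof (cases "r \<in> {0<..<1}")
      case False
      then have "(\<integral>\<^sup>+w. indicator {0<..<1} w * (ennreal (c w) * ennreal (indicator {0<..<w} r * K r w) * G w) \<partial>lborel) = (\<integral>\<^sup>+w. 0 \<partial>(lborel :: real measure))"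
        by (intro nn_integral_cong) (auto split: split_indicator)
      with False show ?thesis by simp
    next
      case True
      then have r: "0 < r" "r < 1" by auto
      have mp: "0 < stable_moment \<alpha> m lam" "0 < stable_moment \<alpha> m (lam / r)" "0 < beta_moment \<alpha> m r"
        using stable_moment_pos[OF assms(1,4)] beta_moment_pos[of \<alpha> m r] assms r by auto
      have fr: "0 \<le> f_R \<alpha> m lam r" using f_R_nonneg assms r by blast
      define a where "a = stable_moment \<alpha> m lam * f_R \<alpha> m lam r * (s ^ m * exp (- (lam / r * s)) / stable_moment \<alpha> m (lam / r))"
      have a: "a = beta_moment \<alpha> m r * \<alpha> * lam powr \<alpha> * r powr (- real m - 1) * s ^ m * exp (- (lam / r * s))"
        unfolding a_def f_R_eq[OF assms(1,4,5) r(1)] using mp by (simp add: field_simps)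
      have a0: "0 \<le> a" unfolding a using mp assms by (intro mult_nonneg_nonneg) auto
      have key: "c w * K r w = a * W_density \<alpha> m r w" if w: "r < w" "w < 1" for w
      proof -
        have 1: "w powr (\<alpha> - real m - 1) * w powr (1 - \<alpha>) = w powr (- real m)"
          unfolding powr_add[symmetric] by (rule arg_cong[where f = "\<lambda>e. w powr e"]) simp
        have 2: "r powr (1 - \<alpha>) * r powr (- 2) = r powr (- real m - 1) * r powr (real m - \<alpha>)"
          unfolding powr_add[symmetric] by (rule arg_cong[where f = "\<lambda>e. r powr e"]) simp
        have "c w * K r w = \<alpha> * lam powr \<alpha> / (Gamma (1 - \<alpha>) * Gamma \<alpha>) * s ^ m * exp (- (lam / r * s)) *
           (w powr (\<alpha> - real m - 1) * w powr (1 - \<alpha>)) * (1 - w) powr (- \<alpha>) * (w - r) powr (\<alpha> - 1) * (r powr (1 - \<alpha>) * r powr (- 2))"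
          unfolding c_def K_def powr_mult by (simp only: mult_ac times_divide_eq_right times_divide_eq_left divide_divide_eq_left)
        also have "\<dots> = a * W_density \<alpha> m r w"
          unfolding 1 2 a W_density_def using mp by (simp add: field_simps)
        finally show ?thesis .
      qed
      have "(\<integral>\<^sup>+w. indicator {0<..<1} w * (ennreal (c w) * ennreal (indicator {0<..<w} r * K r w) * G w) \<partial>lborel) =
         (\<integral>\<^sup>+w. ennreal a * (ennreal (indicator {r<..<1} w * W_density \<alpha> m r w) * G w) \<partial>lborel)"
      proof (rule nn_integral_cong)
        fix w :: real
        show "indicator {0<..<1} w * (ennreal (c w) * ennreal (indicator {0<..<w} r * K r w) * G w) =
          ennreal a * (ennreal (indicator {r<..<1} w * W_density \<alpha> m r w) * G w)"
          using r c0[of w] a0 key[of w]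
          by (auto simp: mult.assoc[symmetric] ennreal_mult'[symmetric] split: split_indicator)
      qed
      also have "\<dots> = ennreal a * (\<integral>\<^sup>+w. ennreal (indicator {r<..<1} w * W_density \<alpha> m r w) * G w \<partial>lborel)"
        by (rule nn_integral_cmult) measurable
      also have "ennreal a = ennreal (stable_moment \<alpha> m lam) * ennreal (f_R \<alpha> m lam r) * ennreal (s ^ m * exp (- (lam / r * s)) / stable_moment \<alpha> m (lam / r))"
        unfolding a_def using mp fr assms by (simp add: ennreal_mult'[symmetric])
      finally show ?thesis using r by (simp add: mult.assoc)
    qed
  qed
  also have "\<dots> = ennreal (stable_moment \<alpha> m lam) * (\<integral>\<^sup>+r. ennreal (s ^ m * exp (- (lam / r * s)) / stable_moment \<alpha> m (lam / r))
      * (\<integral>\<^sup>+w. G w \<partial>W_law \<alpha> m r) \<partial>R_law \<alpha> m lam)"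
  proof -
    have *: "(indicator {r<..<1} w :: real) = (if r < w \<and> w < 1 then 1 else 0)" for r w :: real by (simp add: indicator_def)
    have Gm: "(\<lambda>r. \<integral>\<^sup>+w. ennreal (indicator {r<..<1} w * W_density \<alpha> m r w) * G w \<partial>lborel) \<in> borel_measurable borel"
      unfolding * by measurable
    have W: "(\<integral>\<^sup>+w. G w \<partial>W_law \<alpha> m r) = (\<integral>\<^sup>+w. ennreal (indicator {r<..<1} w * W_density \<alpha> m r w) * G w \<partial>lborel)" for r
      unfolding W_law_def by (subst nn_integral_density) auto
    show ?thesis unfolding W R_law_def using Gm
      by (subst nn_integral_density) (auto simp: nn_integral_cmult)
  qed
  finally show ?thesis unfolding h_def .
qed

section \<open>Poisson counts of ranked points\<close>

definition skip :: "nat \<Rightarrow> nat \<Rightarrow> nat" where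
  "skip j i = (if i < j then i else Suc i)"

lemma strict_mono_skip: "strict_mono (skip j)"
  by (auto simp: strict_mono_def skip_def)

lemma inj_skip: "inj (skip j)"
  by (rule strict_mono_imp_inj_on[OF strict_mono_skip])

lemma range_skip: "range (skip j) = - {j}"
proof
  show "- {j} \<subseteq> range (skip j)"
  proof
    fix i assume "i \<in> - {j}"
    then have "i = skip j (if i < j then i else i - 1)" by (auto simp: skip_def)
    then show "i \<in> range (skip j)" by blast
  qed
qed (auto simp: skip_def)

text \<open>Half-lines are chosen because, for a decreasing sequence, \<open>c < a l\<close> is a condition on the
  number of points above \<open>c\<close>.\<close>
lemma halfspace_cylinders_generate_real_seq:
  "sets real_seq = sigma_sets UNIV {{a. \<forall>l<n. c l < a l} | n c. True}" (is "_ = sigma_sets UNIV ?E")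
proof
  show "sigma_sets UNIV ?E \<subseteq> sets real_seq"
  proof -
    have "X \<in> sets real_seq" if "X \<in> ?E" for X :: "(nat \<Rightarrow> real) set"
    proof -
      from that obtain n c where X: "X = {a. \<forall>l<n. c l < a l}" by auto
      have "{a\<in>space real_seq. \<forall>l\<in>{..<n}. c l < a l} \<in> sets real_seq" by measurable
      then show ?thesis by (simp add: X space_PiM Ball_def)
    qed
    then show ?thesis using sets.sigma_sets_subset[of ?E real_seq] by (auto simp: space_PiM)
  qed
  have "(\<lambda>a. a) \<in> measurable (sigma UNIV ?E) real_seq"
  proof (rule measurable_PiM_single')
    fix l :: nat
    show "(\<lambda>a. a l) \<in> borel_measurable (sigma UNIV ?E)"
      unfolding borel_measurable_iff_greater
    proof
      fix c :: real
      have "{a :: nat \<Rightarrow> real. c < a l} = (\<Union>N. {a. \<forall>l'<Suc l. (if l' = l then c else - real N) < a l'})"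
      proof (intro set_eqI iffI)
        fix a :: "nat \<Rightarrow> real" assume "a \<in> {a. c < a l}"
        moreover obtain N where N: "Max ((\<lambda>i. - a i) ` {..l}) < real N" using reals_Archimedean2 by blast
        have "- real N < a i" if "i \<le> l" for i
        proof -
          have "- a i \<le> Max ((\<lambda>i. - a i) ` {..l})" using that by (intro Max_ge) auto
          then show ?thesis using N by linarith
        qed
        ultimately show "a \<in> (\<Union>N. {a. \<forall>l'<Suc l. (if l' = l then c else - real N) < a l'})"
          by (auto intro!: exI[of _ N])
      qed auto
      also have "\<dots> \<in> sets (sigma UNIV ?E)"
      proof (intro sets.countable_UN image_subsetI)
        fix N :: nat
        have "{a. \<forall>l'<Suc l. (if l' = l then c else - real N) < a l'} \<in> ?E"
          by (intro CollectI exI conjI) (rule refl, simp)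
        then have "{a. \<forall>l'<Suc l. (if l' = l then c else - real N) < a l'} \<in> sigma_sets UNIV ?E"
          by (rule sigma_sets.Basic)
        then show "{a. \<forall>l'<Suc l. (if l' = l then c else - real N) < a l'} \<in> sets (sigma UNIV ?E)"
          by (subst sets_measure_of) (simp_all only: Pow_UNIV subset_UNIV)
      qed
      finally show "{a \<in> space (sigma UNIV ?E). c < a l} \<in> sets (sigma UNIV ?E)" by simp
    qed
  qed auto
  then have "(\<lambda>a. a) -` X \<inter> space (sigma UNIV ?E) \<in> sets (sigma UNIV ?E)" if "X \<in> sets real_seq" for X
    using that by (rule measurable_sets)
  then show "sets real_seq \<subseteq> sigma_sets UNIV ?E" by auto
qed

lemma real_seq_measure_eqI:
  fixes P Q :: "(nat \<Rightarrow> real) measure"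
  assumes sets: "sets P = sets real_seq" "sets Q = sets real_seq"
    and fin: "emeasure P UNIV \<noteq> \<infinity>"
    and eq: "\<And>n c. emeasure P {a. \<forall>l<n. c l < a l} = emeasure Q {a. \<forall>l<n. c l < a l}"
  shows "P = Q"
proof (rule measure_eqI_generator_eq[where A = "\<lambda>_. UNIV" and \<Omega> = UNIV and E = "{{a. \<forall>l<n. c l < a l} | n c. True}"])
  show "Int_stable {{a :: nat \<Rightarrow> real. \<forall>l<n. c l < a l} | n c. True}"
  proof (rule Int_stableI)
    fix X Y :: "(nat \<Rightarrow> real) set"
    assume "X \<in> {{a. \<forall>l<n. c l < a l} | n c. True}" "Y \<in> {{a. \<forall>l<n. c l < a l} | n c. True}"
    then obtain n c n' c' where X: "X = {a. \<forall>l<n. c l < a l}" and Y: "Y = {a. \<forall>l<n'. c' l < a l}" by auto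
    define d where "d l = (if l < n \<and> l < n' then max (c l) (c' l) else if l < n then c l else c' l)" for l
    have "X \<inter> Y = {a. \<forall>l<max n n'. d l < a l}"
      unfolding X Y d_def by (auto simp: less_max_iff_disj split: if_splits)
    then show "X \<inter> Y \<in> {{a. \<forall>l<n. c l < a l} | n c. True}" by blast
  qed
  have "UNIV = {a :: nat \<Rightarrow> real. \<forall>l<0. (0 :: real) < a l}" by auto
  then show "range (\<lambda>_ :: nat. UNIV) \<subseteq> {{a :: nat \<Rightarrow> real. \<forall>l<n. c l < a l} | n c. True}" by blast
qed (use assms halfspace_cylinders_generate_real_seq in auto)

definition point_count :: "(nat \<Rightarrow> real) \<Rightarrow> real set \<Rightarrow> ennreal" where
  "point_count a I = emeasure (count_space UNIV) {k. a k \<in> I}"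

definition poisson_prob :: "real \<Rightarrow> nat \<Rightarrow> real" where
  "poisson_prob x k = exp (- x) * x ^ k / fact k"

lemma poisson_prob_nonneg: "0 \<le> x \<Longrightarrow> 0 \<le> poisson_prob x k"
  by (simp add: poisson_prob_def)

lemma poisson_prob_Suc: "real (Suc k) * poisson_prob x (Suc k) = x * poisson_prob x k"
  by (simp add: poisson_prob_def field_simps del: of_nat_Suc)

lemma suminf_poisson_prob:
  assumes "0 \<le> x"
  shows "(\<Sum>k. ennreal (poisson_prob x k)) = 1"
proof -
  have "(\<lambda>k. exp (- x) * (x ^ k / fact k)) sums (exp (- x) * exp x)"
    using exp_converges[of x] by (intro sums_mult) (simp add: divide_inverse mult.commute)
  then have "poisson_prob x sums 1" by (simp add: poisson_prob_def[abs_def] exp_minus)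
  then show ?thesis
    using poisson_prob_nonneg[OF assms] by (subst suminf_ennreal2) (auto simp: sums_iff)
qed

text \<open>Mecke's equation for a vector of independent Poisson variables.\<close>
lemma poisson_vector_shift:
  fixes F :: "(nat \<Rightarrow> nat) \<Rightarrow> ennreal" and L :: "nat \<Rightarrow> real"
  assumes i: "i < n" and L: "\<And>i. 0 \<le> L i"
  defines "T \<equiv> PiE {..<n} (\<lambda>_. UNIV :: nat set)"
  shows "(\<integral>\<^sup>+k. of_nat (k i) * F (k(i := k i - 1)) * ennreal (\<Prod>j<n. poisson_prob (L j) (k j)) \<partial>count_space T) =
    ennreal (L i) * (\<integral>\<^sup>+k. F k * ennreal (\<Prod>j<n. poisson_prob (L j) (k j)) \<partial>count_space T)"
proof -
  define G where "G k = of_nat (k i) * F (k(i := k i - 1)) * ennreal (\<Prod>j<n. poisson_prob (L j) (k j))" for k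
  have bij: "bij_betw (\<lambda>k. k(i := Suc (k i))) T {k \<in> T. 0 < k i}"
  proof (rule bij_betwI[where g = "\<lambda>k. k(i := k i - 1)"])
    show "(\<lambda>k. k(i := Suc (k i))) \<in> T \<rightarrow> {k \<in> T. 0 < k i}"
      using i by (auto simp: T_def PiE_iff extensional_def)
    show "(\<lambda>k. k(i := k i - 1)) \<in> {k \<in> T. 0 < k i} \<rightarrow> T"
      using i by (auto simp: T_def PiE_iff extensional_def)
  qed (auto simp: fun_eq_iff)
  have "(\<integral>\<^sup>+k. G k \<partial>count_space T) = (\<integral>\<^sup>+k. G k \<partial>count_space {k \<in> T. 0 < k i})"
    by (subst (1 2) nn_integral_count_space_indicator)
       (auto intro!: nn_integral_cong simp: G_def split: split_indicator)
  also have "\<dots> = (\<integral>\<^sup>+k. G (k(i := Suc (k i))) \<partial>count_space T)"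
    by (rule nn_integral_bij_count_space[OF bij, symmetric])
  also have "\<dots> = (\<integral>\<^sup>+k. ennreal (L i) * (F k * ennreal (\<Prod>j<n. poisson_prob (L j) (k j))) \<partial>count_space T)"
  proof (rule nn_integral_cong)
    fix k
    have P: "0 \<le> (\<Prod>j\<in>J. poisson_prob (L j) (k j))" for J
      by (intro prod_nonneg ballI poisson_prob_nonneg L)
    have "(\<Prod>j<n. poisson_prob (L j) ((k(i := Suc (k i))) j)) =
       poisson_prob (L i) (Suc (k i)) * (\<Prod>j\<in>{..<n} - {i}. poisson_prob (L j) (k j))"
      using i by (subst prod.remove[of _ i]) auto
    then have "real (Suc (k i)) * (\<Prod>j<n. poisson_prob (L j) ((k(i := Suc (k i))) j)) =
       L i * (poisson_prob (L i) (k i) * (\<Prod>j\<in>{..<n} - {i}. poisson_prob (L j) (k j)))"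
      using poisson_prob_Suc[of "k i" "L i"] by (simp only: mult.assoc[symmetric])
    also have "poisson_prob (L i) (k i) * (\<Prod>j\<in>{..<n} - {i}. poisson_prob (L j) (k j)) = (\<Prod>j<n. poisson_prob (L j) (k j))"
      using i by (subst (2) prod.remove[of _ i]) auto
    finally have "ennreal (real (Suc (k i))) * ennreal (\<Prod>j<n. poisson_prob (L j) ((k(i := Suc (k i))) j)) =
       ennreal (L i) * ennreal (\<Prod>j<n. poisson_prob (L j) (k j))"
      using L P by (subst (1 2) ennreal_mult'[symmetric]) auto
    then show "G (k(i := Suc (k i))) = ennreal (L i) * (F k * ennreal (\<Prod>j<n. poisson_prob (L j) (k j)))"
      unfolding G_def by (simp add: ennreal_of_nat_eq_real_of_nat mult_ac del: of_nat_Suc)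
  qed
  also have "\<dots> = ennreal (L i) * (\<integral>\<^sup>+k. F k * ennreal (\<Prod>j<n. poisson_prob (L j) (k j)) \<partial>count_space T)"
    by (rule nn_integral_cmult) simp
  finally show ?thesis by (simp add: G_def)
qed

text \<open>This translates conditions on a ranked sequence into conditions on counts.\<close>
lemma less_iff_less_card_superlevel:
  fixes a :: "nat \<Rightarrow> real"
  assumes "decseq a" "finite {k. c < a k}"
  shows "c < a l \<longleftrightarrow> l < card {k. c < a k}"
proof
  assume "c < a l"
  then have "{..l} \<subseteq> {k. c < a k}" using assms(1) by (auto simp: decseq_def intro: less_le_trans)
  then have "card {..l} \<le> card {k. c < a k}" by (rule card_mono[OF assms(2)])
  then show "l < card {k. c < a k}" by simp
next
  assume l: "l < card {k. c < a k}"
  show "c < a l"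
  proof (rule ccontr)
    assume "\<not> c < a l"
    then have "{k. c < a k} \<subseteq> {..<l}"
      using assms(1) by (auto simp: decseq_def not_less) (meson leD le_less_trans not_less)
    then have "card {k. c < a k} \<le> card {..<l}" by (intro card_mono) auto
    then show False using l by simp
  qed
qed

lemma point_count_measurable:
  assumes [measurable]: "\<And>k. A k \<in> borel_measurable M" "I \<in> sets borel"
  shows "(\<lambda>\<omega>. point_count (\<lambda>k. A k \<omega>) I) \<in> borel_measurable M"
proof -
  have "point_count (\<lambda>k. A k \<omega>) I = (\<Sum>k. indicator I (A k \<omega>))" for \<omega>
  proof -
    have "point_count (\<lambda>k. A k \<omega>) I = (\<integral>\<^sup>+k. indicator {k. A k \<omega> \<in> I} k \<partial>count_space UNIV)"
      by (simp add: point_count_def)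
    also have "\<dots> = (\<Sum>k. indicator {k. A k \<omega> \<in> I} k)" by (rule nn_integral_count_space_nat)
    finally show ?thesis by (simp add: indicator_def)
  qed
  then show ?thesis by simp
qed

text \<open>Points of a Poisson process with intensity \<open>\<nu>\<close>, listed in decreasing order. The only information about their
  joint law is that of the counts of disjoint sets.\<close>
locale ranked_poisson = prob_space M for M :: "'a measure" +
  fixes A :: "nat \<Rightarrow> 'a \<Rightarrow> real" and \<nu> :: "real measure"
  assumes A_measurable [measurable]: "\<And>k. A k \<in> borel_measurable M"
    and sets_nu [simp, measurable_cong]: "sets \<nu> = sets borel"
    and nu_finite: "\<And>x. 0 < x \<Longrightarrow> emeasure \<nu> {x<..} < \<infinity>"
    and nu_nonpos: "emeasure \<nu> {..0} = 0"
    and A_pos: "AE \<omega> in M. \<forall>k. 0 < A k \<omega>"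
    and A_dec: "AE \<omega> in M. decseq (\<lambda>k. A k \<omega>)"
    and counts: "\<And>(n :: nat) (I :: nat \<Rightarrow> real set) (k :: nat \<Rightarrow> nat). (\<And>i. i < n \<Longrightarrow> I i \<in> sets borel \<and> I i \<subseteq> {0<..} \<and> emeasure \<nu> (I i) < \<infinity>) \<Longrightarrow>
       disjoint_family_on I {..<n} \<Longrightarrow>
       emeasure M {\<omega>\<in>space M. \<forall>i<n. point_count (\<lambda>k. A k \<omega>) (I i) = of_nat (k i)} =
       ennreal (\<Prod>i<n. poisson_prob (measure \<nu> (I i)) (k i))"
begin

lemma AE_finite_points:
  assumes I: "I \<in> sets borel" "I \<subseteq> {0<..}" "emeasure \<nu> I < \<infinity>"
  shows "AE \<omega> in M. finite {k. A k \<omega> \<in> I}"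
proof -
  note [measurable] = point_count_measurable[OF A_measurable I(1)]
  have p: "emeasure M {\<omega>\<in>space M. point_count (\<lambda>k. A k \<omega>) I = of_nat k} = ennreal (poisson_prob (measure \<nu> I) k)" for k
    using counts[of "Suc 0" "\<lambda>_. I" "\<lambda>_. k"] I by (simp add: disjoint_family_on_def)
  have "(\<Sum>k. emeasure M {\<omega>\<in>space M. point_count (\<lambda>k. A k \<omega>) I = of_nat k}) =
     emeasure M (\<Union>k. {\<omega>\<in>space M. point_count (\<lambda>k. A k \<omega>) I = of_nat k})"
    by (rule suminf_emeasure) (auto simp: disjoint_family_on_def)
  moreover have eq: "(\<Union>k. {\<omega>\<in>space M. point_count (\<lambda>k. A k \<omega>) I = of_nat k}) =
      {\<omega>\<in>space M. \<exists>k. point_count (\<lambda>k. A k \<omega>) I = of_nat k}" by auto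
  ultimately have "emeasure M {\<omega>\<in>space M. \<exists>k. point_count (\<lambda>k. A k \<omega>) I = of_nat k} = 1"
    unfolding p suminf_poisson_prob[OF measure_nonneg] eq by simp
  then have "AE \<omega> in M. \<exists>k. point_count (\<lambda>k. A k \<omega>) I = of_nat k"
    by (subst AE_iff_emeasure_eq_1) auto
  then show ?thesis
    by eventually_elim (auto simp: point_count_def emeasure_count_space split: if_splits)
qed

text \<open>Expectations of functions of the counts are sums against the product of Poisson probabilities,
  because the vector of counts takes values in a countable set.\<close>
lemma nn_integral_counts:
  fixes F :: "(nat \<Rightarrow> nat) \<Rightarrow> ennreal"
  assumes I: "\<And>i. i < n \<Longrightarrow> I i \<in> sets borel \<and> I i \<subseteq> {0<..} \<and> emeasure \<nu> (I i) < \<infinity>"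
    and disj: "disjoint_family_on I {..<n}"
  shows "(\<integral>\<^sup>+\<omega>. F (\<lambda>i\<in>{..<n}. card {k. A k \<omega> \<in> I i}) \<partial>M) =
    (\<integral>\<^sup>+k. F k * ennreal (\<Prod>j<n. poisson_prob (measure \<nu> (I j)) (k j)) \<partial>count_space (PiE {..<n} (\<lambda>_. UNIV)))"
proof -
  define T where "T = PiE {..<n} (\<lambda>_. UNIV :: nat set)"
  define K where "K \<omega> = (\<lambda>i\<in>{..<n}. card {k. A k \<omega> \<in> I i})" for \<omega>
  have cT: "countable T" unfolding T_def by (intro countable_PiE) auto
  have Km: "{\<omega>\<in>space M. K \<omega> = k} \<in> sets M" if "k \<in> T" for k
  proof -
    have [measurable]: "(\<lambda>\<omega>. card {k. A k \<omega> \<in> I i}) \<in> measurable M (count_space UNIV)" if "i < n" for i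
    proof -
      have [measurable]: "I i \<in> sets borel" using I that by auto
      show ?thesis by measurable
    qed
    have "{\<omega>\<in>space M. K \<omega> = k} = {\<omega>\<in>space M. \<forall>i\<in>{..<n}. card {k. A k \<omega> \<in> I i} = k i}"
      using that by (fastforce simp: K_def T_def fun_eq_iff PiE_iff extensional_def)
    also have "\<dots> \<in> sets M" by measurable
    finally show ?thesis .
  qed
  have KT: "K \<omega> \<in> T" for \<omega> by (auto simp: K_def T_def)
  have "(\<integral>\<^sup>+\<omega>. F (K \<omega>) \<partial>M) = (\<integral>\<^sup>+\<omega>. (\<integral>\<^sup>+k. F k * indicator {\<omega>\<in>space M. K \<omega> = k} \<omega> \<partial>count_space T) \<partial>M)"
  proof (rule nn_integral_cong)
    fix \<omega> assume "\<omega> \<in> space M"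
    then have "(\<integral>\<^sup>+k. F k * indicator {\<omega>\<in>space M. K \<omega> = k} \<omega> \<partial>count_space T) = (\<integral>\<^sup>+k. F (K \<omega>) * indicator {K \<omega>} k \<partial>count_space T)"
      by (intro nn_integral_cong) (auto split: split_indicator)
    also have "\<dots> = F (K \<omega>)" using KT by (subst nn_integral_cmult_indicator) auto
    finally show "F (K \<omega>) = (\<integral>\<^sup>+k. F k * indicator {\<omega>\<in>space M. K \<omega> = k} \<omega> \<partial>count_space T)" ..
  qed
  also have "\<dots> = (\<integral>\<^sup>+k. (\<integral>\<^sup>+\<omega>. F k * indicator {\<omega>\<in>space M. K \<omega> = k} \<omega> \<partial>M) \<partial>count_space T)"
    using cT Km by (intro nn_integral_count_space_nn_integral) auto
  also have "\<dots> = (\<integral>\<^sup>+k. F k * ennreal (\<Prod>j<n. poisson_prob (measure \<nu> (I j)) (k j)) \<partial>count_space T)"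
  proof (rule nn_integral_cong)
    fix k assume "k \<in> space (count_space T)"
    then have k: "k \<in> T" by simp
    have fin: "AE \<omega> in M. \<forall>i\<in>{..<n}. finite {k. A k \<omega> \<in> I i}"
      using I by (subst AE_ball_countable) (auto intro!: AE_finite_points)
    have [measurable]: "(\<lambda>\<omega>. point_count (\<lambda>k. A k \<omega>) (I i)) \<in> borel_measurable M" if "i < n" for i
      using I that by (intro point_count_measurable A_measurable) auto
    have "emeasure M {\<omega>\<in>space M. K \<omega> = k} = emeasure M {\<omega>\<in>space M. \<forall>i\<in>{..<n}. point_count (\<lambda>k. A k \<omega>) (I i) = of_nat (k i)}"
    proof (rule emeasure_eq_AE)
      show "AE \<omega> in M. \<omega> \<in> {\<omega>\<in>space M. K \<omega> = k} \<longleftrightarrow> \<omega> \<in> {\<omega>\<in>space M. \<forall>i\<in>{..<n}. point_count (\<lambda>k. A k \<omega>) (I i) = of_nat (k i)}"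
        using fin
      proof eventually_elim
        case (elim \<omega>)
        then have "point_count (\<lambda>k. A k \<omega>) (I i) = of_nat (card {k. A k \<omega> \<in> I i})" if "i < n" for i
          using that by (simp add: point_count_def emeasure_count_space)
        then show ?case
          using k by (fastforce simp: K_def T_def fun_eq_iff PiE_iff extensional_def)
      qed
      show "{\<omega>\<in>space M. \<forall>i\<in>{..<n}. point_count (\<lambda>k. A k \<omega>) (I i) = of_nat (k i)} \<in> sets M"
        by measurable
    qed (use Km k in auto)
    also have "\<dots> = ennreal (\<Prod>j<n. poisson_prob (measure \<nu> (I j)) (k j))"
      using counts[OF I disj, of k] by (simp add: Ball_def)
    finally show "(\<integral>\<^sup>+\<omega>. F k * indicator {\<omega>\<in>space M. K \<omega> = k} \<omega> \<partial>M) = F k * ennreal (\<Prod>j<n. poisson_prob (measure \<nu> (I j)) (k j))"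
      using Km[OF k] by (subst nn_integral_cmult_indicator) auto
  qed
  finally show ?thesis by (simp add: K_def T_def)
qed

text \<open>Mecke's equation for a cylinder event. The thresholds \<open>u\<close> and \<open>c l\<close> cut the half-line above the smallest of them into
  finitely many disjoint pieces, and the event depends only on the counts of these pieces. Removing a point lowers
  the count of its piece by one, so the claim reduces to \<open>poisson_vector_shift\<close>.\<close>
lemma mecke_cylinder:
  fixes c :: "nat \<Rightarrow> real"
  assumes u: "0 < u"
  shows "(\<integral>\<^sup>+\<omega>. (\<Sum>j. indicator {u<..} (A j \<omega>) * indicator {a. \<forall>l<n. c l < a l} (\<lambda>i. A (skip j i) \<omega>)) \<partial>M) =
    emeasure \<nu> {u<..} * (\<integral>\<^sup>+\<omega>. indicator {a. \<forall>l<n. c l < a l} (\<lambda>i. A i \<omega>) \<partial>M)"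
proof -
  \<comment> \<open>Thresholds \<open>c l \<le> 0\<close> impose nothing, since all points are positive.\<close>
  define D where "D = insert u {c l | l. l < n \<and> 0 < c l}"
  have D: "finite D" "\<And>d. d \<in> D \<Longrightarrow> 0 < d" "u \<in> D" using u by (auto simp: D_def)
  define p where "p = card D"
  obtain h where h: "bij_betw h {..<p} D"
    using ex_bij_betw_nat_finite[OF D(1)] by (auto simp: p_def atLeast0LessThan)
  have hD: "h i \<in> D" if "i < p" for i using h that by (auto simp: bij_betw_def)
  \<comment> \<open>The points above the threshold \<open>h i\<close> and up to the next larger threshold, if there is one.\<close>
  define I where "I i = {x. h i < x \<and> (\<forall>d\<in>D. h i < d \<longrightarrow> x \<le> d)}" for i
  define T where "T d = {i\<in>{..<p}. d \<le> h i}" for d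
  have Tfin: "finite (T d)" for d by (simp add: T_def)
  have I_mem: "d < x \<longleftrightarrow> i \<in> T d" if "i < p" "d \<in> D" "x \<in> I i" for i d x
    using that by (auto simp: I_def T_def not_less intro: le_less_trans)
  have I_ex: "\<exists>i\<in>T d. x \<in> I i" if d: "d \<in> D" and x: "d < x" for d x
  proof -
    define e where "e = Max {e\<in>D. e < x}"
    have e: "e \<in> {e\<in>D. e < x}" unfolding e_def using D d x by (intro Max_in) auto
    have e2: "e' \<le> e" if "e' \<in> D" "e' < x" for e' unfolding e_def using D that by (intro Max_ge) auto
    obtain i where i: "i < p" "h i = e" using h e by (auto simp: bij_betw_def)
    have "x \<in> I i" using e e2 i by (auto simp: I_def not_less[symmetric])
    moreover have "i \<in> T d" using e2[OF d x] i by (simp add: T_def)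
    ultimately show ?thesis by blast
  qed
  have disj: "disjoint_family_on I {..<p}"
  proof -
    have "I i \<inter> I j = {}" if "i < p" "j < p" "h i < h j" for i j
      using that hD by (auto simp: I_def not_less[symmetric])
    moreover have "h i \<noteq> h j" if "i < p" "j < p" "i \<noteq> j" for i j
      using h that by (auto simp: bij_betw_def inj_on_def)
    ultimately show ?thesis unfolding disjoint_family_on_def
      by (metis Int_commute lessThan_iff linorder_neqE_linordered_idom)
  qed
  have super: "{d<..} = (\<Union>i\<in>T d. I i)" if "d \<in> D" for d
    using I_ex[OF that] I_mem[OF _ that] by (fastforce simp: T_def)
  have Iprop: "I i \<in> sets borel \<and> I i \<subseteq> {0<..} \<and> emeasure \<nu> (I i) < \<infinity>" if i: "i < p" for i
  proof -
    have "I i = {h i<..} \<inter> (\<Inter>d\<in>D. if h i < d then {..d} else UNIV)"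
      by (auto simp: I_def split: if_splits)
    moreover have "{h i<..} \<inter> (\<Inter>d\<in>D. if h i < d then {..d} else UNIV) \<in> sets borel"
      using D by (intro sets.Int sets.finite_INT) auto
    ultimately have s: "I i \<in> sets borel" by simp
    have sub: "I i \<subseteq> {h i<..}" by (auto simp: I_def)
    have "emeasure \<nu> (I i) \<le> emeasure \<nu> {h i<..}" using sub by (intro emeasure_mono) auto
    also have "\<dots> < \<infinity>" using D(2)[OF hD[OF i]] by (rule nu_finite)
    finally show ?thesis using s sub D(2)[OF hD[OF i]] by fastforce
  qed
  define K where "K \<omega> = (\<lambda>i\<in>{..<p}. card {k. A k \<omega> \<in> I i})" for \<omega>
  \<comment> \<open>The cylinder event in terms of the counts: the point of rank \<open>l\<close> exceeds \<open>c l\<close> when more than \<open>l\<close> points do.\<close>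
  define F :: "(nat \<Rightarrow> nat) \<Rightarrow> ennreal" where "F k = (if \<forall>l<n. 0 < c l \<longrightarrow> l < (\<Sum>i\<in>T (c l). k i) then 1 else 0)" for k
  have good: "AE \<omega> in M. (\<forall>i\<in>{..<p}. finite {k. A k \<omega> \<in> I i}) \<and> (\<forall>k. 0 < A k \<omega>) \<and> decseq (\<lambda>k. A k \<omega>)"
  proof -
    have "AE \<omega> in M. \<forall>i\<in>{..<p}. finite {k. A k \<omega> \<in> I i}"
      using Iprop by (subst AE_ball_countable) (auto intro!: AE_finite_points)
    then show ?thesis using A_pos A_dec by eventually_elim auto
  qed
  have card_super: "finite {k. a k > d} \<and> card {k. a k > d} = (\<Sum>i\<in>T d. card {k. a k \<in> I i})"
    if d: "d \<in> D" and fin: "\<forall>i\<in>{..<p}. finite {k. a k \<in> I i}" for d and a :: "nat \<Rightarrow> real"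
  proof -
    have "{k. a k > d} = (\<Union>i\<in>T d. {k. a k \<in> I i})" using super[OF d] by auto
    moreover have "card (\<Union>i\<in>T d. {k. a k \<in> I i}) = (\<Sum>i\<in>T d. card {k. a k \<in> I i})"
    proof (rule card_UN_disjoint)
      show "\<forall>i\<in>T d. \<forall>j\<in>T d. i \<noteq> j \<longrightarrow> {k. a k \<in> I i} \<inter> {k. a k \<in> I j} = {}"
        using disj by (auto simp: disjoint_family_on_def T_def)
    qed (use fin Tfin in \<open>auto simp: T_def\<close>)
    ultimately show ?thesis using fin Tfin by (auto simp: T_def)
  qed
  have FI: "indicator {a. \<forall>l<n. c l < a l} a = F k"
    if pos: "\<forall>l. 0 < a l" and dec: "decseq a" and fin: "\<And>d. d \<in> D \<Longrightarrow> finite {l. d < a l}"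
      and card: "\<And>d. d \<in> D \<Longrightarrow> card {l. d < a l} = (\<Sum>i\<in>T d. k i)" for a k
  proof -
    have "c l < a l \<longleftrightarrow> (0 < c l \<longrightarrow> l < (\<Sum>i\<in>T (c l). k i))" if l: "l < n" for l
    proof (cases "0 < c l")
      case True
      then have "c l \<in> D" using l by (auto simp: D_def)
      then show ?thesis using less_iff_less_card_superlevel[OF dec fin] card True by simp
    next
      case False
      then have "c l < a l" using pos[rule_format, of l] by linarith
      then show ?thesis using False by simp
    qed
    then show ?thesis by (auto simp: F_def indicator_def)
  qed
  have rhs: "AE \<omega> in M. indicator {a. \<forall>l<n. c l < a l} (\<lambda>i. A i \<omega>) = F (K \<omega>)"
    using good
  proof eventually_elim
    case (elim \<omega>)
    show ?case
    proof (rule FI)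
      fix d assume d: "d \<in> D"
      show "finite {l. d < A l \<omega>}" using card_super[OF d, of "\<lambda>k. A k \<omega>"] elim by auto
      show "card {l. d < A l \<omega>} = (\<Sum>i\<in>T d. K \<omega> i)"
        using card_super[OF d, of "\<lambda>k. A k \<omega>"] elim by (auto simp: K_def T_def)
    qed (use elim in auto)
  qed
  have lhs: "AE \<omega> in M. (\<Sum>j. indicator {u<..} (A j \<omega>) * indicator {a. \<forall>l<n. c l < a l} (\<lambda>i. A (skip j i) \<omega>)) =
     (\<Sum>i\<in>T u. of_nat (K \<omega> i) * F ((K \<omega>)(i := K \<omega> i - 1)))"
    using good
  proof eventually_elim
    case (elim \<omega>)
    have termj: "indicator {u<..} (A j \<omega>) * indicator {a. \<forall>l<n. c l < a l} (\<lambda>i. A (skip j i) \<omega>) =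
       (\<Sum>i\<in>T u. indicator {k. A k \<omega> \<in> I i} j * F ((K \<omega>)(i := K \<omega> i - 1)))" for j
    proof (cases "u < A j \<omega>")
      case False
      then have "indicator {k. A k \<omega> \<in> I i} j = (0 :: ennreal)" if "i \<in> T u" for i
        using I_mem[of i u "A j \<omega>"] that D by (auto simp: T_def indicator_def)
      then show ?thesis using False by simp
    next
      case True
      then obtain i where i: "i \<in> T u" "A j \<omega> \<in> I i" using I_ex[OF D(3)] by blast
      then have ip: "i < p" by (simp add: T_def)
      have uni: "indicator {k. A k \<omega> \<in> I i'} j = (0 :: ennreal)" if "i' \<in> T u" "i' \<noteq> i" for i'
        using disj i that by (auto simp: disjoint_family_on_def T_def indicator_def)
      have "(\<Sum>i\<in>T u. indicator {k. A k \<omega> \<in> I i} j * F ((K \<omega>)(i := K \<omega> i - 1))) = F ((K \<omega>)(i := K \<omega> i - 1))"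
        using i uni by (subst sum.remove[OF Tfin i(1)]) (auto intro!: sum.neutral)
      also have "\<dots> = indicator {a. \<forall>l<n. c l < a l} (\<lambda>i. A (skip j i) \<omega>)"
      proof (rule FI[symmetric])
        show "\<forall>l. 0 < A (skip j l) \<omega>" using elim by auto
        show "decseq (\<lambda>i. A (skip j i) \<omega>)"
          using elim strict_mono_mono[OF strict_mono_skip, of j] by (auto simp: decseq_def mono_def)
        fix d assume d: "d \<in> D"
        have fin: "finite {l. d < A l \<omega>}" using card_super[OF d, of "\<lambda>k. A k \<omega>"] elim by auto
        have img: "skip j ` {l. d < A (skip j l) \<omega>} = {l. d < A l \<omega>} - {j}"
          using range_skip[of j] by auto
        show "finite {l. d < A (skip j l) \<omega>}"
          using fin img by (metis finite_Diff finite_imageD inj_on_subset inj_skip subset_UNIV)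
        have "card {l. d < A (skip j l) \<omega>} = card ({l. d < A l \<omega>} - {j})"
          unfolding img[symmetric] by (rule card_image[symmetric]) (metis inj_on_subset inj_skip subset_UNIV)
        also have "\<dots> = card {l. d < A l \<omega>} - (if i \<in> T d then 1 else 0)"
          using fin I_mem[OF ip d i(2)] by (auto simp: card_Diff_singleton)
        also have "card {l. d < A l \<omega>} = (\<Sum>i\<in>T d. K \<omega> i)"
          using card_super[OF d, of "\<lambda>k. A k \<omega>"] elim by (auto simp: K_def T_def)
        also have "(\<Sum>i\<in>T d. K \<omega> i) - (if i \<in> T d then 1 else 0) = (\<Sum>i'\<in>T d. ((K \<omega>)(i := K \<omega> i - 1)) i')"
        proof (cases "i \<in> T d")
          case True
          have "{k. A k \<omega> \<in> I i} \<noteq> {}" "finite {k. A k \<omega> \<in> I i}" using i ip elim by auto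
          then have "0 < K \<omega> i" using ip by (simp add: K_def card_gt_0_iff)
          then show ?thesis using True by (subst (1 2) sum.remove[OF Tfin True]) auto
        qed (auto intro!: sum.cong)
        finally show "card {l. d < A (skip j l) \<omega>} = (\<Sum>i'\<in>T d. ((K \<omega>)(i := K \<omega> i - 1)) i')" .
      qed
      finally show ?thesis using True by simp
    qed
    have "(\<Sum>j. \<Sum>i\<in>T u. indicator {k. A k \<omega> \<in> I i} j * F ((K \<omega>)(i := K \<omega> i - 1))) =
      (\<Sum>i\<in>T u. (\<Sum>j. indicator {k. A k \<omega> \<in> I i} j) * F ((K \<omega>)(i := K \<omega> i - 1)))"
      by (subst suminf_sum) auto
    also have "\<dots> = (\<Sum>i\<in>T u. of_nat (K \<omega> i) * F ((K \<omega>)(i := K \<omega> i - 1)))"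
    proof (rule sum.cong[OF refl])
      fix i assume i: "i \<in> T u"
      have "(\<Sum>j. indicator {k. A k \<omega> \<in> I i} j :: ennreal) = emeasure (count_space UNIV) {k. A k \<omega> \<in> I i}"
        by (subst nn_integral_count_space_nat[symmetric]) simp
      also have "\<dots> = of_nat (K \<omega> i)"
        using i elim by (auto simp: K_def T_def emeasure_count_space)
      finally show "(\<Sum>j. indicator {k. A k \<omega> \<in> I i} j) * F ((K \<omega>)(i := K \<omega> i - 1)) = of_nat (K \<omega> i) * F ((K \<omega>)(i := K \<omega> i - 1))"
        by simp
    qed
    finally show ?case unfolding termj .
  qed
  define P where "P k = ennreal (\<Prod>j<p. poisson_prob (measure \<nu> (I j)) (k j))" for k
  define S where "S = PiE {..<p} (\<lambda>_. UNIV :: nat set)"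
  have int: "(\<integral>\<^sup>+\<omega>. G (K \<omega>) \<partial>M) = (\<integral>\<^sup>+k. G k * P k \<partial>count_space S)" for G
    unfolding K_def P_def S_def by (rule nn_integral_counts[OF Iprop disj])
  have "(\<integral>\<^sup>+\<omega>. (\<Sum>j. indicator {u<..} (A j \<omega>) * indicator {a. \<forall>l<n. c l < a l} (\<lambda>i. A (skip j i) \<omega>)) \<partial>M) =
     (\<integral>\<^sup>+\<omega>. (\<Sum>i\<in>T u. of_nat (K \<omega> i) * F ((K \<omega>)(i := K \<omega> i - 1))) \<partial>M)"
    by (rule nn_integral_cong_AE[OF lhs])
  also have "\<dots> = (\<integral>\<^sup>+k. (\<Sum>i\<in>T u. of_nat (k i) * F (k(i := k i - 1))) * P k \<partial>count_space S)"
    by (rule int)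
  also have "\<dots> = (\<Sum>i\<in>T u. (\<integral>\<^sup>+k. of_nat (k i) * F (k(i := k i - 1)) * P k \<partial>count_space S))"
    unfolding sum_distrib_right by (rule nn_integral_sum) simp
  also have "\<dots> = (\<Sum>i\<in>T u. emeasure \<nu> (I i) * (\<integral>\<^sup>+k. F k * P k \<partial>count_space S))"
  proof (rule sum.cong[OF refl])
    fix i assume "i \<in> T u"
    then have i: "i < p" by (simp add: T_def)
    have "ennreal (measure \<nu> (I i)) = emeasure \<nu> (I i)"
      using Iprop[OF i] by (intro emeasure_eq_ennreal_measure[symmetric]) auto
    then show "(\<integral>\<^sup>+k. of_nat (k i) * F (k(i := k i - 1)) * P k \<partial>count_space S) = emeasure \<nu> (I i) * (\<integral>\<^sup>+k. F k * P k \<partial>count_space S)"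
      unfolding P_def S_def using poisson_vector_shift[OF i, of "\<lambda>j. measure \<nu> (I j)" F] by simp
  qed
  also have "\<dots> = emeasure \<nu> (\<Union>i\<in>T u. I i) * (\<integral>\<^sup>+k. F k * P k \<partial>count_space S)"
    unfolding sum_distrib_right[symmetric]
    by (subst sum_emeasure) (use Iprop disj Tfin in \<open>auto simp: T_def disjoint_family_on_def\<close>)
  also have "(\<integral>\<^sup>+k. F k * P k \<partial>count_space S) = (\<integral>\<^sup>+\<omega>. F (K \<omega>) \<partial>M)"
    by (rule int[symmetric])
  also have "\<dots> = (\<integral>\<^sup>+\<omega>. indicator {a. \<forall>l<n. c l < a l} (\<lambda>i. A i \<omega>) \<partial>M)"
    by (rule nn_integral_cong_AE) (use rhs in eventually_elim, simp)
  finally show ?thesis unfolding super[OF D(3)] .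
qed

end

section \<open>Mecke's equation and the jumps of a stable subordinator\<close>

context ranked_poisson
begin

text \<open>Mecke's equation: adding up over all points, each point paired with the configuration without it, has the same
  expectation as adding an independent point with intensity \<open>\<nu>\<close>. The pair \<open>(x, a)\<close> is coded as the sequence that
  starts with \<open>x\<close> and continues with \<open>a\<close>; restricted to \<open>x > e\<close> both sides are finite
  measures on sequences, and they agree on half-line cylinders.\<close>
theorem mecke:
  assumes h [measurable]: "(\<lambda>(x, a). h x a) \<in> borel_measurable (borel \<Otimes>\<^sub>M real_seq)"
  shows "(\<integral>\<^sup>+\<omega>. (\<Sum>j. h (A j \<omega>) (\<lambda>i. A (skip j i) \<omega>)) \<partial>M) = (\<integral>\<^sup>+x. (\<integral>\<^sup>+\<omega>. h x (\<lambda>i. A i \<omega>) \<partial>M) \<partial>\<nu>)"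
proof -
  have Ap [measurable]: "(\<lambda>\<omega>. (\<lambda>i. A (skip j i) \<omega>)) \<in> measurable M real_seq" for j
    by (rule measurable_PiM_single') auto
  have A [measurable]: "(\<lambda>\<omega>. (\<lambda>i. A i \<omega>)) \<in> measurable M real_seq"
    by (rule measurable_PiM_single') auto
  define p1 where "p1 = (\<lambda>(j, \<omega>). case_nat (A j \<omega>) (\<lambda>i. A (skip j i) \<omega>))"
  define p2 where "p2 = (\<lambda>(x, \<omega>). case_nat x (\<lambda>i. A i \<omega>) :: nat \<Rightarrow> real)"
  have p1 [measurable]: "p1 \<in> measurable (count_space UNIV \<Otimes>\<^sub>M M) real_seq"
  proof (rule measurable_pair_measure_countable1)
    show "(\<lambda>\<omega>. p1 (j, \<omega>)) \<in> measurable M real_seq" for j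
      unfolding p1_def by (rule measurable_PiM_single') (auto split: nat.split)
  qed auto
  have p2 [measurable]: "p2 \<in> measurable (\<nu> \<Otimes>\<^sub>M M) real_seq"
    unfolding p2_def by (rule measurable_PiM_single') (auto simp: split_beta' space_PiM split: nat.split)
  have Aj [measurable]: "(\<lambda>(j, \<omega>). A j \<omega>) \<in> borel_measurable (count_space UNIV \<Otimes>\<^sub>M M)"
    by (rule measurable_pair_measure_countable1) auto
  define N1 where "N1 e = distr (density (count_space UNIV \<Otimes>\<^sub>M M) (\<lambda>q. indicator {e<..} (A (fst q) (snd q)))) real_seq p1" for e
  define N2 where "N2 e = distr (density (\<nu> \<Otimes>\<^sub>M M) (\<lambda>q. indicator {e<..} (fst q))) real_seq p2" for e
  have N1: "(\<integral>\<^sup>+a. H a \<partial>N1 e) = (\<integral>\<^sup>+\<omega>. (\<Sum>j. indicator {e<..} (A j \<omega>) * H (p1 (j, \<omega>))) \<partial>M)"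
    if [measurable]: "H \<in> borel_measurable real_seq" for H e
  proof -
    have [measurable]: "(\<lambda>q. indicator {e<..} (A (fst q) (snd q)) :: ennreal) \<in> borel_measurable (count_space UNIV \<Otimes>\<^sub>M M)"
      using Aj by (simp add: split_beta')
    have [measurable]: "(\<lambda>\<omega>. H (p1 (j, \<omega>))) \<in> borel_measurable M" for j by measurable
    have "(\<integral>\<^sup>+a. H a \<partial>N1 e) = (\<integral>\<^sup>+q. indicator {e<..} (A (fst q) (snd q)) * H (p1 q) \<partial>(count_space UNIV \<Otimes>\<^sub>M M))"
      unfolding N1_def by (subst nn_integral_distr) (auto simp: nn_integral_density)
    also have "\<dots> = (\<integral>\<^sup>+j. (\<integral>\<^sup>+\<omega>. indicator {e<..} (A j \<omega>) * H (p1 (j, \<omega>)) \<partial>M) \<partial>count_space UNIV)"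
      by (subst nn_integral_fst[symmetric]) auto
    also have "\<dots> = (\<Sum>j. (\<integral>\<^sup>+\<omega>. indicator {e<..} (A j \<omega>) * H (p1 (j, \<omega>)) \<partial>M))"
      by (rule nn_integral_count_space_nat)
    also have "\<dots> = (\<integral>\<^sup>+\<omega>. (\<Sum>j. indicator {e<..} (A j \<omega>) * H (p1 (j, \<omega>))) \<partial>M)"
      by (rule nn_integral_suminf[symmetric]) measurable
    finally show ?thesis .
  qed
  have N2: "(\<integral>\<^sup>+a. H a \<partial>N2 e) = (\<integral>\<^sup>+x. indicator {e<..} x * (\<integral>\<^sup>+\<omega>. H (p2 (x, \<omega>)) \<partial>M) \<partial>\<nu>)"
    if [measurable]: "H \<in> borel_measurable real_seq" for H e
  proof -
    have "(\<integral>\<^sup>+a. H a \<partial>N2 e) = (\<integral>\<^sup>+q. indicator {e<..} (fst q) * H (p2 q) \<partial>(\<nu> \<Otimes>\<^sub>M M))"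
      unfolding N2_def by (subst nn_integral_distr) (auto simp: nn_integral_density)
    also have "\<dots> = (\<integral>\<^sup>+x. (\<integral>\<^sup>+\<omega>. indicator {e<..} x * H (p2 (x, \<omega>)) \<partial>M) \<partial>\<nu>)"
      by (subst nn_integral_fst[symmetric]) auto
    also have "\<dots> = (\<integral>\<^sup>+x. indicator {e<..} x * (\<integral>\<^sup>+\<omega>. H (p2 (x, \<omega>)) \<partial>M) \<partial>\<nu>)"
      by (intro nn_integral_cong nn_integral_cmult) measurable
    finally show ?thesis .
  qed
  have cyl [measurable]: "{a. \<forall>l<n. c l < a l} \<in> sets real_seq" for n and c :: "nat \<Rightarrow> real"
    unfolding halfspace_cylinders_generate_real_seq by (intro sigma_sets.Basic) blast
  have key: "emeasure (N1 e) {a. \<forall>l<n. c l < a l} = emeasure (N2 e) {a. \<forall>l<n. c l < a l}"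
    if e: "0 < e" for e n c
  proof -
    obtain u n' c' where u: "0 < u" and
      eq: "\<And>x a. indicator {e<..} x * indicator {a. \<forall>l<n. c l < a l} (case_nat x a) = (indicator {u<..} x * indicator {a. \<forall>l<n'. c' l < a l} a :: ennreal)"
    proof (cases n)
      case 0
      then show ?thesis using e by (intro that[of e 0 c]) auto
    next
      case (Suc n')
      have "(\<forall>l<Suc n'. c l < (case l of 0 \<Rightarrow> x | Suc i \<Rightarrow> a i)) \<longleftrightarrow> c 0 < x \<and> (\<forall>l<n'. c (Suc l) < a l)" for x :: real and a
        by (auto simp: less_Suc_eq_0_disj)
      then show ?thesis using e Suc by (intro that[of "max e (c 0)" n' "\<lambda>l. c (Suc l)"]) (auto simp: indicator_def)
    qed
    have "emeasure (N1 e) {a. \<forall>l<n. c l < a l} = (\<integral>\<^sup>+a. indicator {a. \<forall>l<n. c l < a l} a \<partial>N1 e)"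
      by (subst nn_integral_indicator) (auto simp: N1_def)
    also have "\<dots> = (\<integral>\<^sup>+\<omega>. (\<Sum>j. indicator {u<..} (A j \<omega>) * indicator {a. \<forall>l<n'. c' l < a l} (\<lambda>i. A (skip j i) \<omega>)) \<partial>M)"
      by (subst N1) (simp_all add: p1_def eq)
    also have "\<dots> = emeasure \<nu> {u<..} * (\<integral>\<^sup>+\<omega>. indicator {a. \<forall>l<n'. c' l < a l} (\<lambda>i. A i \<omega>) \<partial>M)"
      by (rule mecke_cylinder[OF u])
    also have "\<dots> = (\<integral>\<^sup>+x. indicator {u<..} x * (\<integral>\<^sup>+\<omega>. indicator {a. \<forall>l<n'. c' l < a l} (\<lambda>i. A i \<omega>) \<partial>M) \<partial>\<nu>)"
      by (simp add: nn_integral_multc)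
    also have "\<dots> = (\<integral>\<^sup>+x. (\<integral>\<^sup>+\<omega>. indicator {u<..} x * indicator {a. \<forall>l<n'. c' l < a l} (\<lambda>i. A i \<omega>) \<partial>M) \<partial>\<nu>)"
      by (intro nn_integral_cong nn_integral_cmult[symmetric]) measurable
    also have "\<dots> = (\<integral>\<^sup>+x. (\<integral>\<^sup>+\<omega>. indicator {e<..} x * indicator {a. \<forall>l<n. c l < a l} (p2 (x, \<omega>)) \<partial>M) \<partial>\<nu>)"
      unfolding p2_def split by (subst eq) (rule refl)
    also have "\<dots> = (\<integral>\<^sup>+x. indicator {e<..} x * (\<integral>\<^sup>+\<omega>. indicator {a. \<forall>l<n. c l < a l} (p2 (x, \<omega>)) \<partial>M) \<partial>\<nu>)"
    proof (intro nn_integral_cong nn_integral_cmult)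
      fix x assume "x \<in> space \<nu>"
      then have "Pair x \<in> measurable M (\<nu> \<Otimes>\<^sub>M M)" by measurable
      then have "(\<lambda>\<omega>. p2 (x, \<omega>)) \<in> measurable M real_seq" by (rule measurable_compose) measurable
      then show "(\<lambda>\<omega>. indicator {a. \<forall>l<n. c l < a l} (p2 (x, \<omega>)) :: ennreal) \<in> borel_measurable M" by measurable
    qed
    also have "\<dots> = (\<integral>\<^sup>+a. indicator {a. \<forall>l<n. c l < a l} a \<partial>N2 e)"
      by (rule N2[symmetric]) measurable
    also have "\<dots> = emeasure (N2 e) {a. \<forall>l<n. c l < a l}"
      by (subst nn_integral_indicator) (auto simp: N2_def)
    finally show ?thesis .
  qed
  have N12: "N1 e = N2 e" if e: "0 < e" for e
  proof (rule real_seq_measure_eqI)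
    have "UNIV = {a :: nat \<Rightarrow> real. \<forall>l<0. (0 :: real) < a l}" by auto
    then have "emeasure (N1 e) UNIV = emeasure (N2 e) UNIV" using key[OF e, of 0 "\<lambda>_. 0"] by simp
    also have "\<dots> = (\<integral>\<^sup>+a. 1 \<partial>N2 e)" by (simp add: N2_def space_PiM)
    also have "\<dots> = emeasure \<nu> {e<..}" by (subst N2) (auto simp: emeasure_space_1)
    also have "\<dots> < \<infinity>" by (rule nu_finite[OF e])
    finally show "emeasure (N1 e) UNIV \<noteq> \<infinity>" by simp
  qed (use key[OF e] in \<open>auto simp: N1_def N2_def\<close>)
  define H where "H a = h (a 0) (\<lambda>i. a (Suc i))" for a :: "nat \<Rightarrow> real"
  have Hm [measurable]: "H \<in> borel_measurable real_seq"
  proof -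
    have [measurable]: "(\<lambda>a. \<lambda>i. a (Suc i)) \<in> measurable real_seq real_seq"
      by (rule measurable_PiM_single') (auto simp: space_PiM)
    have "(\<lambda>a. (a 0, \<lambda>i. a (Suc i))) \<in> measurable real_seq (borel \<Otimes>\<^sub>M real_seq)" by measurable
    from measurable_compose[OF this h] show ?thesis unfolding H_def by simp
  qed
  have Hp: "H (p1 (j, \<omega>)) = h (A j \<omega>) (\<lambda>i. A (skip j i) \<omega>)" "H (p2 (x, \<omega>)) = h x (\<lambda>i. A i \<omega>)" for j \<omega> x
    by (simp_all add: H_def p1_def p2_def)
  \<comment> \<open>All points are positive, so the restriction to points above \<open>e i\<close> is removed by monotone convergence.\<close>
  define e where "e i = 1 / real (Suc i)" for i
  have e: "0 < e i" for i by (simp add: e_def)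
  have inc: "incseq (\<lambda>i. indicator {e i<..} x * c)" for x :: real and c :: ennreal
  proof (rule incseq_SucI)
    fix i
    have "e (Suc i) \<le> e i" unfolding e_def by (simp add: divide_simps)
    then show "indicator {e i<..} x * c \<le> indicator {e (Suc i)<..} x * c"
      by (auto split: split_indicator)
  qed
  have sup: "(SUP i. indicator {e i<..} x * c) = indicator {0<..} x * c" for x :: real and c :: ennreal
  proof (cases "0 < x")
    case True
    then obtain i where "inverse (real (Suc i)) < x" using reals_Archimedean by blast
    then have i: "e i < x" by (simp add: e_def divide_inverse)
    show ?thesis
    proof (rule antisym)
      show "indicator {0<..} x * c \<le> (SUP i. indicator {e i<..} x * c)"
        using i True by (intro SUP_upper2[of i]) auto
    qed (use True in \<open>auto intro!: SUP_least split: split_indicator\<close>)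
  next
    case False
    then have zero: "indicator {e i<..} x * c = 0" for i using e[of i] by (auto split: split_indicator)
    show ?thesis unfolding zero using False by simp
  qed
  have h1 [measurable]: "(\<lambda>\<omega>. h (A j \<omega>) (\<lambda>i. A (skip j i) \<omega>)) \<in> borel_measurable M" for j
  proof -
    have "(\<lambda>\<omega>. (A j \<omega>, \<lambda>i. A (skip j i) \<omega>)) \<in> measurable M (borel \<Otimes>\<^sub>M real_seq)" by measurable
    from measurable_compose[OF this h] show ?thesis by simp
  qed
  have h2 [measurable]: "(\<lambda>x. (\<integral>\<^sup>+\<omega>. h x (\<lambda>i. A i \<omega>) \<partial>M)) \<in> borel_measurable \<nu>"
  proof -
    have "(\<lambda>q. (fst q, \<lambda>i. A i (snd q))) \<in> measurable (\<nu> \<Otimes>\<^sub>M M) (borel \<Otimes>\<^sub>M real_seq)" by measurable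
    from measurable_compose[OF this h] have "(\<lambda>q. h (fst q) (\<lambda>i. A i (snd q))) \<in> borel_measurable (\<nu> \<Otimes>\<^sub>M M)" by simp
    then show ?thesis by (intro borel_measurable_nn_integral) (simp add: split_beta')
  qed
  have "(\<integral>\<^sup>+\<omega>. (\<Sum>j. h (A j \<omega>) (\<lambda>i. A (skip j i) \<omega>)) \<partial>M) = (\<Sum>j. (\<integral>\<^sup>+\<omega>. indicator {0<..} (A j \<omega>) * h (A j \<omega>) (\<lambda>i. A (skip j i) \<omega>) \<partial>M))"
  proof -
    have "(\<integral>\<^sup>+\<omega>. (\<Sum>j. h (A j \<omega>) (\<lambda>i. A (skip j i) \<omega>)) \<partial>M) = (\<Sum>j. (\<integral>\<^sup>+\<omega>. h (A j \<omega>) (\<lambda>i. A (skip j i) \<omega>) \<partial>M))"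
      by (rule nn_integral_suminf) measurable
    also have "\<dots> = (\<Sum>j. (\<integral>\<^sup>+\<omega>. indicator {0<..} (A j \<omega>) * h (A j \<omega>) (\<lambda>i. A (skip j i) \<omega>) \<partial>M))"
      by (intro suminf_cong nn_integral_cong_AE) (use A_pos in eventually_elim, auto)
    finally show ?thesis .
  qed
  also have "\<dots> = (\<integral>\<^sup>+j. (\<integral>\<^sup>+\<omega>. (SUP i. indicator {e i<..} (A j \<omega>) * h (A j \<omega>) (\<lambda>i. A (skip j i) \<omega>)) \<partial>M) \<partial>count_space UNIV)"
    unfolding sup by (rule nn_integral_count_space_nat[symmetric])
  also have "\<dots> = (\<integral>\<^sup>+j. (SUP i. (\<integral>\<^sup>+\<omega>. indicator {e i<..} (A j \<omega>) * h (A j \<omega>) (\<lambda>i. A (skip j i) \<omega>) \<partial>M)) \<partial>count_space UNIV)"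
  proof (intro nn_integral_cong nn_integral_monotone_convergence_SUP)
    show "incseq (\<lambda>i \<omega>. indicator {e i<..} (A j \<omega>) * h (A j \<omega>) (\<lambda>i. A (skip j i) \<omega>))" for j
      using inc by (simp add: incseq_def le_fun_def)
  qed measurable
  also have "\<dots> = (SUP i. (\<integral>\<^sup>+j. (\<integral>\<^sup>+\<omega>. indicator {e i<..} (A j \<omega>) * h (A j \<omega>) (\<lambda>i. A (skip j i) \<omega>) \<partial>M) \<partial>count_space UNIV))"
  proof (rule nn_integral_monotone_convergence_SUP)
    show "incseq (\<lambda>i j. \<integral>\<^sup>+\<omega>. indicator {e i<..} (A j \<omega>) * h (A j \<omega>) (\<lambda>i. A (skip j i) \<omega>) \<partial>M)"
      using inc by (auto simp: incseq_def le_fun_def intro!: nn_integral_mono)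
  qed auto
  also have "\<dots> = (SUP i. (\<integral>\<^sup>+a. H a \<partial>N1 (e i)))"
  proof (rule SUP_cong[OF refl])
    fix i
    have "(\<integral>\<^sup>+j. (\<integral>\<^sup>+\<omega>. indicator {e i<..} (A j \<omega>) * h (A j \<omega>) (\<lambda>i. A (skip j i) \<omega>) \<partial>M) \<partial>count_space UNIV) =
       (\<integral>\<^sup>+\<omega>. (\<Sum>j. indicator {e i<..} (A j \<omega>) * h (A j \<omega>) (\<lambda>i. A (skip j i) \<omega>)) \<partial>M)"
      unfolding nn_integral_count_space_nat by (rule nn_integral_suminf[symmetric]) measurable
    also have "\<dots> = (\<integral>\<^sup>+a. H a \<partial>N1 (e i))" by (simp add: N1[OF Hm] Hp)
    finally show "(\<integral>\<^sup>+j. (\<integral>\<^sup>+\<omega>. indicator {e i<..} (A j \<omega>) * h (A j \<omega>) (\<lambda>i. A (skip j i) \<omega>) \<partial>M) \<partial>count_space UNIV) = (\<integral>\<^sup>+a. H a \<partial>N1 (e i))" .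
  qed
  also have "\<dots> = (SUP i. (\<integral>\<^sup>+x. indicator {e i<..} x * (\<integral>\<^sup>+\<omega>. h x (\<lambda>i. A i \<omega>) \<partial>M) \<partial>\<nu>))"
    by (intro SUP_cong refl) (simp add: N12[OF e] N2[OF Hm] Hp)
  also have "\<dots> = (\<integral>\<^sup>+x. (SUP i. indicator {e i<..} x * (\<integral>\<^sup>+\<omega>. h x (\<lambda>i. A i \<omega>) \<partial>M)) \<partial>\<nu>)"
  proof (rule nn_integral_monotone_convergence_SUP[symmetric])
    show "incseq (\<lambda>i x. indicator {e i<..} x * (\<integral>\<^sup>+\<omega>. h x (\<lambda>i. A i \<omega>) \<partial>M))"
      using inc by (simp add: incseq_def le_fun_def)
  qed measurable
  also have "\<dots> = (\<integral>\<^sup>+x. indicator {0<..} x * (\<integral>\<^sup>+\<omega>. h x (\<lambda>i. A i \<omega>) \<partial>M) \<partial>\<nu>)"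
    unfolding sup ..
  also have "\<dots> = (\<integral>\<^sup>+x. (\<integral>\<^sup>+\<omega>. h x (\<lambda>i. A i \<omega>) \<partial>M) \<partial>\<nu>)"
  proof (rule nn_integral_cong_AE)
    have "AE x in \<nu>. x \<notin> {..0}" using nu_nonpos by (intro AE_not_in null_setsI) auto
    then show "AE x in \<nu>. indicator {0<..} x * (\<integral>\<^sup>+\<omega>. h x (\<lambda>i. A i \<omega>) \<partial>M) = (\<integral>\<^sup>+\<omega>. h x (\<lambda>i. A i \<omega>) \<partial>M)"
      by eventually_elim auto
  qed
  finally show ?thesis .
qed

end

lemma stable_levy_measure_eq: "stable_levy_measure \<alpha> = density lborel (\<lambda>x. ennreal (stable_levy_density \<alpha> x))"
  by (simp add: stable_levy_measure_def stable_levy_density_def)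

lemma sets_stable_levy_measure [simp, measurable_cong]: "sets (stable_levy_measure \<alpha>) = sets borel"
  by (simp add: stable_levy_measure_def)

lemma stable_levy_measure_tail_finite:
  assumes "0 < \<alpha>" "\<alpha> < 1" "0 < u"
  shows "emeasure (stable_levy_measure \<alpha>) {u<..} < \<infinity>"
proof -
  have G: "0 < Gamma (1 - \<alpha>)" using assms by (intro Gamma_real_pos) auto
  have int: "((\<lambda>x. x powr (- \<alpha> - 1)) has_integral - (u powr (- \<alpha> - 1 + 1)) / (- \<alpha> - 1 + 1)) {u..}"
    using assms by (intro has_integral_powr_to_inf) auto
  have "emeasure (stable_levy_measure \<alpha>) {u<..} \<le> (\<integral>\<^sup>+x. ennreal (\<alpha> / Gamma (1 - \<alpha>)) * ennreal (indicator {u..} x * x powr (- \<alpha> - 1)) \<partial>lborel)"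
    unfolding stable_levy_measure_eq using assms G
    by (subst emeasure_density)
       (auto intro!: nn_integral_mono simp: stable_levy_density_def ennreal_mult'[symmetric] split: split_indicator)
  also have "\<dots> = ennreal (\<alpha> / Gamma (1 - \<alpha>)) * ennreal (- (u powr (- \<alpha> - 1 + 1)) / (- \<alpha> - 1 + 1))"
    using nn_integral_has_integral_lebesgue[OF _ int] by (subst nn_integral_cmult) auto
  also have "\<dots> < \<infinity>" by (simp add: ennreal_mult_less_top)
  finally show ?thesis .
qed

lemma sigma_finite_stable_levy_measure:
  assumes "0 < \<alpha>" "\<alpha> < 1"
  shows "sigma_finite_measure (stable_levy_measure \<alpha>)"
  unfolding stable_levy_measure_eq
  by (subst sigma_finite_measure.sigma_finite_iff_density_finite[OF sigma_finite_lborel]) auto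

text \<open>The jumps up to time one are summable because they add up to the value of the subordinator at that time. The
  enumeration by ranks is a bijection, so counting ranked jumps is counting points of the jump
  process.\<close>
lemma ranked_jumps_AE:
  assumes tau: "stable_subordinator M \<alpha> \<tau>" and A: "ranked_jumps M \<tau> A"
  shows "AE \<omega> in M. decseq (\<lambda>k. A k \<omega>) \<and> (\<forall>k. 0 < A k \<omega>) \<and> summable (\<lambda>k. A k \<omega>) \<and>
    (\<forall>I. I \<subseteq> {0<..} \<longrightarrow> point_count (\<lambda>k. A k \<omega>) I =
       emeasure (count_space UNIV) {(s, x) \<in> {0<..1} \<times> I. 0 < s \<and> 0 < x \<and> x = jump (\<lambda>u. \<tau> u \<omega>) s})"
proof -
  have 1: "AE \<omega> in M. (jump (\<lambda>s. \<tau> s \<omega>) has_sum \<tau> 1 \<omega>) {0<..1}"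
  proof -
    have "AE \<omega> in M. \<forall>t\<ge>0. (jump (\<lambda>s. \<tau> s \<omega>) has_sum \<tau> t \<omega>) {0<..t}"
      using tau unfolding stable_subordinator_def by simp
    then show ?thesis by eventually_elim auto
  qed
  have 2: "AE \<omega> in M. decseq (\<lambda>k. A k \<omega>) \<and>
        (\<exists>T. bij_betw T UNIV {s\<in>{0<..1}. 0 < jump (\<lambda>u. \<tau> u \<omega>) s} \<and>
             (\<forall>k. A k \<omega> = jump (\<lambda>u. \<tau> u \<omega>) (T k)))"
    using A unfolding ranked_jumps_def by blast
  show ?thesis using 1 2
  proof eventually_elim
    case (elim \<omega>)
    define J where "J = jump (\<lambda>u. \<tau> u \<omega>)"
    obtain T where T: "bij_betw T UNIV {s\<in>{0<..1}. 0 < J s}" "\<And>k. A k \<omega> = J (T k)"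
      using elim unfolding J_def by blast
    have Tin: "T k \<in> {s\<in>{0<..1}. 0 < J s}" for k using T(1) by (auto simp: bij_betw_def)
    have pos: "\<forall>k. 0 < A k \<omega>" using Tin T(2) by auto
    have "J summable_on {0<..1}" using elim unfolding J_def has_sum_def[symmetric] summable_on_def by blast
    then have "J summable_on {s\<in>{0<..1}. 0 < J s}" by (rule summable_on_subset_banach) auto
    then have "(\<lambda>k. J (T k)) summable_on UNIV" by (subst summable_on_reindex_bij_betw[OF T(1)])
    then have summ: "summable (\<lambda>k. A k \<omega>)"
      using pos unfolding T(2)[symmetric] by (subst (asm) summable_on_UNIV_nonneg_real_iff) (auto intro: less_imp_le)
    have "point_count (\<lambda>k. A k \<omega>) I = emeasure (count_space UNIV) {(s, x) \<in> {0<..1} \<times> I. 0 < s \<and> 0 < x \<and> x = J s}"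
      if I: "I \<subseteq> {0<..}" for I
    proof -
      have "bij_betw (\<lambda>k. (T k, A k \<omega>)) {k. A k \<omega> \<in> I} {(s, x) \<in> {0<..1} \<times> I. 0 < s \<and> 0 < x \<and> x = J s}"
        unfolding bij_betw_def
      proof
        show "inj_on (\<lambda>k. (T k, A k \<omega>)) {k. A k \<omega> \<in> I}"
          using T(1) by (auto simp: inj_on_def bij_betw_def)
        show "(\<lambda>k. (T k, A k \<omega>)) ` {k. A k \<omega> \<in> I} = {(s, x) \<in> {0<..1} \<times> I. 0 < s \<and> 0 < x \<and> x = J s}"
        proof (intro set_eqI iffI)
          fix q assume "q \<in> (\<lambda>k. (T k, A k \<omega>)) ` {k. A k \<omega> \<in> I}"
          then show "q \<in> {(s, x) \<in> {0<..1} \<times> I. 0 < s \<and> 0 < x \<and> x = J s}" using Tin T(2) by auto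
        next
          fix q assume q: "q \<in> {(s, x) \<in> {0<..1} \<times> I. 0 < s \<and> 0 < x \<and> x = J s}"
          then have "fst q \<in> range T" using T(1) by (auto simp: bij_betw_def)
          then obtain k where "fst q = T k" by blast
          then show "q \<in> (\<lambda>k. (T k, A k \<omega>)) ` {k. A k \<omega> \<in> I}" using q T(2) by (auto intro!: image_eqI[of _ _ k])
        qed
      qed
      from bij_betw_same_card[OF this] bij_betw_finite[OF this] show ?thesis
        by (simp add: point_count_def emeasure_count_space)
    qed
    then show ?case using pos summ elim unfolding J_def by blast
  qed
qed

text \<open>The sets \<open>{0<..1} \<times> I\<close> have the intensity of \<open>I\<close> under the Levy measure, so the counts of ranked jumps inherit
  the Poisson law and the independence from the jump process.\<close>
lemma ranked_poisson_stable:
  assumes alpha: "0 < \<alpha>" "\<alpha> < 1"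
    and tau: "stable_subordinator M \<alpha> \<tau>" and A: "ranked_jumps M \<tau> A"
  shows "ranked_poisson M A (stable_levy_measure \<alpha>)"
proof -
  interpret prob_space M using tau by (simp add: stable_subordinator_def)
  interpret L: sigma_finite_measure "stable_levy_measure \<alpha>" by (rule sigma_finite_stable_levy_measure[OF alpha])
  have Am [measurable]: "A k \<in> borel_measurable M" for k using A by (simp add: ranked_jumps_def)
  define mP where "mP = density (lborel :: real measure) (indicator {0<..}) \<Otimes>\<^sub>M stable_levy_measure \<alpha>"
  define N where "N = (\<lambda>\<omega> E. emeasure (count_space UNIV) {(s, x) \<in> E. 0 < s \<and> 0 < x \<and> x = jump (\<lambda>u. \<tau> u \<omega>) s})"
  have prm: "poisson_random_measure M mP N"
    using tau unfolding stable_subordinator_def mP_def N_def by blast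
  note AE = ranked_jumps_AE[OF tau A]
  show ?thesis
  proof (unfold_locales)
    fix n :: nat and I :: "nat \<Rightarrow> real set" and k :: "nat \<Rightarrow> nat"
    assume I: "\<And>i. i < n \<Longrightarrow> I i \<in> sets borel \<and> I i \<subseteq> {0<..} \<and> emeasure (stable_levy_measure \<alpha>) (I i) < \<infinity>"
      and disj: "disjoint_family_on I {..<n}"
    define E where "E i = {0<..1::real} \<times> I i" for i
    have unit: "emeasure (density lborel (indicator {0<..})) {0<..1::real} = 1"
    proof -
      have "emeasure (density lborel (indicator {0<..})) {0<..1::real} = (\<integral>\<^sup>+x. indicator {0<..1::real} x \<partial>lborel)"
        by (subst emeasure_density) (auto simp del: nn_integral_indicator intro!: nn_integral_cong split: split_indicator)
      then show ?thesis by simp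
    qed
    have E: "E i \<in> sets mP" "emeasure mP (E i) = emeasure (stable_levy_measure \<alpha>) (I i)" if "i < n" for i
    proof -
      show "E i \<in> sets mP" unfolding E_def mP_def using I[OF that] by (intro pair_measureI) auto
      show "emeasure mP (E i) = emeasure (stable_levy_measure \<alpha>) (I i)"
        unfolding E_def mP_def using I[OF that] unit by (subst L.emeasure_pair_measure_Times) auto
    qed
    have fin: "emeasure mP (E i) < \<infinity>" if "i < n" for i using E[OF that] I[OF that] by simp
    have dE: "disjoint_family_on E {..<n}" using disj by (auto simp: disjoint_family_on_def E_def)
    have Nm: "(\<lambda>\<omega>. N \<omega> (E i)) \<in> borel_measurable M" if "i < n" for i
      using prm E fin that unfolding poisson_random_measure_def by blast
    have Np: "prob {\<omega>\<in>space M. N \<omega> (E i) = of_nat j} = poisson_prob (measure (stable_levy_measure \<alpha>) (I i)) j" if "i < n" for i j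
      using prm E[OF that] fin[OF that] unfolding poisson_random_measure_def poisson_prob_def by (auto simp: measure_def)
    have ind: "indep_vars (\<lambda>_. borel) (\<lambda>i \<omega>. N \<omega> (E i)) {..<n}"
      using prm E fin dE unfolding poisson_random_measure_def by blast
    have "emeasure M {\<omega>\<in>space M. \<forall>i<n. point_count (\<lambda>k. A k \<omega>) (I i) = of_nat (k i)} =
       emeasure M {\<omega>\<in>space M. \<forall>i\<in>{..<n}. N \<omega> (E i) = of_nat (k i)}"
    proof (rule emeasure_eq_AE)
      show "AE \<omega> in M. \<omega> \<in> {\<omega>\<in>space M. \<forall>i<n. point_count (\<lambda>k. A k \<omega>) (I i) = of_nat (k i)} \<longleftrightarrow>
         \<omega> \<in> {\<omega>\<in>space M. \<forall>i\<in>{..<n}. N \<omega> (E i) = of_nat (k i)}"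
        using AE
      proof eventually_elim
        case (elim \<omega>)
        have "point_count (\<lambda>k. A k \<omega>) (I i) = N \<omega> (E i)" if "i < n" for i
          using elim I[OF that] unfolding N_def E_def by blast
        then show ?case by auto
      qed
      note [measurable] = Nm
      show "{\<omega>\<in>space M. \<forall>i\<in>{..<n}. N \<omega> (E i) = of_nat (k i)} \<in> sets M" by measurable
      have [measurable]: "(\<lambda>\<omega>. point_count (\<lambda>k. A k \<omega>) (I i)) \<in> borel_measurable M" if "i < n" for i
        using I[OF that] by (intro point_count_measurable Am) auto
      have "{\<omega>\<in>space M. \<forall>i\<in>{..<n}. point_count (\<lambda>k. A k \<omega>) (I i) = of_nat (k i)} \<in> sets M" by measurable
      then show "{\<omega>\<in>space M. \<forall>i<n. point_count (\<lambda>k. A k \<omega>) (I i) = of_nat (k i)} \<in> sets M" by (simp add: Ball_def)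
    qed
    also have "\<dots> = ennreal (\<Prod>i<n. poisson_prob (measure (stable_levy_measure \<alpha>) (I i)) (k i))"
    proof (cases "n = 0")
      case True
      then show ?thesis by (simp add: emeasure_space_1)
    next
      case False
      have "{\<omega>\<in>space M. \<forall>i\<in>{..<n}. N \<omega> (E i) = of_nat (k i)} = (\<Inter>i\<in>{..<n}. (\<lambda>\<omega>. N \<omega> (E i)) -` {of_nat (k i)} \<inter> space M)"
        using False by auto
      also have "prob \<dots> = (\<Prod>i\<in>{..<n}. prob ((\<lambda>\<omega>. N \<omega> (E i)) -` {of_nat (k i)} \<inter> space M))"
        using False by (intro indep_varsD[OF ind]) auto
      also have "\<dots> = (\<Prod>i<n. poisson_prob (measure (stable_levy_measure \<alpha>) (I i)) (k i))"
      proof (rule prod.cong[OF refl])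
        fix i assume "i \<in> {..<n}"
        moreover have "(\<lambda>\<omega>. N \<omega> (E i)) -` {of_nat (k i)} \<inter> space M = {\<omega>\<in>space M. N \<omega> (E i) = of_nat (k i)}" by auto
        ultimately show "prob ((\<lambda>\<omega>. N \<omega> (E i)) -` {of_nat (k i)} \<inter> space M) = poisson_prob (measure (stable_levy_measure \<alpha>) (I i)) (k i)"
          using Np by simp
      qed
      finally show ?thesis by (simp add: emeasure_eq_measure)
    qed
    finally show "emeasure M {\<omega>\<in>space M. \<forall>i<n. point_count (\<lambda>k. A k \<omega>) (I i) = of_nat (k i)} =
       ennreal (\<Prod>i<n. poisson_prob (measure (stable_levy_measure \<alpha>) (I i)) (k i))" .
  next
    show "emeasure (stable_levy_measure \<alpha>) {..0} = 0"
    proof -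
      have "emeasure (stable_levy_measure \<alpha>) {..0} = (\<integral>\<^sup>+x. ennreal (stable_levy_density \<alpha> x) * indicator {..0} x \<partial>lborel)"
        unfolding stable_levy_measure_eq by (subst emeasure_density) auto
      also have "\<dots> = (\<integral>\<^sup>+x. 0 \<partial>(lborel :: real measure))"
        by (rule nn_integral_cong) (auto simp: stable_levy_density_def split: split_indicator)
      finally show ?thesis by simp
    qed
    show "AE \<omega> in M. \<forall>k. 0 < A k \<omega>" using AE by eventually_elim auto
    show "AE \<omega> in M. decseq (\<lambda>k. A k \<omega>)" using AE by eventually_elim auto
  qed (use stable_levy_measure_tail_finite[OF alpha] in auto)
qed

lemma total_mass_pos_AE:
  assumes "stable_subordinator M \<alpha> \<tau>" and "ranked_jumps M \<tau> A"
  shows "AE \<omega> in M. (\<forall>k. 0 < A k \<omega>) \<and> summable (\<lambda>k. A k \<omega>) \<and> 0 < total_mass A \<omega>"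
  using ranked_jumps_AE[OF assms]
proof eventually_elim
  case (elim \<omega>)
  then have "0 < total_mass A \<omega>" unfolding total_mass_def by (intro suminf_pos) auto
  then show ?case using elim by blast
qed

section \<open>Size-biased picks from the jumps\<close>

text \<open>The probability that the first \<open>n\<close> ratios of remaining masses under size-biased sampling from \<open>a\<close> lie in
  \<open>B 0, B 1, \<dots>\<close>. A picked mass is set to zero instead of being deleted: it then never has a chance
  of being picked again, and the other indices keep their meaning.\<close>
primrec size_biased_prob :: "nat \<Rightarrow> (nat \<Rightarrow> real set) \<Rightarrow> (nat \<Rightarrow> real) \<Rightarrow> ennreal" where
  "size_biased_prob 0 B a = 1"
| "size_biased_prob (Suc n) B a =
    (\<Sum>j. ennreal (a j / suminf a) * (indicator (B 0) (1 - a j / suminf a) * size_biased_prob n (\<lambda>l. B (Suc l)) (a(j := 0))))"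

lemma measurable_fun_upd_real_seq [measurable]:
  assumes [measurable]: "f \<in> measurable M real_seq"
  shows "(\<lambda>\<omega>. (f \<omega>)(j := 0)) \<in> measurable M real_seq"
proof (rule measurable_PiM_single')
  fix i :: nat
  have "(\<lambda>\<omega>. f \<omega> i) \<in> borel_measurable M" using assms by measurable
  then show "(\<lambda>\<omega>. ((f \<omega>)(j := 0)) i) \<in> borel_measurable M" by (cases "i = j") auto
qed (auto simp: space_PiM)

lemma suminf_real_seq_measurable [measurable]:
  assumes [measurable]: "f \<in> measurable M real_seq"
  shows "(\<lambda>\<omega>. suminf (f \<omega>) :: real) \<in> borel_measurable M"
proof -
  have "(\<lambda>\<omega>. \<Sum>i. f \<omega> i :: real) \<in> borel_measurable M" by measurable
  then show ?thesis by simp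
qed

lemma size_biased_prob_measurable [measurable]:
  assumes "\<And>l. B l \<in> sets borel"
  shows "size_biased_prob n B \<in> borel_measurable real_seq"
  using assms
proof (induction n arbitrary: B)
  case (Suc n)
  have [measurable]: "B 0 \<in> sets borel" "size_biased_prob n (\<lambda>l. B (Suc l)) \<in> borel_measurable real_seq"
    using Suc by auto
  show ?case unfolding size_biased_prob.simps(2)[abs_def] by measurable
qed (simp add: size_biased_prob.simps(1)[abs_def])

text \<open>Masses equal to zero do not matter. This links setting a mass to zero with deleting it, which is the
  operation in Mecke's equation.\<close>
lemma size_biased_prob_reindex:
  assumes e: "strict_mono e" and a: "\<And>i. i \<notin> range e \<Longrightarrow> a i = 0"
  shows "size_biased_prob n B (\<lambda>i. a (e i)) = size_biased_prob n B a"
  using a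
proof (induction n arbitrary: B a)
  case (Suc n)
  have S: "suminf (\<lambda>i. a (e i)) = suminf a" by (rule suminf_mono_reindex[OF e]) (rule Suc.prems)
  have upd: "(\<lambda>i. a (e i))(j := 0) = (\<lambda>i. (a(e j := 0)) (e i))" for j
    using strict_mono_eq[OF e] by (auto simp: fun_eq_iff)
  have IH: "size_biased_prob n (\<lambda>l. B (Suc l)) ((\<lambda>i. a (e i))(j := 0)) = size_biased_prob n (\<lambda>l. B (Suc l)) (a(e j := 0))" for j
    unfolding upd by (rule Suc.IH) (use Suc.prems in auto)
  define g where "g j = ennreal (a j / suminf a) * (indicator (B 0) (1 - a j / suminf a) * size_biased_prob n (\<lambda>l. B (Suc l)) (a(j := 0)))" for j
  have "size_biased_prob (Suc n) B (\<lambda>i. a (e i)) = (\<Sum>j. g (e j))"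
    by (simp only: size_biased_prob.simps S IH g_def)
  also have "\<dots> = suminf g" by (rule suminf_mono_reindex[OF e]) (simp add: g_def Suc.prems)
  also have "suminf g = size_biased_prob (Suc n) B a"
    by (simp only: size_biased_prob.simps g_def[abs_def])
  finally show ?case .
qed simp

lemma suminf_fun_upd_0:
  fixes a :: "nat \<Rightarrow> real"
  assumes "summable a"
  shows "summable (a(j := 0))" "suminf (a(j := 0)) = suminf a - a j"
proof -
  have "(\<lambda>i. a i - (if i = j then a j else 0)) sums (suminf a - a j)"
    using assms sums_single[of j "\<lambda>_. a j"] by (intro sums_diff) (auto simp: summable_sums)
  also have "(\<lambda>i. a i - (if i = j then a j else 0)) = a(j := 0)" by auto
  finally have "(a(j := 0)) sums (suminf a - a j)" .
  then show "summable (a(j := 0))" "suminf (a(j := 0)) = suminf a - a j"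
    by (rule sums_summable, rule sums_unique[symmetric])
qed

text \<open>Only ratios enter, so the jumps may be sampled instead of the normalised jumps.\<close>
lemma size_biased_prob_scale:
  assumes "summable a" "c \<noteq> 0"
  shows "size_biased_prob n B (\<lambda>i. a i / c) = size_biased_prob n B a"
  using assms(1)
proof (induction n arbitrary: B a)
  case (Suc n)
  have S: "suminf (\<lambda>i. a i / c) = suminf a / c" using Suc.prems by (rule suminf_divide)
  have "(\<lambda>i. a i / c)(j := 0) = (\<lambda>i. (a(j := 0)) i / c)" for j by auto
  then have IH: "size_biased_prob n (\<lambda>l. B (Suc l)) ((\<lambda>i. a i / c)(j := 0)) = size_biased_prob n (\<lambda>l. B (Suc l)) (a(j := 0))" for j
    using Suc.IH[OF suminf_fun_upd_0(1)[OF Suc.prems]] by metis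
  have "a j / c / (suminf a / c) = a j / suminf a" for j using assms(2) by simp
  then show ?case by (simp only: size_biased_prob.simps S IH)
qed simp

text \<open>The expectation of the product of the \<open>\<phi> l (R l)\<close> under the chain in which \<open>R l\<close> has the law
  \<open>R_law\<close> with parameter \<open>lam\<close> divided by the product of the earlier values.\<close>
primrec R_chain_expectation :: "real \<Rightarrow> nat \<Rightarrow> nat \<Rightarrow> (nat \<Rightarrow> real \<Rightarrow> ennreal) \<Rightarrow> real \<Rightarrow> ennreal" where
  "R_chain_expectation \<alpha> m 0 \<phi> lam = 1"
| "R_chain_expectation \<alpha> m (Suc n) \<phi> lam =
    (\<integral>\<^sup>+r. \<phi> 0 r * R_chain_expectation \<alpha> m n (\<lambda>l. \<phi> (Suc l)) (lam / r) \<partial>R_law \<alpha> m lam)"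

lemma sets_W_law [simp, measurable_cong]: "sets (W_law \<alpha> m r) = sets borel"
  by (simp add: W_law_def)

lemma sets_R_law [simp, measurable_cong]: "sets (R_law \<alpha> m lam) = sets borel"
  by (simp add: R_law_def)

lemma emeasure_W_law_measurable:
  assumes "0 < \<alpha>" "\<alpha> < 1" "1 \<le> m" and [measurable]: "B \<in> sets borel"
  shows "(\<lambda>r. emeasure (W_law \<alpha> m r) B) \<in> borel_measurable borel"
proof -
  note [measurable] = W_density_measurable[OF assms(1-3)]
  have [measurable]: "W_density \<alpha> m r \<in> borel_measurable borel" for r
    unfolding W_density_def by measurable
  have *: "(indicator {r<..<1} w :: real) = (if r < w \<and> w < 1 then 1 else 0)" for r w :: real by (simp add: indicator_def)
  have "emeasure (W_law \<alpha> m r) B = (\<integral>\<^sup>+w. ennreal ((if r < w \<and> w < 1 then 1 else 0) * W_density \<alpha> m r w) * indicator B w \<partial>lborel)" for r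
    unfolding W_law_def *[symmetric] by (subst emeasure_density) auto
  then show ?thesis by simp
qed

lemma AE_R_law: "AE r in R_law \<alpha> m lam. 0 < r \<and> r < 1"
  if "0 < \<alpha>" "\<alpha> < 1" "1 \<le> m"
proof -
  have [measurable]: "f_R \<alpha> m lam \<in> borel_measurable borel"
    using f_R_measurable[OF that] by (auto dest: measurable_Pair2)
  show ?thesis unfolding R_law_def by (subst AE_density) (auto split: split_indicator)
qed

text \<open>Induction on the number of picks. Mecke's equation exposes the first pick, \<open>size_biased_jump_kernel\<close> rewrites its density,
  and the remaining configuration carries the weight with parameter \<open>lam / r\<close>, to which
  the induction hypothesis applies.\<close>
lemma size_biased_tilted_expectation:
  assumes alpha: "0 < \<alpha>" "\<alpha> < 1" and m: "1 \<le> m" and f: "stable_density \<alpha> f"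
    and tau: "stable_subordinator M \<alpha> \<tau>" and A: "ranked_jumps M \<tau> A"
    and S: "distributed M lborel (total_mass A) (\<lambda>t. ennreal (f t))"
    and lam: "0 < lam" and B: "\<And>l. B l \<in> sets borel"
  shows "(\<integral>\<^sup>+\<omega>. ennreal (total_mass A \<omega> ^ m * exp (- (lam * total_mass A \<omega>))) * size_biased_prob n B (\<lambda>k. A k \<omega>) \<partial>M) =
    ennreal (stable_moment \<alpha> m lam) * R_chain_expectation \<alpha> m n (\<lambda>l r. emeasure (W_law \<alpha> m r) (B l)) lam"
  using lam B
proof (induction n arbitrary: lam B)
  case 0
  have f': "f \<in> borel_measurable borel" "\<And>t. 0 \<le> f t" using f by (auto simp: stable_density_def)
  note [measurable] = f'(1)
  have "(\<integral>\<^sup>+\<omega>. ennreal (total_mass A \<omega> ^ m * exp (- (lam * total_mass A \<omega>))) \<partial>M) =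
     (\<integral>\<^sup>+t. ennreal (f t) * ennreal (t ^ m * exp (- (lam * t))) \<partial>lborel)"
    by (subst distributed_nn_integral[OF S]) auto
  also have "\<dots> = (\<integral>\<^sup>+t. ennreal (t ^ m * exp (- (lam * t)) * f t) \<partial>lborel)"
    by (intro nn_integral_cong) (simp add: ennreal_mult'[symmetric] f'(2) mult.commute)
  also have "\<dots> = ennreal (stable_moment \<alpha> m lam)"
    by (rule stable_moment_eq(1)[OF alpha(1) f 0(1)])
  finally show ?case by simp
next
  case (Suc n)
  interpret ranked_poisson M A "stable_levy_measure \<alpha>" by (rule ranked_poisson_stable[OF alpha tau A])
  note [measurable] = W_density_measurable[OF alpha m] f_R_measurable[OF alpha m] beta_moment_measurable[OF alpha m]
  have [measurable]: "f_R \<alpha> m lam \<in> borel_measurable borel" unfolding f_R_def f_R1_def by measurable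
  have [measurable]: "stable_moment \<alpha> m \<in> borel_measurable borel" unfolding stable_moment_def by measurable
  have B0 [measurable]: "B 0 \<in> sets borel" using Suc.prems by simp
  define B' where "B' l = B (Suc l)" for l
  define U where "U = size_biased_prob n B'"
  have U [measurable]: "U \<in> borel_measurable real_seq"
    unfolding U_def by (rule size_biased_prob_measurable) (simp add: B'_def Suc.prems)
  have Aseq [measurable]: "(\<lambda>\<omega>. (\<lambda>i. A i \<omega>)) \<in> measurable M real_seq"
    by (rule measurable_PiM_single') auto
  have Sm [measurable]: "total_mass A \<in> borel_measurable M"
    unfolding total_mass_def[abs_def] by measurable
  have UA [measurable]: "(\<lambda>\<omega>. U (\<lambda>i. A i \<omega>)) \<in> borel_measurable M"
    using measurable_compose[OF Aseq U] .
  \<comment> \<open>The contribution of a pick \<open>x\<close> when \<open>a\<close> is left: one factor \<open>x + suminf a\<close> of the weight is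
    cancelled by the denominator of the picking probability.\<close>
  define h where "h x a = ennreal (x * (x + suminf a) ^ (m - 1) * exp (- (lam * (x + suminf a)))) *
     (indicator (B 0) (suminf a / (x + suminf a)) * U a)" for x and a :: "nat \<Rightarrow> real"
  have h [measurable]: "(\<lambda>(x, a). h x a) \<in> borel_measurable (borel \<Otimes>\<^sub>M real_seq)"
    unfolding h_def split_beta' by measurable
  have good: "AE \<omega> in M. (\<forall>k. 0 < A k \<omega>) \<and> summable (\<lambda>k. A k \<omega>) \<and> 0 < total_mass A \<omega>"
    by (rule total_mass_pos_AE[OF tau A])
  interpret R: sigma_finite_measure "R_law \<alpha> m lam"
    unfolding R_law_def by (subst sigma_finite_measure.sigma_finite_iff_density_finite[OF sigma_finite_lborel]) auto
  have [measurable]: "(\<lambda>r. emeasure (W_law \<alpha> m r) (B 0)) \<in> borel_measurable borel"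
    by (rule emeasure_W_law_measurable[OF alpha m B0])
  define G where "G \<omega> r = ennreal (total_mass A \<omega> ^ m * exp (- (lam / r * total_mass A \<omega>)) / stable_moment \<alpha> m (lam / r))
     * emeasure (W_law \<alpha> m r) (B 0) * U (\<lambda>i. A i \<omega>)" for \<omega> r
  have "(\<integral>\<^sup>+\<omega>. ennreal (total_mass A \<omega> ^ m * exp (- (lam * total_mass A \<omega>))) * size_biased_prob (Suc n) B (\<lambda>k. A k \<omega>) \<partial>M) =
     (\<integral>\<^sup>+\<omega>. (\<Sum>j. h (A j \<omega>) (\<lambda>i. A (skip j i) \<omega>)) \<partial>M)"
  proof (rule nn_integral_cong_AE)
    show "AE \<omega> in M. ennreal (total_mass A \<omega> ^ m * exp (- (lam * total_mass A \<omega>))) * size_biased_prob (Suc n) B (\<lambda>k. A k \<omega>) =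
      (\<Sum>j. h (A j \<omega>) (\<lambda>i. A (skip j i) \<omega>))"
      using good
    proof eventually_elim
      case (elim \<omega>)
      define a where "a k = A k \<omega>" for k
      define s where "s = suminf a"
      have a: "\<And>k. 0 < a k" "summable a" "0 < s" "total_mass A \<omega> = s"
        using elim by (auto simp: a_def[abs_def] s_def total_mass_def)
      have "ennreal (s ^ m * exp (- (lam * s))) * (ennreal (a j / s) * (indicator (B 0) (1 - a j / s) * size_biased_prob n (\<lambda>l. B (Suc l)) (a(j := 0)))) =
        h (a j) (\<lambda>i. a (skip j i))" for j
      proof -
        have reidx: "(\<lambda>i. (a(j := 0)) (skip j i)) = (\<lambda>i. a (skip j i))"
          using range_skip[of j] by (auto simp: fun_eq_iff)
        have off: "(a(j := 0)) i = 0" if "i \<notin> range (skip j)" for i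
          using that by (simp add: range_skip)
        have s': "suminf (\<lambda>i. a (skip j i)) = s - a j"
          unfolding reidx[symmetric] s_def suminf_fun_upd_0(2)[OF a(2), symmetric]
          by (rule suminf_mono_reindex[OF strict_mono_skip off])
        have u: "size_biased_prob n (\<lambda>l. B (Suc l)) (a(j := 0)) = U (\<lambda>i. a (skip j i))"
          unfolding reidx[symmetric] U_def B'_def
          by (rule size_biased_prob_reindex[OF strict_mono_skip off, symmetric])
        have p: "s ^ m * exp (- (lam * s)) * (a j / s) = a j * s ^ (m - 1) * exp (- (lam * s))"
          using m a(3) by (cases m) (auto simp: field_simps)
        have "(s - a j) / s = 1 - a j / s" using a(3) by (simp add: field_simps)
        then show ?thesis
          unfolding h_def s' u using p a(3) less_imp_le[OF a(1)]
          by (simp add: mult.assoc[symmetric] ennreal_mult[symmetric])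
      qed
      then have "ennreal (s ^ m * exp (- (lam * s))) * size_biased_prob (Suc n) B a = (\<Sum>j. h (a j) (\<lambda>i. a (skip j i)))"
        by (simp only: size_biased_prob.simps ennreal_suminf_cmult[symmetric] s_def)
      then show ?case unfolding a(4) by (simp only: a_def[abs_def])
    qed
  qed
  also have "\<dots> = (\<integral>\<^sup>+x. (\<integral>\<^sup>+\<omega>. h x (\<lambda>i. A i \<omega>) \<partial>M) \<partial>stable_levy_measure \<alpha>)"
    by (rule mecke[OF h])
  also have "\<dots> = (\<integral>\<^sup>+x. (\<integral>\<^sup>+\<omega>. ennreal (stable_levy_density \<alpha> x) * h x (\<lambda>i. A i \<omega>) \<partial>M) \<partial>lborel)"
  proof -
    have "(\<lambda>q. (fst q, \<lambda>i. A i (snd q))) \<in> measurable (borel \<Otimes>\<^sub>M M) (borel \<Otimes>\<^sub>M real_seq)" by measurable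
    from measurable_compose[OF this h] have hm: "(\<lambda>q. h (fst q) (\<lambda>i. A i (snd q))) \<in> borel_measurable (borel \<Otimes>\<^sub>M M)" by simp
    then have "(\<lambda>x. (\<integral>\<^sup>+\<omega>. h x (\<lambda>i. A i \<omega>) \<partial>M)) \<in> borel_measurable borel"
      by (intro borel_measurable_nn_integral) (simp add: split_beta')
    moreover have "(\<lambda>\<omega>. h x (\<lambda>i. A i \<omega>)) \<in> borel_measurable M" for x
      using measurable_compose[OF measurable_Pair1' hm, of x] by simp
    ultimately show ?thesis
      unfolding stable_levy_measure_eq by (subst nn_integral_density) (auto simp: nn_integral_cmult)
  qed
  also have "\<dots> = (\<integral>\<^sup>+\<omega>. (\<integral>\<^sup>+x. ennreal (stable_levy_density \<alpha> x) * h x (\<lambda>i. A i \<omega>) \<partial>lborel) \<partial>M)"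
  proof -
    interpret LM: pair_sigma_finite "lborel :: real measure" M ..
    have "(\<lambda>q. (fst q, \<lambda>i. A i (snd q))) \<in> measurable (lborel \<Otimes>\<^sub>M M) (borel \<Otimes>\<^sub>M real_seq)" by measurable
    from measurable_compose[OF this h] have [measurable]: "(\<lambda>q. h (fst q) (\<lambda>i. A i (snd q))) \<in> borel_measurable (lborel \<Otimes>\<^sub>M M)" by simp
    show ?thesis by (rule LM.Fubini'[symmetric]) (simp add: split_beta')
  qed
  also have "\<dots> = (\<integral>\<^sup>+\<omega>. ennreal (stable_moment \<alpha> m lam) *
      (\<integral>\<^sup>+r. ennreal (total_mass A \<omega> ^ m * exp (- (lam / r * total_mass A \<omega>)) / stable_moment \<alpha> m (lam / r)) * emeasure (W_law \<alpha> m r) (B 0) \<partial>R_law \<alpha> m lam)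
      * U (\<lambda>i. A i \<omega>) \<partial>M)"
  proof (rule nn_integral_cong_AE)
    show "AE \<omega> in M. (\<integral>\<^sup>+x. ennreal (stable_levy_density \<alpha> x) * h x (\<lambda>i. A i \<omega>) \<partial>lborel) =
       ennreal (stable_moment \<alpha> m lam) *
      (\<integral>\<^sup>+r. ennreal (total_mass A \<omega> ^ m * exp (- (lam / r * total_mass A \<omega>)) / stable_moment \<alpha> m (lam / r)) * emeasure (W_law \<alpha> m r) (B 0) \<partial>R_law \<alpha> m lam)
      * U (\<lambda>i. A i \<omega>)"
      using good
    proof eventually_elim
      case (elim \<omega>)
      define s where "s = total_mass A \<omega>"
      have "(\<integral>\<^sup>+x. ennreal (stable_levy_density \<alpha> x) * h x (\<lambda>i. A i \<omega>) \<partial>lborel) =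
        (\<integral>\<^sup>+x. ennreal (stable_levy_density \<alpha> x * (x * (x + s) ^ (m - 1) * exp (- (lam * (x + s))))) * indicator (B 0) (s / (x + s)) * U (\<lambda>i. A i \<omega>) \<partial>lborel)"
        unfolding h_def s_def total_mass_def
        by (intro nn_integral_cong) (simp add: ennreal_mult' stable_levy_density_nonneg[OF alpha] mult.assoc)
      also have "\<dots> = (\<integral>\<^sup>+x. ennreal (stable_levy_density \<alpha> x * (x * (x + s) ^ (m - 1) * exp (- (lam * (x + s))))) * indicator (B 0) (s / (x + s)) \<partial>lborel) * U (\<lambda>i. A i \<omega>)"
        by (rule nn_integral_multc) measurable
      also have "(\<integral>\<^sup>+x. ennreal (stable_levy_density \<alpha> x * (x * (x + s) ^ (m - 1) * exp (- (lam * (x + s))))) * indicator (B 0) (s / (x + s)) \<partial>lborel) =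
         ennreal (stable_moment \<alpha> m lam) * (\<integral>\<^sup>+r. ennreal (s ^ m * exp (- (lam / r * s)) / stable_moment \<alpha> m (lam / r))
           * (\<integral>\<^sup>+w. indicator (B 0) w \<partial>W_law \<alpha> m r) \<partial>R_law \<alpha> m lam)"
        using elim Suc.prems(1) by (intro size_biased_jump_kernel[OF alpha m f]) (auto simp: s_def)
      finally show ?case by (simp add: s_def)
    qed
  qed
  also have "\<dots> = ennreal (stable_moment \<alpha> m lam) * (\<integral>\<^sup>+\<omega>. (\<integral>\<^sup>+r. G \<omega> r \<partial>R_law \<alpha> m lam) \<partial>M)"
  proof -
    define g where "g \<omega> r = ennreal (total_mass A \<omega> ^ m * exp (- (lam / r * total_mass A \<omega>)) / stable_moment \<alpha> m (lam / r))
      * emeasure (W_law \<alpha> m r) (B 0)" for \<omega> r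
    have Gg: "(\<integral>\<^sup>+r. G \<omega> r \<partial>R_law \<alpha> m lam) = (\<integral>\<^sup>+r. g \<omega> r \<partial>R_law \<alpha> m lam) * U (\<lambda>i. A i \<omega>)" for \<omega>
      unfolding G_def g_def by (rule nn_integral_multc) measurable
    have [measurable]: "(\<lambda>\<omega>. \<integral>\<^sup>+r. g \<omega> r \<partial>R_law \<alpha> m lam) \<in> borel_measurable M"
      unfolding g_def by measurable
    show ?thesis
      unfolding Gg g_def[symmetric] mult.assoc by (rule nn_integral_cmult) measurable
  qed
  also have "(\<integral>\<^sup>+\<omega>. (\<integral>\<^sup>+r. G \<omega> r \<partial>R_law \<alpha> m lam) \<partial>M) = (\<integral>\<^sup>+r. (\<integral>\<^sup>+\<omega>. G \<omega> r \<partial>M) \<partial>R_law \<alpha> m lam)"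
  proof -
    interpret RM: pair_sigma_finite "R_law \<alpha> m lam" M ..
    show ?thesis unfolding G_def by (rule RM.Fubini') measurable
  qed
  also have "\<dots> = (\<integral>\<^sup>+r. emeasure (W_law \<alpha> m r) (B 0) * R_chain_expectation \<alpha> m n (\<lambda>l r. emeasure (W_law \<alpha> m r) (B (Suc l))) (lam / r) \<partial>R_law \<alpha> m lam)"
  proof (rule nn_integral_cong_AE)
    show "AE r in R_law \<alpha> m lam. (\<integral>\<^sup>+\<omega>. G \<omega> r \<partial>M) =
       emeasure (W_law \<alpha> m r) (B 0) * R_chain_expectation \<alpha> m n (\<lambda>l r. emeasure (W_law \<alpha> m r) (B (Suc l))) (lam / r)"
      using AE_R_law[OF alpha m, of lam]
    proof eventually_elim
      case (elim r)
      then have lr: "0 < lam / r" using Suc.prems(1) by simp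
      define c where "c = stable_moment \<alpha> m (lam / r)"
      have c: "0 < c" unfolding c_def by (rule stable_moment_pos[OF alpha(1) f lr])
      have "(\<integral>\<^sup>+\<omega>. ennreal (total_mass A \<omega> ^ m * exp (- (lam / r * total_mass A \<omega>)) / c) * emeasure (W_law \<alpha> m r) (B 0) * U (\<lambda>i. A i \<omega>) \<partial>M) =
        (\<integral>\<^sup>+\<omega>. (ennreal (1 / c) * emeasure (W_law \<alpha> m r) (B 0)) * (ennreal (total_mass A \<omega> ^ m * exp (- (lam / r * total_mass A \<omega>))) * U (\<lambda>i. A i \<omega>)) \<partial>M)"
      proof (rule nn_integral_cong)
        fix \<omega>
        define x where "x = total_mass A \<omega> ^ m * exp (- (lam / r * total_mass A \<omega>))"
        have "ennreal (x / c) = ennreal (1 / c) * ennreal x"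
          using c by (simp add: ennreal_mult'[symmetric])
        then have "ennreal (x / c) * emeasure (W_law \<alpha> m r) (B 0) * U (\<lambda>i. A i \<omega>) =
          (ennreal (1 / c) * emeasure (W_law \<alpha> m r) (B 0)) * (ennreal x * U (\<lambda>i. A i \<omega>))"
          by (metis mult.assoc mult.commute)
        then show "ennreal (total_mass A \<omega> ^ m * exp (- (lam / r * total_mass A \<omega>)) / c) * emeasure (W_law \<alpha> m r) (B 0) * U (\<lambda>i. A i \<omega>) =
          (ennreal (1 / c) * emeasure (W_law \<alpha> m r) (B 0)) * (ennreal (total_mass A \<omega> ^ m * exp (- (lam / r * total_mass A \<omega>))) * U (\<lambda>i. A i \<omega>))"
          unfolding x_def .
      qed
      also have "\<dots> = (ennreal (1 / c) * emeasure (W_law \<alpha> m r) (B 0)) * (\<integral>\<^sup>+\<omega>. ennreal (total_mass A \<omega> ^ m * exp (- (lam / r * total_mass A \<omega>))) * U (\<lambda>i. A i \<omega>) \<partial>M)"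
        by (rule nn_integral_cmult) measurable
      also have "(\<integral>\<^sup>+\<omega>. ennreal (total_mass A \<omega> ^ m * exp (- (lam / r * total_mass A \<omega>))) * U (\<lambda>i. A i \<omega>) \<partial>M) =
        ennreal c * R_chain_expectation \<alpha> m n (\<lambda>l r. emeasure (W_law \<alpha> m r) (B' l)) (lam / r)"
        unfolding U_def c_def by (rule Suc.IH[OF lr]) (simp add: B'_def Suc.prems)
      also have "(ennreal (1 / c) * emeasure (W_law \<alpha> m r) (B 0)) * (ennreal c * R_chain_expectation \<alpha> m n (\<lambda>l r. emeasure (W_law \<alpha> m r) (B' l)) (lam / r)) =
         (ennreal (1 / c) * ennreal c) * (emeasure (W_law \<alpha> m r) (B 0) * R_chain_expectation \<alpha> m n (\<lambda>l r. emeasure (W_law \<alpha> m r) (B' l)) (lam / r))"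
        by (simp only: mult_ac)
      also have "ennreal (1 / c) * ennreal c = 1" using c by (simp add: ennreal_mult'[symmetric])
      finally show ?case by (simp add: c_def B'_def G_def)
    qed
  qed
  finally show ?case by simp
qed

section \<open>Size-biased sampling from the tilted Poisson-Dirichlet law\<close>

text \<open>Both sides, as functions of the set tested by \<open>X\<close>, are measures, so the defining equation of a conditional
  law extends from indicators to nonnegative functions of \<open>X\<close>.\<close>
lemma cond_law_nn_integral:
  assumes cl: "cond_law M X MX K Y MY" and B [measurable]: "B \<in> sets MY"
    and g [measurable]: "g \<in> borel_measurable MX"
  shows "(\<integral>\<^sup>+\<omega>. g (X \<omega>) * indicator B (Y \<omega>) \<partial>M) = (\<integral>\<^sup>+\<omega>. g (X \<omega>) * emeasure (K (X \<omega>)) B \<partial>M)"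
proof -
  have X [measurable]: "X \<in> measurable M MX" and Y [measurable]: "Y \<in> measurable M MY"
    and Km [measurable]: "(\<lambda>\<omega>. emeasure (K (X \<omega>)) B) \<in> borel_measurable M"
    and eq: "\<And>A. A \<in> sets MX \<Longrightarrow> emeasure M {\<omega>\<in>space M. X \<omega> \<in> A \<and> Y \<omega> \<in> B} =
           (\<integral>\<^sup>+\<omega>. indicator A (X \<omega>) * emeasure (K (X \<omega>)) B \<partial>M)"
    using cl B unfolding cond_law_def by auto
  have "distr (density M (\<lambda>\<omega>. indicator B (Y \<omega>))) MX X = distr (density M (\<lambda>\<omega>. emeasure (K (X \<omega>)) B)) MX X"
  proof (rule measure_eqI)
    fix A assume "A \<in> sets (distr (density M (\<lambda>\<omega>. indicator B (Y \<omega>))) MX X)"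
    then have A [measurable]: "A \<in> sets MX" by simp
    have XA [measurable]: "X -` A \<inter> space M \<in> sets M" by (rule measurable_sets[OF X A])
    have "emeasure (distr (density M (\<lambda>\<omega>. indicator B (Y \<omega>))) MX X) A = (\<integral>\<^sup>+\<omega>. indicator B (Y \<omega>) * indicator (X -` A \<inter> space M) \<omega> \<partial>M)"
      by (subst emeasure_distr) (auto simp: emeasure_density)
    also have "\<dots> = (\<integral>\<^sup>+\<omega>. indicator {\<omega>\<in>space M. X \<omega> \<in> A \<and> Y \<omega> \<in> B} \<omega> \<partial>M)"
      by (intro nn_integral_cong) (auto split: split_indicator)
    also have "\<dots> = emeasure M {\<omega>\<in>space M. X \<omega> \<in> A \<and> Y \<omega> \<in> B}"
      by (rule nn_integral_indicator) measurable
    also have "\<dots> = (\<integral>\<^sup>+\<omega>. emeasure (K (X \<omega>)) B * indicator (X -` A \<inter> space M) \<omega> \<partial>M)"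
      unfolding eq[OF A] by (intro nn_integral_cong) (auto split: split_indicator)
    also have "\<dots> = emeasure (distr (density M (\<lambda>\<omega>. emeasure (K (X \<omega>)) B)) MX X) A"
      by (subst emeasure_distr) (auto simp: emeasure_density)
    finally show "emeasure (distr (density M (\<lambda>\<omega>. indicator B (Y \<omega>))) MX X) A = emeasure (distr (density M (\<lambda>\<omega>. emeasure (K (X \<omega>)) B)) MX X) A" .
  qed simp
  then have "(\<integral>\<^sup>+x. g x \<partial>distr (density M (\<lambda>\<omega>. indicator B (Y \<omega>))) MX X) = (\<integral>\<^sup>+x. g x \<partial>distr (density M (\<lambda>\<omega>. emeasure (K (X \<omega>)) B)) MX X)"
    by simp
  then show ?thesis
    by (simp add: nn_integral_distr nn_integral_density mult.commute)
qed

text \<open>Mixing the conditional laws given the total mass over a density of the form \<open>g f\<close>, where \<open>f\<close> is the density of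
  the total mass, means weighting the original probability by \<open>g\<close> of the total mass.\<close>
lemma PD_tilted_eq_distr:
  assumes alpha: "0 < \<alpha>" and f: "stable_density \<alpha> f" and lam: "0 < lam"
    and S: "distributed M lborel (total_mass A) (\<lambda>t. ennreal (f t))"
    and kappa: "PD_given M A \<kappa>"
  shows "PD_tilted f \<kappa> m lam =
    distr (density M (\<lambda>\<omega>. ennreal (total_mass A \<omega> ^ m * exp (- (lam * total_mass A \<omega>)) / stable_moment \<alpha> m lam)))
      real_seq (\<lambda>\<omega> l. A l \<omega> / total_mass A \<omega>)"
proof (rule measure_eqI)
  have fm [measurable]: "f \<in> borel_measurable borel" and f0: "\<And>t. 0 \<le> f t"
    using f by (auto simp: stable_density_def)
  have k: "\<kappa> \<in> measurable borel (prob_algebra real_seq)"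
    and cl: "cond_law M (total_mass A) borel \<kappa> (\<lambda>\<omega> l. A l \<omega> / total_mass A \<omega>) real_seq"
    using kappa by (auto simp: PD_given_def)
  note k' [measurable] = measurable_prob_algebraD[OF k]
  have Sm [measurable]: "total_mass A \<in> borel_measurable M"
    and Qm [measurable]: "(\<lambda>\<omega> l. A l \<omega> / total_mass A \<omega>) \<in> measurable M real_seq"
    using cl by (auto simp: cond_law_def)
  define g where "g t = t ^ m * exp (- (lam * t)) / stable_moment \<alpha> m lam" for t
  have gm [measurable]: "g \<in> borel_measurable borel" unfolding g_def by measurable
  have tilted: "ennreal (tilted_density f m lam t) = ennreal (f t) * ennreal (g t)" for t
    unfolding tilted_density_def integral_stable_moment[OF alpha f lam] g_def
    by (simp add: ennreal_mult'[symmetric] f0 mult.commute)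
  have td [measurable]: "tilted_density f m lam \<in> borel_measurable borel"
    unfolding tilted_density_def by measurable
  show sets: "sets (PD_tilted f \<kappa> m lam) = sets (distr (density M (\<lambda>\<omega>. ennreal (total_mass A \<omega> ^ m * exp (- (lam * total_mass A \<omega>)) / stable_moment \<alpha> m lam)))
      real_seq (\<lambda>\<omega> l. A l \<omega> / total_mass A \<omega>))"
    unfolding PD_tilted_def by (subst sets_bind[where N = real_seq]) (auto simp: sets_kernel[OF k'])
  fix B assume "B \<in> sets (PD_tilted f \<kappa> m lam)"
  then have B [measurable]: "B \<in> sets real_seq" unfolding sets by simp
  have kB [measurable]: "(\<lambda>t. emeasure (\<kappa> t) B) \<in> borel_measurable borel"
    using measurable_emeasure_kernel[OF k' B] .
  have QB [measurable]: "(\<lambda>\<omega> l. A l \<omega> / total_mass A \<omega>) -` B \<inter> space M \<in> sets M" by (rule measurable_sets[OF Qm B])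
  have "emeasure (PD_tilted f \<kappa> m lam) B = (\<integral>\<^sup>+t. emeasure (\<kappa> t) B \<partial>density lborel (\<lambda>t. ennreal (tilted_density f m lam t)))"
    unfolding PD_tilted_def by (rule emeasure_bind[where N = real_seq]) auto
  also have "\<dots> = (\<integral>\<^sup>+t. ennreal (f t) * (ennreal (g t) * emeasure (\<kappa> t) B) \<partial>lborel)"
    by (subst nn_integral_density) (auto simp: tilted mult.assoc)
  also have "\<dots> = (\<integral>\<^sup>+\<omega>. ennreal (g (total_mass A \<omega>)) * emeasure (\<kappa> (total_mass A \<omega>)) B \<partial>M)"
    by (rule distributed_nn_integral[OF S]) measurable
  also have "\<dots> = (\<integral>\<^sup>+\<omega>. ennreal (g (total_mass A \<omega>)) * indicator B (\<lambda>l. A l \<omega> / total_mass A \<omega>) \<partial>M)"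
    by (rule cond_law_nn_integral[OF cl B, symmetric]) measurable
  also have "\<dots> = (\<integral>\<^sup>+\<omega>. ennreal (g (total_mass A \<omega>)) * indicator ((\<lambda>\<omega> l. A l \<omega> / total_mass A \<omega>) -` B \<inter> space M) \<omega> \<partial>M)"
    by (intro nn_integral_cong) (auto split: split_indicator)
  also have "\<dots> = emeasure (distr (density M (\<lambda>\<omega>. ennreal (g (total_mass A \<omega>)))) real_seq (\<lambda>\<omega> l. A l \<omega> / total_mass A \<omega>)) B"
    by (subst emeasure_distr) (auto simp: emeasure_density)
  finally show "emeasure (PD_tilted f \<kappa> m lam) B = emeasure (distr (density M (\<lambda>\<omega>. ennreal (total_mass A \<omega> ^ m * exp (- (lam * total_mass A \<omega>)) / stable_moment \<alpha> m lam)))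
      real_seq (\<lambda>\<omega> l. A l \<omega> / total_mass A \<omega>)) B"
    unfolding g_def .
qed

definition masses_left :: "nat \<Rightarrow> (nat \<Rightarrow> real) \<Rightarrow> (nat \<Rightarrow> nat) \<Rightarrow> nat \<Rightarrow> real" where
  "masses_left k p s = (\<lambda>i. if i \<in> s ` {..<k} then 0 else p i)"

definition stick_ratio :: "nat \<Rightarrow> (nat \<Rightarrow> real) \<Rightarrow> (nat \<Rightarrow> nat) \<Rightarrow> real" where
  "stick_ratio k p s = 1 - masses_left k p s (s k) / suminf (masses_left k p s)"

lemma masses_left_0 [simp]: "masses_left 0 p s = p"
  by (simp add: masses_left_def)

lemma masses_left_Suc: "masses_left (Suc k) p s = (masses_left k p s)(s k := 0)"
  by (auto simp: masses_left_def fun_eq_iff lessThan_Suc)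

lemma masses_left_cong: "(\<And>i. i < k \<Longrightarrow> s i = t i) \<Longrightarrow> masses_left k p s = masses_left k p t"
  by (auto simp: masses_left_def fun_eq_iff image_iff)

lemma stick_ratio_cong:
  assumes "\<And>i. i \<le> k \<Longrightarrow> s i = t i"
  shows "stick_ratio k p s = stick_ratio k p t"
  unfolding stick_ratio_def using assms masses_left_cong[of k s t p] by simp

lemma masses_left_measurable [measurable]:
  assumes [measurable]: "f \<in> measurable M real_seq" "\<And>i. i < k \<Longrightarrow> (\<lambda>\<omega>. s \<omega> i) \<in> measurable M (count_space UNIV)"
  shows "(\<lambda>\<omega>. masses_left k (f \<omega>) (s \<omega>)) \<in> measurable M real_seq"
proof (rule measurable_PiM_single')
  fix i :: nat
  have *: "i \<in> s \<omega> ` {..<k} \<longleftrightarrow> (\<exists>l\<in>{..<k}. s \<omega> l = i)" for \<omega> by auto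
  have "(\<lambda>\<omega>. f \<omega> i) \<in> borel_measurable M" by measurable
  then show "(\<lambda>\<omega>. masses_left k (f \<omega>) (s \<omega>) i) \<in> borel_measurable M"
    unfolding masses_left_def * by measurable
qed (auto simp: space_PiM)

lemma stick_ratio_measurable [measurable]:
  assumes [measurable]: "f \<in> measurable M real_seq" "\<And>i. i \<le> k \<Longrightarrow> (\<lambda>\<omega>. s \<omega> i) \<in> measurable M (count_space UNIV)"
  shows "(\<lambda>\<omega>. stick_ratio k (f \<omega>) (s \<omega>)) \<in> borel_measurable M"
proof -
  have [measurable]: "(\<lambda>\<omega>. masses_left k (f \<omega>) (s \<omega>)) \<in> measurable M real_seq" by measurable
  have "(\<lambda>\<omega>. masses_left k (f \<omega>) (s \<omega>) (s \<omega> k)) \<in> borel_measurable M"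
    by (rule measurable_compose_countable[where f = "\<lambda>j \<omega>. masses_left k (f \<omega>) (s \<omega>) j" and g = "\<lambda>\<omega>. s \<omega> k"]) measurable
  then show ?thesis unfolding stick_ratio_def by measurable
qed

lemma size_biased_pick_law:
  assumes sb: "size_biased_sampling M P \<sigma>" and Pm [measurable]: "\<And>l. P l \<in> borel_measurable M"
    and g [measurable]: "g \<in> borel_measurable (real_seq \<Otimes>\<^sub>M (\<Pi>\<^sub>M i\<in>{..<k}. count_space UNIV))"
  shows "(\<integral>\<^sup>+\<omega>. g (\<lambda>l. P l \<omega>, \<lambda>i\<in>{..<k}. \<sigma> i \<omega>) * indicator {j} (\<sigma> k \<omega>) \<partial>M) =
    (\<integral>\<^sup>+\<omega>. g (\<lambda>l. P l \<omega>, \<lambda>i\<in>{..<k}. \<sigma> i \<omega>) *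
       ennreal (masses_left k (\<lambda>l. P l \<omega>) (\<lambda>i. \<sigma> i \<omega>) j / suminf (masses_left k (\<lambda>l. P l \<omega>) (\<lambda>i. \<sigma> i \<omega>))) \<partial>M)"
proof -
  define K where "K = (\<lambda>(p :: nat \<Rightarrow> real, s). density (count_space UNIV)
           (\<lambda>j. ennreal (if j \<in> s ` {..<k} then 0
                         else p j / (\<Sum>i. if i \<in> s ` {..<k} then 0 else p i))))"
  have cl: "cond_law M (\<lambda>\<omega>. (\<lambda>l. P l \<omega>, \<lambda>i\<in>{..<k}. \<sigma> i \<omega>))
        (real_seq \<Otimes>\<^sub>M (\<Pi>\<^sub>M i\<in>{..<k}. count_space UNIV)) K (\<sigma> k) (count_space UNIV)"
    using sb unfolding size_biased_sampling_def K_def by blast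
  have K: "emeasure (K (p, s)) {j} = ennreal (masses_left k p s j / suminf (masses_left k p s))" for p s
  proof -
    have "emeasure (K (p, s)) {j} = (\<integral>\<^sup>+i. ennreal (if i \<in> s ` {..<k} then 0
                         else p i / (\<Sum>i. if i \<in> s ` {..<k} then 0 else p i)) * indicator {j} i \<partial>count_space UNIV)"
      unfolding K_def by (simp add: emeasure_density)
    also have "\<dots> = ennreal (if j \<in> s ` {..<k} then 0
                         else p j / (\<Sum>i. if i \<in> s ` {..<k} then 0 else p i))"
      by (subst nn_integral_indicator_singleton) auto
    finally show ?thesis by (simp add: masses_left_def)
  qed
  have "masses_left k p (\<lambda>i\<in>{..<k}. s i) = masses_left k p s" for p s
    by (rule masses_left_cong) simp
  then show ?thesis
    using cond_law_nn_integral[OF cl _ g, of "{j}"] by (simp add: K)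
qed

text \<open>The functional \<open>size_biased_prob\<close> is unfolded one pick at a time: conditionally on the earlier picks, its sum over
  indices is the expectation over the next pick.\<close>
lemma size_biased_stick_ratios:
  assumes sb: "size_biased_sampling M P \<sigma>" and Pm [measurable]: "\<And>l. P l \<in> borel_measurable M"
    and B: "\<And>l. B l \<in> sets borel"
  shows "(\<integral>\<^sup>+\<omega>. (\<Prod>l<k. indicator (B l) (stick_ratio l (\<lambda>l. P l \<omega>) (\<lambda>i. \<sigma> i \<omega>))) *
      size_biased_prob n (\<lambda>l. B (l + k)) (masses_left k (\<lambda>l. P l \<omega>) (\<lambda>i. \<sigma> i \<omega>)) \<partial>M) =
    (\<integral>\<^sup>+\<omega>. size_biased_prob (n + k) B (\<lambda>l. P l \<omega>) \<partial>M)"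
proof (induction k arbitrary: n)
  case (Suc k)
  have Bm [measurable]: "B l \<in> sets borel" for l by (rule B)
  have \<sigma>m [measurable]: "\<sigma> i \<in> measurable M (count_space UNIV)" for i
    using sb by (auto simp: size_biased_sampling_def cond_law_def)
  have Pseq [measurable]: "(\<lambda>\<omega> l. P l \<omega>) \<in> measurable M real_seq"
    by (rule measurable_PiM_single') auto
  define V where "V = size_biased_prob n (\<lambda>l. B (l + Suc k))"
  have V [measurable]: "V \<in> borel_measurable real_seq"
    unfolding V_def by (rule size_biased_prob_measurable) simp
  define g where "g j = (\<lambda>(p, s). (\<Prod>l<k. indicator (B l) (stick_ratio l p s)) *
      (indicator (B k) (1 - masses_left k p s j / suminf (masses_left k p s)) * V ((masses_left k p s)(j := 0)) :: ennreal))" for j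
  let ?X = "real_seq \<Otimes>\<^sub>M (\<Pi>\<^sub>M i\<in>{..<k}. count_space (UNIV :: nat set))"
  have gm [measurable]: "g j \<in> borel_measurable ?X" for j
  proof -
    have s: "(\<lambda>q. snd q i) \<in> measurable ?X (count_space UNIV)" if "i < k" for i
      by (rule measurable_compose[OF measurable_snd measurable_component_singleton]) (use that in auto)
    have m1 [measurable]: "(\<lambda>q. masses_left k (fst q) (snd q)) \<in> measurable ?X real_seq"
      by (rule masses_left_measurable) (use s in auto)
    have [measurable]: "(\<lambda>q. stick_ratio l (fst q) (snd q)) \<in> borel_measurable ?X" if "l \<in> {..<k}" for l
      by (rule stick_ratio_measurable) (use s that in auto)
    show ?thesis unfolding g_def split_beta' by measurable
  qed
  define X where "X \<omega> = (\<lambda>l. P l \<omega>, \<lambda>i\<in>{..<k}. \<sigma> i \<omega>)" for \<omega>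
  have ind [measurable]: "(\<lambda>\<omega>. indicator {j} (\<sigma> k \<omega>) :: ennreal) \<in> borel_measurable M" for j
    by (rule measurable_compose[OF \<sigma>m]) simp
  define z where "z \<omega> = masses_left k (\<lambda>l. P l \<omega>) (\<lambda>i. \<sigma> i \<omega>)" for \<omega>
  have gX: "g j (X \<omega>) = (\<Prod>l<k. indicator (B l) (stick_ratio l (\<lambda>l. P l \<omega>) (\<lambda>i. \<sigma> i \<omega>))) *
     (indicator (B k) (1 - z \<omega> j / suminf (z \<omega>)) * V ((z \<omega>)(j := 0)))" for j \<omega>
  proof -
    have "masses_left k (\<lambda>l. P l \<omega>) (\<lambda>i\<in>{..<k}. \<sigma> i \<omega>) = z \<omega>"
      unfolding z_def by (rule masses_left_cong) simp
    moreover have "stick_ratio l (\<lambda>l. P l \<omega>) (\<lambda>i\<in>{..<k}. \<sigma> i \<omega>) = stick_ratio l (\<lambda>l. P l \<omega>) (\<lambda>i. \<sigma> i \<omega>)" if "l < k" for l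
      by (rule stick_ratio_cong) (use that in auto)
    ultimately show ?thesis by (simp add: g_def X_def)
  qed
  have gXm [measurable]: "(\<lambda>\<omega>. g j (X \<omega>)) \<in> borel_measurable M" for j
  proof -
    have "X \<in> measurable M ?X" unfolding X_def by measurable
    from measurable_compose[OF this gm] show ?thesis .
  qed
  have "(\<integral>\<^sup>+\<omega>. (\<Prod>l<Suc k. indicator (B l) (stick_ratio l (\<lambda>l. P l \<omega>) (\<lambda>i. \<sigma> i \<omega>))) *
      size_biased_prob n (\<lambda>l. B (l + Suc k)) (masses_left (Suc k) (\<lambda>l. P l \<omega>) (\<lambda>i. \<sigma> i \<omega>)) \<partial>M) =
    (\<integral>\<^sup>+\<omega>. (\<Sum>j. g j (X \<omega>) * indicator {j} (\<sigma> k \<omega>)) \<partial>M)"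
  proof (rule nn_integral_cong)
    fix \<omega>
    have "(\<Sum>j. g j (X \<omega>) * indicator {j} (\<sigma> k \<omega>)) = (\<Sum>j. if j = \<sigma> k \<omega> then g j (X \<omega>) else 0)"
      by (intro suminf_cong) auto
    also have "\<dots> = g (\<sigma> k \<omega>) (X \<omega>)" by (rule sums_unique[OF sums_single, symmetric])
    finally show "(\<Prod>l<Suc k. indicator (B l) (stick_ratio l (\<lambda>l. P l \<omega>) (\<lambda>i. \<sigma> i \<omega>))) *
      size_biased_prob n (\<lambda>l. B (l + Suc k)) (masses_left (Suc k) (\<lambda>l. P l \<omega>) (\<lambda>i. \<sigma> i \<omega>)) = (\<Sum>j. g j (X \<omega>) * indicator {j} (\<sigma> k \<omega>))"
      by (simp add: gX masses_left_Suc V_def z_def stick_ratio_def mult.assoc)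
  qed
  also have "\<dots> = (\<Sum>j. (\<integral>\<^sup>+\<omega>. g j (X \<omega>) * indicator {j} (\<sigma> k \<omega>) \<partial>M))"
    by (rule nn_integral_suminf) measurable
  also have "\<dots> = (\<Sum>j. (\<integral>\<^sup>+\<omega>. g j (X \<omega>) * ennreal (z \<omega> j / suminf (z \<omega>)) \<partial>M))"
    unfolding X_def z_def by (intro suminf_cong size_biased_pick_law[OF sb Pm gm])
  also have "\<dots> = (\<integral>\<^sup>+\<omega>. (\<Sum>j. g j (X \<omega>) * ennreal (z \<omega> j / suminf (z \<omega>))) \<partial>M)"
  proof (rule nn_integral_suminf[symmetric])
    have [measurable]: "z \<in> measurable M real_seq" unfolding z_def by measurable
    show "(\<lambda>\<omega>. g j (X \<omega>) * ennreal (z \<omega> j / suminf (z \<omega>))) \<in> borel_measurable M" for j by measurable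
  qed
  also have "\<dots> = (\<integral>\<^sup>+\<omega>. (\<Prod>l<k. indicator (B l) (stick_ratio l (\<lambda>l. P l \<omega>) (\<lambda>i. \<sigma> i \<omega>))) *
      size_biased_prob (Suc n) (\<lambda>l. B (l + k)) (z \<omega>) \<partial>M)"
  proof (rule nn_integral_cong)
    fix \<omega>
    show "(\<Sum>j. g j (X \<omega>) * ennreal (z \<omega> j / suminf (z \<omega>))) = (\<Prod>l<k. indicator (B l) (stick_ratio l (\<lambda>l. P l \<omega>) (\<lambda>i. \<sigma> i \<omega>))) *
      size_biased_prob (Suc n) (\<lambda>l. B (l + k)) (z \<omega>)"
      by (simp add: gX V_def ennreal_suminf_cmult[symmetric] mult_ac)
  qed
  also have "\<dots> = (\<integral>\<^sup>+\<omega>. size_biased_prob (Suc n + k) B (\<lambda>l. P l \<omega>) \<partial>M)"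
    unfolding z_def by (rule Suc.IH)
  finally show ?case by simp
qed simp

lemma size_biased_picks_distinct:
  assumes sb: "size_biased_sampling M P \<sigma>" and Pm [measurable]: "\<And>l. P l \<in> borel_measurable M"
  shows "AE \<omega> in M. \<forall>k. \<sigma> k \<omega> \<notin> (\<lambda>i. \<sigma> i \<omega>) ` {..<k}"
proof -
  have \<sigma>m [measurable]: "\<sigma> i \<in> measurable M (count_space UNIV)" for i
    using sb by (auto simp: size_biased_sampling_def cond_law_def)
  have "AE \<omega> in M. \<not> (j \<in> (\<lambda>i. \<sigma> i \<omega>) ` {..<k} \<and> \<sigma> k \<omega> = j)" for j k
  proof -
    define g where "g = (\<lambda>(p :: nat \<Rightarrow> real, s). if \<exists>i\<in>{..<k}. s i = j then 1 else (0 :: ennreal))"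
    have gm [measurable]: "g \<in> borel_measurable (real_seq \<Otimes>\<^sub>M (\<Pi>\<^sub>M i\<in>{..<k}. count_space UNIV))"
      unfolding g_def split_beta' by measurable
    have gs: "g (p, \<lambda>i\<in>{..<k}. s i) = (if j \<in> s ` {..<k} then 1 else 0)" for p s
      by (auto simp: g_def)
    note size_biased_pick_law[OF sb Pm gm]
    also have "(\<integral>\<^sup>+\<omega>. g (\<lambda>l. P l \<omega>, \<lambda>i\<in>{..<k}. \<sigma> i \<omega>) *
       ennreal (masses_left k (\<lambda>l. P l \<omega>) (\<lambda>i. \<sigma> i \<omega>) j / suminf (masses_left k (\<lambda>l. P l \<omega>) (\<lambda>i. \<sigma> i \<omega>))) \<partial>M) = (\<integral>\<^sup>+\<omega>. 0 \<partial>M)"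
      unfolding gs by (intro nn_integral_cong) (auto simp: masses_left_def)
    finally have "(\<integral>\<^sup>+\<omega>. g (\<lambda>l. P l \<omega>, \<lambda>i\<in>{..<k}. \<sigma> i \<omega>) * indicator {j} (\<sigma> k \<omega>) \<partial>M) = 0" by simp
    moreover have [measurable]: "(\<lambda>\<omega>. indicator {j} (\<sigma> k \<omega>) :: ennreal) \<in> borel_measurable M"
      by (rule measurable_compose[OF \<sigma>m]) simp
    have "(\<lambda>\<omega>. (\<lambda>l. P l \<omega>, \<lambda>i\<in>{..<k}. \<sigma> i \<omega>)) \<in> measurable M (real_seq \<Otimes>\<^sub>M (\<Pi>\<^sub>M i\<in>{..<k}. count_space UNIV))"
      by (intro measurable_Pair measurable_restrict measurable_PiM_single') auto
    from measurable_compose[OF this gm]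
    have "(\<lambda>\<omega>. g (\<lambda>l. P l \<omega>, \<lambda>i\<in>{..<k}. \<sigma> i \<omega>) * indicator {j} (\<sigma> k \<omega>)) \<in> borel_measurable M"
      by measurable
    with calculation have "AE \<omega> in M. g (\<lambda>l. P l \<omega>, \<lambda>i\<in>{..<k}. \<sigma> i \<omega>) * indicator {j} (\<sigma> k \<omega>) = 0"
      by (simp add: nn_integral_0_iff_AE)
    then show ?thesis unfolding gs by eventually_elim auto
  qed
  then have "AE \<omega> in M. \<forall>j k. \<not> (j \<in> (\<lambda>i. \<sigma> i \<omega>) ` {..<k} \<and> \<sigma> k \<omega> = j)"
    by (simp add: AE_all_countable)
  then show ?thesis by eventually_elim blast
qed

text \<open>The product of the ratios telescopes to the mass that is still left.\<close>
lemma stick_breaking_of_distinct_picks: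
  fixes p :: "nat \<Rightarrow> real"
  assumes pos: "\<And>i. 0 < p i" and p: "summable p" "suminf p = 1"
    and dist: "\<And>k. s k \<notin> s ` {..<k}"
  shows "p (s k) = (1 - stick_ratio k p s) * (\<Prod>l<k. stick_ratio l p s)"
proof -
  have summ: "summable (masses_left k p s)" for k
  proof (induction k)
    case (Suc k)
    then show ?case unfolding masses_left_Suc by (rule suminf_fun_upd_0(1))
  qed (simp add: p)
  have pos_sum: "0 < suminf (masses_left k p s)" for k
  proof -
    obtain i where "i \<notin> s ` {..<k}" using ex_new_if_finite[OF infinite_UNIV_nat, of "s ` {..<k}"] by auto
    then show ?thesis using summ[of k] pos less_imp_le[OF pos]
      by (intro suminf_pos2[where i = i]) (auto simp: masses_left_def)
  qed
  have left: "masses_left k p s (s k) = p (s k)" for k using dist[of k] by (simp add: masses_left_def)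
  have prod: "(\<Prod>l<k. stick_ratio l p s) = suminf (masses_left k p s)" for k
  proof (induction k)
    case (Suc k)
    have "suminf (masses_left (Suc k) p s) = suminf (masses_left k p s) - p (s k)"
      unfolding masses_left_Suc suminf_fun_upd_0(2)[OF summ] left ..
    moreover have "suminf (masses_left k p s) * (1 - p (s k) / suminf (masses_left k p s)) = suminf (masses_left k p s) - p (s k)"
      using pos_sum[of k] by (simp add: right_diff_distrib)
    ultimately show ?case using Suc by (simp add: stick_ratio_def left)
  qed (simp add: p)
  show ?thesis unfolding prod unfolding stick_ratio_def left using pos_sum[of k] by simp
qed

text \<open>The two facts about the sampled sequence that the theorem needs: the joint law of its ratios, and its recovery
  from them. Positivity and total mass one are transferred from the jumps to the masses through their common
  law.\<close>
lemma size_biased_stick_ratio_law: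
  assumes alpha: "0 < \<alpha>" "\<alpha> < 1" and m: "1 \<le> m" and f: "stable_density \<alpha> f"
    and tau: "stable_subordinator M \<alpha> \<tau>" and A: "ranked_jumps M \<tau> A"
    and S: "distributed M lborel (total_mass A) (\<lambda>t. ennreal (f t))"
    and kappa: "PD_given M A \<kappa>" and lam: "0 < lam"
    and Pm [measurable]: "\<And>l. P l \<in> borel_measurable M'"
    and P: "distr M' real_seq (\<lambda>\<omega> l. P l \<omega>) = PD_tilted f \<kappa> m lam"
    and sb: "size_biased_sampling M' P \<sigma>"
  shows "\<And>n B. (\<And>l. B l \<in> sets borel) \<Longrightarrow>
      emeasure M' {\<omega>\<in>space M'. \<forall>l<n. stick_ratio l (\<lambda>l. P l \<omega>) (\<lambda>i. \<sigma> i \<omega>) \<in> B l} =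
      R_chain_expectation \<alpha> m n (\<lambda>l r. emeasure (W_law \<alpha> m r) (B l)) lam"
    and "AE \<omega> in M'. \<forall>k. P (\<sigma> k \<omega>) \<omega> = (1 - stick_ratio k (\<lambda>l. P l \<omega>) (\<lambda>i. \<sigma> i \<omega>)) *
           (\<Prod>l<k. stick_ratio l (\<lambda>l. P l \<omega>) (\<lambda>i. \<sigma> i \<omega>))"
proof -
  define c where "c = stable_moment \<alpha> m lam"
  have c: "0 < c" unfolding c_def by (rule stable_moment_pos[OF alpha(1) f lam])
  define w where "w \<omega> = ennreal (total_mass A \<omega> ^ m * exp (- (lam * total_mass A \<omega>)) / c)" for \<omega>
  have Sm [measurable]: "total_mass A \<in> borel_measurable M"
    and Qm [measurable]: "(\<lambda>\<omega> l. A l \<omega> / total_mass A \<omega>) \<in> measurable M real_seq"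
    using kappa by (auto simp: cond_law_def PD_given_def)
  have wm [measurable]: "w \<in> borel_measurable M" unfolding w_def by measurable
  have Pseq [measurable]: "(\<lambda>\<omega> l. P l \<omega>) \<in> measurable M' real_seq"
    by (rule measurable_PiM_single') auto
  have \<sigma>m [measurable]: "\<sigma> i \<in> measurable M' (count_space UNIV)" for i
    using sb by (auto simp: size_biased_sampling_def cond_law_def)
  have law: "distr M' real_seq (\<lambda>\<omega> l. P l \<omega>) = distr (density M w) real_seq (\<lambda>\<omega> l. A l \<omega> / total_mass A \<omega>)"
    unfolding P PD_tilted_eq_distr[OF alpha(1) f lam S kappa] w_def c_def ..
  have good: "AE \<omega> in M. (\<forall>k. 0 < A k \<omega>) \<and> summable (\<lambda>k. A k \<omega>) \<and> 0 < total_mass A \<omega>"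
    by (rule total_mass_pos_AE[OF tau A])
  show "emeasure M' {\<omega>\<in>space M'. \<forall>l<n. stick_ratio l (\<lambda>l. P l \<omega>) (\<lambda>i. \<sigma> i \<omega>) \<in> B l} =
      R_chain_expectation \<alpha> m n (\<lambda>l r. emeasure (W_law \<alpha> m r) (B l)) lam"
    if B: "\<And>l. B l \<in> sets borel" for n B
  proof -
    have Bm [measurable]: "B l \<in> sets borel" for l by (rule B)
    have V [measurable]: "size_biased_prob n B \<in> borel_measurable real_seq"
      by (rule size_biased_prob_measurable[OF B])
    have "{\<omega>\<in>space M'. \<forall>l\<in>{..<n}. stick_ratio l (\<lambda>l. P l \<omega>) (\<lambda>i. \<sigma> i \<omega>) \<in> B l} \<in> sets M'" by measurable
    then have ms: "{\<omega>\<in>space M'. \<forall>l<n. stick_ratio l (\<lambda>l. P l \<omega>) (\<lambda>i. \<sigma> i \<omega>) \<in> B l} \<in> sets M'" by (simp add: Ball_def)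
    have "emeasure M' {\<omega>\<in>space M'. \<forall>l<n. stick_ratio l (\<lambda>l. P l \<omega>) (\<lambda>i. \<sigma> i \<omega>) \<in> B l} =
      (\<integral>\<^sup>+\<omega>. (\<Prod>l<n. indicator (B l) (stick_ratio l (\<lambda>l. P l \<omega>) (\<lambda>i. \<sigma> i \<omega>))) *
      size_biased_prob 0 (\<lambda>l. B (l + n)) (masses_left n (\<lambda>l. P l \<omega>) (\<lambda>i. \<sigma> i \<omega>)) \<partial>M')"
      unfolding nn_integral_indicator[OF ms, symmetric]
      by (intro nn_integral_cong) (auto simp: indicator_def prod_eq_1_iff)
    also have "\<dots> = (\<integral>\<^sup>+\<omega>. size_biased_prob n B (\<lambda>l. P l \<omega>) \<partial>M')"
      using size_biased_stick_ratios[OF sb Pm B, where n = 0 and k = n] by simp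
    also have "\<dots> = (\<integral>\<^sup>+p. size_biased_prob n B p \<partial>distr M' real_seq (\<lambda>\<omega> l. P l \<omega>))"
      by (subst nn_integral_distr) auto
    also have "\<dots> = (\<integral>\<^sup>+\<omega>. w \<omega> * size_biased_prob n B (\<lambda>l. A l \<omega> / total_mass A \<omega>) \<partial>M)"
      unfolding law by (subst nn_integral_distr, simp, simp) (subst nn_integral_density, auto)
    also have "\<dots> = (\<integral>\<^sup>+\<omega>. ennreal (1 / c) * (ennreal (total_mass A \<omega> ^ m * exp (- (lam * total_mass A \<omega>))) * size_biased_prob n B (\<lambda>l. A l \<omega>)) \<partial>M)"
    proof (rule nn_integral_cong_AE)
      show "AE \<omega> in M. w \<omega> * size_biased_prob n B (\<lambda>l. A l \<omega> / total_mass A \<omega>) =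
        ennreal (1 / c) * (ennreal (total_mass A \<omega> ^ m * exp (- (lam * total_mass A \<omega>))) * size_biased_prob n B (\<lambda>l. A l \<omega>))"
        using good
      proof eventually_elim
        case (elim \<omega>)
        then have "size_biased_prob n B (\<lambda>l. A l \<omega> / total_mass A \<omega>) = size_biased_prob n B (\<lambda>l. A l \<omega>)"
          by (intro size_biased_prob_scale) auto
        then show ?case using c elim
          by (simp add: w_def mult.assoc[symmetric] ennreal_mult[symmetric])
      qed
    qed
    also have "\<dots> = ennreal (1 / c) * (\<integral>\<^sup>+\<omega>. ennreal (total_mass A \<omega> ^ m * exp (- (lam * total_mass A \<omega>))) * size_biased_prob n B (\<lambda>l. A l \<omega>) \<partial>M)"
    proof (rule nn_integral_cmult)
      have [measurable]: "A k \<in> borel_measurable M" for k using A by (simp add: ranked_jumps_def)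
      have [measurable]: "(\<lambda>\<omega> l. A l \<omega>) \<in> measurable M real_seq"
        by (rule measurable_PiM_single') auto
      show "(\<lambda>\<omega>. ennreal (total_mass A \<omega> ^ m * exp (- (lam * total_mass A \<omega>))) * size_biased_prob n B (\<lambda>l. A l \<omega>)) \<in> borel_measurable M"
        by measurable
    qed
    also have "\<dots> = (ennreal (1 / c) * ennreal c) * R_chain_expectation \<alpha> m n (\<lambda>l r. emeasure (W_law \<alpha> m r) (B l)) lam"
      unfolding size_biased_tilted_expectation[OF alpha m f tau A S lam B] c_def by (simp only: mult.assoc)
    also have "ennreal (1 / c) * ennreal c = 1" using c by (simp add: ennreal_mult'[symmetric])
    finally show ?thesis by simp
  qed
  define ok where "ok p \<longleftrightarrow> (\<forall>k. 0 < p k) \<and> (\<Sum>k. ennreal (p k)) = 1" for p :: "nat \<Rightarrow> real"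
  have okm [measurable]: "Measurable.pred real_seq ok" unfolding ok_def by measurable
  have "AE \<omega> in density M w. ok (\<lambda>l. A l \<omega> / total_mass A \<omega>)"
  proof -
    have "AE \<omega> in M. ok (\<lambda>l. A l \<omega> / total_mass A \<omega>)"
      using good
    proof eventually_elim
      case (elim \<omega>)
      then have "summable (\<lambda>l. A l \<omega> / total_mass A \<omega>)" "(\<Sum>l. A l \<omega> / total_mass A \<omega>) = 1"
        by (auto simp: suminf_divide total_mass_def intro: summable_divide)
      then show ?case using elim unfolding ok_def
        by (subst suminf_ennreal2) (auto simp: less_imp_le)
    qed
    then show ?thesis by (subst AE_density) auto
  qed
  then have "AE p in distr M' real_seq (\<lambda>\<omega> l. P l \<omega>). ok p"
    unfolding law by (subst AE_distr_iff) auto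
  then have okP: "AE \<omega> in M'. ok (\<lambda>l. P l \<omega>)" by (rule AE_distrD[rotated]) simp
  show "AE \<omega> in M'. \<forall>k. P (\<sigma> k \<omega>) \<omega> = (1 - stick_ratio k (\<lambda>l. P l \<omega>) (\<lambda>i. \<sigma> i \<omega>)) *
           (\<Prod>l<k. stick_ratio l (\<lambda>l. P l \<omega>) (\<lambda>i. \<sigma> i \<omega>))"
    using okP size_biased_picks_distinct[OF sb Pm]
  proof eventually_elim
    case (elim \<omega>)
    then have pos: "\<And>k. 0 < P k \<omega>" and one: "(\<Sum>k. ennreal (P k \<omega>)) = 1" by (auto simp: ok_def)
    have summ: "summable (\<lambda>k. P k \<omega>)"
      using pos one by (intro summable_suminf_not_top) (auto simp: less_imp_le)
    have "ennreal (\<Sum>k. P k \<omega>) = 1"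
      using one by (subst (asm) suminf_ennreal2[OF _ summ]) (auto simp: less_imp_le pos)
    then have "(\<Sum>k. P k \<omega>) = 1" by simp
    then show ?case
      using stick_breaking_of_distinct_picks[of "\<lambda>l. P l \<omega>" "\<lambda>i. \<sigma> i \<omega>"] pos summ elim by blast
  qed
qed

section \<open>Markov chains and conditionally independent extensions\<close>

text \<open>The Ionescu-Tulcea theorem, with the transition property stated for functions of the history and the next
  value.\<close>
lemma exists_markov_chain:
  fixes K :: "nat \<Rightarrow> (nat \<Rightarrow> real) \<Rightarrow> real measure"
  assumes K: "\<And>n. K n \<in> measurable (PiM {0..<n} (\<lambda>_. borel)) (prob_algebra borel)"
  shows "\<exists>Q. prob_space Q \<and> sets Q = sets real_seq \<and>
    (\<forall>n. \<forall>h \<in> borel_measurable (PiM {0..<n} (\<lambda>_. borel) \<Otimes>\<^sub>M borel).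
      (\<integral>\<^sup>+\<omega>. h (restrict \<omega> {0..<n}, \<omega> n) \<partial>Q) =
      (\<integral>\<^sup>+\<omega>. (\<integral>\<^sup>+y. h (restrict \<omega> {0..<n}, y) \<partial>K n (restrict \<omega> {0..<n})) \<partial>Q))"
proof -
  note Ks [measurable] = measurable_prob_algebraD[OF K]
  have Kp: "prob_space (K i x)" if "x \<in> space (PiM {0..<i} (\<lambda>_. borel))" for i x
    using measurable_space[OF K that] by (simp add: space_prob_algebra)
  interpret IT: Ionescu_Tulcea K "\<lambda>_. borel :: real measure"
    by (rule Ionescu_Tulcea.intro[OF Ks Kp])
  define Q where "Q = IT.PF.lim"
  have sQ [simp, measurable_cong]: "sets Q = sets real_seq" by (simp add: Q_def)
  let ?P = "\<lambda>n. PiM {0..<n} (\<lambda>_ :: nat. borel :: real measure)"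
  let ?u = "\<lambda>_ :: nat. undefined :: real"
  have u: "?u \<in> space (?P 0)" by (simp add: space_PiM)
  have rm [measurable]: "(\<lambda>\<omega>. restrict \<omega> {0..<n}) \<in> measurable real_seq (?P n)" for n
    by (rule measurable_restrict_subset) auto
  have D: "distr Q (?P n) (\<lambda>\<omega>. restrict \<omega> {0..<n}) = IT.C 0 n ?u" for n
  proof -
    have up: "IT.up_to {0..<n} = n"
    proof (rule antisym)
      show "IT.up_to {0..<n} \<le> n" by (subst IT.up_to_iff_Ico) auto
      show "n \<le> IT.up_to {0..<n}"
        using IT.up_to[of "{0..<n}"] by (auto simp: atLeastLessThan_subset_iff)
    qed
    have "distr Q (?P n) (\<lambda>\<omega>. restrict \<omega> {0..<n}) = IT.CI {0..<n}"
      unfolding Q_def by (rule IT.distr_lim) simp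
    also have "\<dots> = distr (IT.C 0 n ?u) (?P n) (\<lambda>\<omega>. restrict \<omega> {0..<n})"
      by (simp add: IT.CI_def up)
    also have "\<dots> = IT.C 0 n ?u" using IT.distr_C[of n n ?u 0] u by simp
    finally show ?thesis .
  qed
  have "prob_space (distr Q (?P 0) (\<lambda>\<omega>. restrict \<omega> {0..<0}))"
    unfolding D by (rule IT.prob_space_C[OF u])
  then have pQ: "prob_space Q" by (rule prob_space_distrD[rotated]) measurable
  have "(\<integral>\<^sup>+\<omega>. h (restrict \<omega> {0..<n}, \<omega> n) \<partial>Q) =
      (\<integral>\<^sup>+\<omega>. (\<integral>\<^sup>+y. h (restrict \<omega> {0..<n}, y) \<partial>K n (restrict \<omega> {0..<n})) \<partial>Q)"
    if h [measurable]: "h \<in> borel_measurable (?P n \<Otimes>\<^sub>M borel)" for n h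
  proof -
    define H where "H x = h (restrict x {0..<n}, x n)" for x :: "nat \<Rightarrow> real"
    have [measurable]: "(\<lambda>x. restrict x {0..<n}) \<in> measurable (?P (Suc n)) (?P n)"
      by (rule measurable_restrict_subset) auto
    have [measurable]: "(\<lambda>x. x n) \<in> borel_measurable (?P (Suc n))"
      by (rule measurable_component_singleton) simp
    have Hm [measurable]: "H \<in> borel_measurable (?P (Suc n))" unfolding H_def by measurable
    have Cm: "sets (IT.C 0 n ?u) = sets (?P n)" using IT.sets_C[OF u, of n] by simp
    have "(\<integral>\<^sup>+\<omega>. h (restrict \<omega> {0..<n}, \<omega> n) \<partial>Q) = (\<integral>\<^sup>+\<omega>. H (restrict \<omega> {0..<Suc n}) \<partial>Q)"
      by (intro nn_integral_cong) (auto simp: H_def intro!: arg_cong[where f = h])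
    also have "\<dots> = (\<integral>\<^sup>+x. H x \<partial>IT.C 0 (Suc n) ?u)"
      unfolding D[symmetric] by (rule nn_integral_distr[symmetric], measurable)
    also have "\<dots> = (\<integral>\<^sup>+x. (\<integral>\<^sup>+z. H z \<partial>IT.eP n x) \<partial>IT.C 0 n ?u)"
      unfolding IT.C.simps add_0
      by (rule nn_integral_bind[OF Hm]) (use IT.measurable_eP[of n] measurable_cong_sets[OF Cm refl] in blast)
    also have "\<dots> = (\<integral>\<^sup>+x. (\<integral>\<^sup>+y. h (x, y) \<partial>K n x) \<partial>IT.C 0 n ?u)"
    proof (rule nn_integral_cong)
      fix x assume "x \<in> space (IT.C 0 n ?u)"
      then have x: "x \<in> space (?P n)" using IT.space_C[OF u, of n] by simp
      have r: "restrict (x(n := y)) {0..<n} = x" for y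
        using x by (auto simp: space_PiM PiE_iff extensional_def fun_eq_iff)
      show "(\<integral>\<^sup>+z. H z \<partial>IT.eP n x) = (\<integral>\<^sup>+y. h (x, y) \<partial>K n x)"
        unfolding IT.nn_integral_eP[OF x Hm] by (simp add: H_def r)
    qed
    also have "\<dots> = (\<integral>\<^sup>+\<omega>. (\<integral>\<^sup>+y. h (restrict \<omega> {0..<n}, y) \<partial>K n (restrict \<omega> {0..<n})) \<partial>Q)"
      unfolding D[symmetric]
      by (subst nn_integral_distr) (auto intro!: nn_integral_measurable_subprob_algebra2[OF _ Ks])
    finally show ?thesis .
  qed
  then show ?thesis using pQ sQ by blast
qed

lemma PiM_kernel_measurable:
  fixes k :: "nat \<Rightarrow> 'x \<Rightarrow> 'y measure"
  assumes k: "\<And>l. k l \<in> measurable MX (prob_algebra MY)"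
  shows "(\<lambda>x. PiM UNIV (\<lambda>l. k l x)) \<in> measurable MX (prob_algebra (PiM UNIV (\<lambda>_. MY)))"
proof (rule measurable_prob_algebra_generated[OF sets_PiM Int_stable_prod_algebra prod_algebra_sets_into_space])
  have p: "prob_space (k l x)" "sets (k l x) = sets MY" "space (k l x) = space MY" if "x \<in> space MX" for l x
    using measurable_space[OF k that, of l] by (auto simp: space_prob_algebra dest: sets_eq_imp_space_eq)
  fix x assume x: "x \<in> space MX"
  show "prob_space (PiM UNIV (\<lambda>l. k l x))" by (rule prob_space_PiM) (rule p[OF x])
  show "sets (PiM UNIV (\<lambda>l. k l x)) = sets (PiM UNIV (\<lambda>_. MY))"
    by (rule sets_PiM_cong) (auto simp: p[OF x])
next
  have p: "prob_space (k l x)" "sets (k l x) = sets MY" "space (k l x) = space MY" if "x \<in> space MX" for l x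
    using measurable_space[OF k that, of l] by (auto simp: space_prob_algebra dest: sets_eq_imp_space_eq)
  fix A assume "A \<in> prod_algebra UNIV (\<lambda>_ :: nat. MY)"
  then obtain J E where A: "A = prod_emb UNIV (\<lambda>_. MY) J (PiE J E)" and J: "finite J" "\<And>i. i \<in> J \<Longrightarrow> E i \<in> sets MY"
    by (rule prod_algebraE) auto
  have "emeasure (PiM UNIV (\<lambda>l. k l x)) A = (\<Prod>l\<in>J. emeasure (k l x) (E l))" if x: "x \<in> space MX" for x
  proof -
    interpret product_prob_space "\<lambda>l. k l x" UNIV
      using p[OF x] by (simp add: product_prob_space_def product_prob_space_axioms_def product_sigma_finite_def prob_space_imp_sigma_finite)
    have "A = prod_emb UNIV (\<lambda>l. k l x) J (PiE J E)" unfolding A prod_emb_def by (simp add: p[OF x])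
    then show ?thesis using J p[OF x] by (simp add: emeasure_PiM_emb)
  qed
  moreover have "(\<lambda>x. \<Prod>l\<in>J. emeasure (k l x) (E l)) \<in> borel_measurable MX"
    using J measurable_emeasure_kernel[OF measurable_prob_algebraD[OF k]] by (intro borel_measurable_prod_ennreal) auto
  ultimately show "(\<lambda>x. emeasure (PiM UNIV (\<lambda>l. k l x)) A) \<in> borel_measurable MX"
    by (subst measurable_cong) auto
qed

text \<open>Any probability law can be enlarged by a sequence which is conditionally independent with
  prescribed conditional laws.\<close>
text \<open>Given a value of the law, the sequence is drawn from the product of the kernels at this value.\<close>
lemma exists_cond_indep_extension:
  fixes k :: "nat \<Rightarrow> 'x \<Rightarrow> 'y measure" and Q :: "'x measure"
  assumes Q: "prob_space Q" "sets Q = sets MX"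
    and k: "\<And>l. k l \<in> measurable MX (prob_algebra MY)"
  shows "\<exists>Q'. prob_space Q' \<and> sets Q' = sets (MX \<Otimes>\<^sub>M PiM UNIV (\<lambda>_. MY)) \<and>
    (\<forall>n F g. F \<in> borel_measurable MX \<longrightarrow> (\<forall>l<n. g l \<in> borel_measurable (MX \<Otimes>\<^sub>M MY)) \<longrightarrow>
      (\<integral>\<^sup>+q. F (fst q) * (\<Prod>l<n. g l (fst q, snd q l)) \<partial>Q') =
      (\<integral>\<^sup>+x. F x * (\<Prod>l<n. (\<integral>\<^sup>+y. g l (x, y) \<partial>k l x)) \<partial>Q))"
proof -
  note [measurable_cong] = Q(2)
  define PY where "PY = PiM UNIV (\<lambda>_ :: nat. MY)"
  define L where "L x = (PiM UNIV (\<lambda>l. k l x) \<bind> (\<lambda>y. return (MX \<Otimes>\<^sub>M PY) (x, y)))" for x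
  have pk [measurable]: "(\<lambda>x. PiM UNIV (\<lambda>l. k l x)) \<in> measurable MX (prob_algebra PY)"
    unfolding PY_def by (rule PiM_kernel_measurable[OF k])
  have Lm: "L \<in> measurable MX (prob_algebra (MX \<Otimes>\<^sub>M PY))"
    unfolding L_def by (rule measurable_bind_prob_space2[OF pk]) measurable
  have Qp: "Q \<in> space (prob_algebra MX)" using Q by (simp add: space_prob_algebra)
  define Q' where "Q' = Q \<bind> L"
  have p: "prob_space (k l x)" "sets (k l x) = sets MY" "space (k l x) = space MY" if "x \<in> space MX" for l x
    using measurable_space[OF k that, of l] by (auto simp: space_prob_algebra dest: sets_eq_imp_space_eq)
  have main: "(\<integral>\<^sup>+q. F (fst q) * (\<Prod>l<n. g l (fst q, snd q l)) \<partial>Q') =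
      (\<integral>\<^sup>+x. F x * (\<Prod>l<n. (\<integral>\<^sup>+y. g l (x, y) \<partial>k l x)) \<partial>Q)"
    if F [measurable]: "F \<in> borel_measurable MX" and g: "\<And>l. l < n \<Longrightarrow> g l \<in> borel_measurable (MX \<Otimes>\<^sub>M MY)" for n F g
  proof -
    have [measurable]: "g l \<in> borel_measurable (MX \<Otimes>\<^sub>M MY)" if "l \<in> {..<n}" for l using g that by simp
    have Hm [measurable]: "(\<lambda>q. F (fst q) * (\<Prod>l<n. g l (fst q, snd q l))) \<in> borel_measurable (MX \<Otimes>\<^sub>M PY)"
      unfolding PY_def by measurable
    have "(\<integral>\<^sup>+q. F (fst q) * (\<Prod>l<n. g l (fst q, snd q l)) \<partial>Q') =
       (\<integral>\<^sup>+x. (\<integral>\<^sup>+q. F (fst q) * (\<Prod>l<n. g l (fst q, snd q l)) \<partial>L x) \<partial>Q)"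
      unfolding Q'_def using measurable_prob_algebraD[OF Lm] Q(2)
      by (intro nn_integral_bind[OF Hm]) (simp cong: measurable_cong_sets)
    also have "\<dots> = (\<integral>\<^sup>+x. F x * (\<Prod>l<n. (\<integral>\<^sup>+y. g l (x, y) \<partial>k l x)) \<partial>Q)"
    proof (rule nn_integral_cong)
      fix x assume "x \<in> space Q"
      then have x [measurable]: "x \<in> space MX" using sets_eq_imp_space_eq[OF Q(2)] by simp
      interpret product_prob_space "\<lambda>l. k l x" UNIV
        using p[OF x] by (simp add: product_prob_space_def product_prob_space_axioms_def product_sigma_finite_def prob_space_imp_sigma_finite)
      have sPY: "sets (PiM UNIV (\<lambda>l. k l x)) = sets PY"
        unfolding PY_def by (rule sets_PiM_cong) (auto simp: p[OF x])
      have gx: "(\<lambda>y. g l (x, y)) \<in> borel_measurable (k l x)" if "l < n" for l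
        using measurable_compose[OF measurable_Pair1'[OF x] g[OF that]] p[OF x]
        by (simp cong: measurable_cong_sets)
      have ret: "(\<lambda>y. return (MX \<Otimes>\<^sub>M PY) (x, y)) \<in> measurable (PiM UNIV (\<lambda>l. k l x)) (subprob_algebra (MX \<Otimes>\<^sub>M PY))"
        using measurable_compose[OF measurable_Pair1'[OF x] return_measurable[of "MX \<Otimes>\<^sub>M PY"]] sPY
        by (simp cong: measurable_cong_sets)
      have "(\<integral>\<^sup>+q. F (fst q) * (\<Prod>l<n. g l (fst q, snd q l)) \<partial>L x) =
        (\<integral>\<^sup>+y. F x * (\<Prod>l<n. g l (x, y l)) \<partial>PiM UNIV (\<lambda>l. k l x))"
        unfolding L_def nn_integral_bind[OF Hm ret]
      proof (rule nn_integral_cong)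
        fix y assume "y \<in> space (PiM UNIV (\<lambda>l. k l x))"
        then have "(x, y) \<in> space (MX \<Otimes>\<^sub>M PY)" using x sets_eq_imp_space_eq[OF sPY] by (simp add: space_pair_measure)
        from nn_integral_return[OF this Hm]
        show "(\<integral>\<^sup>+q. F (fst q) * (\<Prod>l<n. g l (fst q, snd q l)) \<partial>return (MX \<Otimes>\<^sub>M PY) (x, y)) = F x * (\<Prod>l<n. g l (x, y l))"
          by simp
      qed
      also have "\<dots> = F x * (\<integral>\<^sup>+y. (\<Prod>l<n. g l (x, y l)) \<partial>PiM UNIV (\<lambda>l. k l x))"
      proof (rule nn_integral_cmult)
        show "(\<lambda>y. \<Prod>l<n. g l (x, y l)) \<in> borel_measurable (PiM UNIV (\<lambda>l. k l x))"
          using gx by (intro borel_measurable_prod_ennreal measurable_compose[OF measurable_component_singleton]) auto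
      qed
      also have "(\<integral>\<^sup>+y. (\<Prod>l<n. g l (x, y l)) \<partial>PiM UNIV (\<lambda>l. k l x)) =
        (\<integral>\<^sup>+y. (\<Prod>l<n. g l (x, y l)) \<partial>distr (PiM UNIV (\<lambda>l. k l x)) (PiM {..<n} (\<lambda>l. k l x)) (\<lambda>y. restrict y {..<n}))"
      proof -
        have 1: "(\<lambda>y. restrict y {..<n}) \<in> measurable (PiM UNIV (\<lambda>l. k l x)) (PiM {..<n} (\<lambda>l. k l x))"
          by (rule measurable_restrict_subset) auto
        have 2: "(\<lambda>y. \<Prod>l<n. g l (x, y l)) \<in> borel_measurable (PiM {..<n} (\<lambda>l. k l x))"
          using gx by (intro borel_measurable_prod_ennreal measurable_compose[OF measurable_component_singleton]) auto
        show ?thesis using 2 by (subst nn_integral_distr[OF 1]) simp_all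
      qed
      also have "\<dots> = (\<Prod>l<n. (\<integral>\<^sup>+y. g l (x, y) \<partial>k l x))"
        unfolding distr_PiM_restrict_finite[OF finite_lessThan subset_UNIV]
        using gx by (intro product_nn_integral_prod) auto
      finally show "(\<integral>\<^sup>+q. F (fst q) * (\<Prod>l<n. g l (fst q, snd q l)) \<partial>L x) = F x * (\<Prod>l<n. (\<integral>\<^sup>+y. g l (x, y) \<partial>k l x))" .
    qed
    finally show ?thesis .
  qed
  have "prob_space Q'" "sets Q' = sets (MX \<Otimes>\<^sub>M PiM UNIV (\<lambda>_. MY))"
    using prob_space_bind'[OF Qp Lm] sets_bind'[OF Qp Lm] by (auto simp: Q'_def PY_def)
  then show ?thesis using main by blast
qed

lemma nn_integral_N_law:
  "(\<integral>\<^sup>+k. g k \<partial>N_law \<alpha> m r) = (\<Sum>k=1..m. ennreal (N_prob \<alpha> m r k) * g k)"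
proof -
  have "(\<integral>\<^sup>+k. g k \<partial>N_law \<alpha> m r) = (\<integral>\<^sup>+k. ennreal (if k \<in> {1..m} then N_prob \<alpha> m r k else 0) * g k \<partial>count_space UNIV)"
    unfolding N_law_def by (subst nn_integral_density) auto
  also have "\<dots> = (\<Sum>k\<in>{1..m}. ennreal (if k \<in> {1..m} then N_prob \<alpha> m r k else 0) * g k)"
    by (rule nn_integral_count_space') auto
  also have "\<dots> = (\<Sum>k=1..m. ennreal (N_prob \<alpha> m r k) * g k)"
    by (intro sum.cong) auto
  finally show ?thesis .
qed

lemma sets_N_law [simp, measurable_cong]: "sets (N_law \<alpha> m r) = UNIV"
  by (simp add: N_law_def)

lemma emeasure_N_law:
  "emeasure (N_law \<alpha> m r) B = (\<Sum>k=1..m. ennreal (N_prob \<alpha> m r k) * indicator B k)"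
  unfolding nn_integral_N_law[symmetric] by simp

lemma N_prob_measurable:
  assumes "0 < \<alpha>" "\<alpha> < 1" "1 \<le> m"
  shows "(\<lambda>r. N_prob \<alpha> m r k) \<in> borel_measurable borel"
  unfolding N_prob_def using beta_moment_measurable[OF assms, measurable] by measurable

lemma emeasure_N_law_measurable:
  assumes "0 < \<alpha>" "\<alpha> < 1" "1 \<le> m"
  shows "(\<lambda>r. emeasure (N_law \<alpha> m r) B) \<in> borel_measurable borel"
  unfolding emeasure_N_law using N_prob_measurable[OF assms, measurable] by measurable

lemma prob_space_N_law:
  assumes "0 < \<alpha>" "\<alpha> < 1" "1 \<le> m" "0 < r" "r < 1"
  shows "prob_space (N_law \<alpha> m r)"
proof
  have "emeasure (N_law \<alpha> m r) (space (N_law \<alpha> m r)) = (\<Sum>k=1..m. ennreal (N_prob \<alpha> m r k))"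
    unfolding emeasure_N_law by (simp add: N_law_def)
  also have "\<dots> = ennreal (\<Sum>k=1..m. N_prob \<alpha> m r k)"
    using assms by (intro sum_ennreal) (auto intro!: N_prob_nonneg)
  finally show "emeasure (N_law \<alpha> m r) (space (N_law \<alpha> m r)) = 1" unfolding sum_N_prob[OF assms] by simp
qed

text \<open>In terms of random variables: a mixture over \<open>N\<close> of the images of Beta laws under \<open>W_of\<close> has the density
  \<open>W_density\<close>.\<close>
lemma emeasure_W_law_mixture:
  assumes "0 < \<alpha>" "\<alpha> < 1" "1 \<le> m" "0 < r" "r < 1" and B [measurable]: "B \<in> sets borel"
  shows "emeasure (W_law \<alpha> m r) B =
    (\<Sum>k=1..m. ennreal (N_prob \<alpha> m r k) * emeasure (distr (beta_law (real k - \<alpha>) \<alpha>) borel (\<lambda>b. W_of b r)) B)"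
proof -
  have [measurable]: "W_density \<alpha> m r \<in> borel_measurable borel" unfolding W_density_def by measurable
  have "emeasure (W_law \<alpha> m r) B = (\<integral>\<^sup>+w. ennreal (indicator {r<..<1} w * W_density \<alpha> m r w) * indicator B w \<partial>lborel)"
    unfolding W_law_def by (subst emeasure_density) auto
  also have "\<dots> = (\<integral>\<^sup>+w. (\<Sum>k=1..m. ennreal (N_prob \<alpha> m r k) * (ennreal (indicator {r<..<1} w * W_component_density \<alpha> k r w) * indicator B w)) \<partial>lborel)"
  proof (rule nn_integral_cong)
    fix w :: real
    show "ennreal (indicator {r<..<1} w * W_density \<alpha> m r w) * indicator B w =
      (\<Sum>k=1..m. ennreal (N_prob \<alpha> m r k) * (ennreal (indicator {r<..<1} w * W_component_density \<alpha> k r w) * indicator B w))"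
    proof (cases "w \<in> {r<..<1} \<inter> B")
      case True
      then have "ennreal (W_density \<alpha> m r w) = ennreal (\<Sum>k=1..m. N_prob \<alpha> m r k * W_component_density \<alpha> k r w)"
        using assms by (subst W_density_mixture) auto
      also have "\<dots> = (\<Sum>k=1..m. ennreal (N_prob \<alpha> m r k) * ennreal (W_component_density \<alpha> k r w))"
        using assms by (subst sum_ennreal[symmetric])
          (auto intro!: sum.cong ennreal_mult mult_nonneg_nonneg N_prob_nonneg W_component_density_nonneg)
      finally show ?thesis using True by simp
    qed auto
  qed
  also have "\<dots> = (\<Sum>k=1..m. (\<integral>\<^sup>+w. ennreal (N_prob \<alpha> m r k) * (ennreal (indicator {r<..<1} w * W_component_density \<alpha> k r w) * indicator B w) \<partial>lborel))"
    by (rule nn_integral_sum) measurable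
  also have "\<dots> = (\<Sum>k=1..m. ennreal (N_prob \<alpha> m r k) * emeasure (distr (beta_law (real k - \<alpha>) \<alpha>) borel (\<lambda>b. W_of b r)) B)"
  proof (rule sum.cong[OF refl])
    fix k assume "k \<in> {1..m}"
    then have k: "1 \<le> k" by simp
    show "(\<integral>\<^sup>+w. ennreal (N_prob \<alpha> m r k) * (ennreal (indicator {r<..<1} w * W_component_density \<alpha> k r w) * indicator B w) \<partial>lborel) =
      ennreal (N_prob \<alpha> m r k) * emeasure (distr (beta_law (real k - \<alpha>) \<alpha>) borel (\<lambda>b. W_of b r)) B"
      unfolding distr_W_of_beta_law[OF assms(1,2) k assms(4,5)]
      by (subst nn_integral_cmult) (auto simp: emeasure_density)
  qed
  finally show ?thesis .
qed

lemma emeasure_distr_W_of_measurable [measurable]: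
  assumes [measurable]: "B \<in> sets borel"
  shows "(\<lambda>r. emeasure (distr (beta_law a c) borel (\<lambda>b. W_of b r)) B) \<in> borel_measurable borel"
proof -
  have W [measurable]: "(\<lambda>b. W_of b r) \<in> borel_measurable borel" for r unfolding W_of_def by measurable
  have [measurable]: "(\<lambda>q. W_of (snd q) (fst q)) \<in> borel_measurable (borel \<Otimes>\<^sub>M borel)"
    unfolding W_of_def by measurable
  have "emeasure (distr (beta_law a c) borel (\<lambda>b. W_of b r)) B =
     (\<integral>\<^sup>+b. ennreal (indicator {0<..<1} b * (b powr (a - 1) * (1 - b) powr (c - 1) / Beta a c)) * indicator B (W_of b r) \<partial>lborel)" for r
  proof -
    have "(\<lambda>b. W_of b r) -` B \<in> sets borel" using measurable_sets[OF W] by simp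
    then show ?thesis unfolding beta_law_def
      by (subst emeasure_distr) (auto simp: emeasure_density intro!: nn_integral_cong split: split_indicator)
  qed
  then show ?thesis by simp
qed

section \<open>The sequences R, N and the Beta variables\<close>

lemma emeasure_R_law_measurable:
  assumes "0 < \<alpha>" "\<alpha> < 1" "1 \<le> m" and [measurable]: "B \<in> sets borel"
  shows "(\<lambda>l. emeasure (R_law \<alpha> m l) B) \<in> borel_measurable borel"
proof -
  note [measurable] = f_R_measurable[OF assms(1-3)] beta_moment_measurable[OF assms(1-3)]
  have [measurable]: "f_R \<alpha> m l \<in> borel_measurable borel" for l unfolding f_R_def f_R1_def by measurable
  have "emeasure (R_law \<alpha> m l) B = (\<integral>\<^sup>+r. ennreal (indicator {0<..<1} r * f_R \<alpha> m l r) * indicator B r \<partial>lborel)" for l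
    unfolding R_law_def by (subst emeasure_density) auto
  then show ?thesis by simp
qed

lemma R_chain_expectation_measurable:
  assumes "0 < \<alpha>" "\<alpha> < 1" "1 \<le> m" "\<And>l. \<phi> l \<in> borel_measurable borel"
  shows "R_chain_expectation \<alpha> m n \<phi> \<in> borel_measurable borel"
  using assms(4)
proof (induction n arbitrary: \<phi>)
  case (Suc n)
  note [measurable] = f_R_measurable[OF assms(1-3)] beta_moment_measurable[OF assms(1-3)]
  have [measurable]: "f_R \<alpha> m l \<in> borel_measurable borel" for l unfolding f_R_def f_R1_def by measurable
  have [measurable]: "\<phi> 0 \<in> borel_measurable borel" "R_chain_expectation \<alpha> m n (\<lambda>l. \<phi> (Suc l)) \<in> borel_measurable borel"
    using Suc by auto
  have "R_chain_expectation \<alpha> m (Suc n) \<phi> l = (\<integral>\<^sup>+r. ennreal (indicator {0<..<1} r * f_R \<alpha> m l r) *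
     (\<phi> 0 r * R_chain_expectation \<alpha> m n (\<lambda>l. \<phi> (Suc l)) (l / r)) \<partial>lborel)" for l
    unfolding R_law_def R_chain_expectation.simps by (subst nn_integral_density) auto
  then have "R_chain_expectation \<alpha> m (Suc n) \<phi> = (\<lambda>l. \<integral>\<^sup>+r. ennreal (indicator {0<..<1} r * f_R \<alpha> m l r) *
     (\<phi> 0 r * R_chain_expectation \<alpha> m n (\<lambda>l. \<phi> (Suc l)) (l / r)) \<partial>lborel)" by (rule ext)
  then show ?case by simp
qed (simp add: R_chain_expectation.simps(1)[abs_def])

lemma prob_space_W_law:
  assumes "0 < \<alpha>" "\<alpha> < 1" "1 \<le> m" "0 < r" "r < 1"
  shows "prob_space (W_law \<alpha> m r)"
proof
  have [measurable]: "(\<lambda>b. W_of b r) \<in> borel_measurable borel" unfolding W_of_def by measurable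
  have "emeasure (W_law \<alpha> m r) (space (W_law \<alpha> m r)) =
    (\<Sum>k=1..m. ennreal (N_prob \<alpha> m r k) * emeasure (distr (beta_law (real k - \<alpha>) \<alpha>) borel (\<lambda>b. W_of b r)) UNIV)"
    using emeasure_W_law_mixture[OF assms, of UNIV] by (simp add: W_law_def)
  also have "\<dots> = (\<Sum>k=1..m. ennreal (N_prob \<alpha> m r k))"
  proof (rule sum.cong[OF refl])
    fix k assume "k \<in> {1..m}"
    then interpret prob_space "distr (beta_law (real k - \<alpha>) \<alpha>) borel (\<lambda>b. W_of b r)"
      using assms by (intro prob_space.prob_space_distr prob_space_beta_law) auto
    show "ennreal (N_prob \<alpha> m r k) * emeasure (distr (beta_law (real k - \<alpha>) \<alpha>) borel (\<lambda>b. W_of b r)) UNIV = ennreal (N_prob \<alpha> m r k)"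
      using emeasure_space_1 by simp
  qed
  also have "\<dots> = 1"
    using prob_space.emeasure_space_1[OF prob_space_N_law[OF assms]] unfolding emeasure_N_law by (simp add: N_law_def)
  finally show "emeasure (W_law \<alpha> m r) (space (W_law \<alpha> m r)) = 1" .
qed

text \<open>With one pick and no condition on its ratio, \<open>size_biased_tilted_expectation\<close> compares the same moment with itself
  times the total mass of \<open>R_law\<close>.\<close>
lemma prob_space_R_law:
  assumes alpha: "0 < \<alpha>" "\<alpha> < 1" and m: "1 \<le> m" and f: "stable_density \<alpha> f"
    and tau: "stable_subordinator M \<alpha> \<tau>" and A: "ranked_jumps M \<tau> A"
    and S: "distributed M lborel (total_mass A) (\<lambda>t. ennreal (f t))"
    and lam: "0 < lam"
  shows "prob_space (R_law \<alpha> m lam)"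
proof
  define c where "c = stable_moment \<alpha> m lam"
  have c: "0 < c" unfolding c_def by (rule stable_moment_pos[OF alpha(1) f lam])
  have UNIV_borel: "UNIV \<in> sets (borel :: real measure)" for l :: nat by simp
  have "ennreal c = (\<integral>\<^sup>+\<omega>. ennreal (total_mass A \<omega> ^ m * exp (- (lam * total_mass A \<omega>))) * size_biased_prob 0 (\<lambda>_. UNIV) (\<lambda>k. A k \<omega>) \<partial>M)"
    unfolding size_biased_tilted_expectation[OF alpha m f tau A S lam UNIV_borel] c_def by simp
  also have "\<dots> = (\<integral>\<^sup>+\<omega>. ennreal (total_mass A \<omega> ^ m * exp (- (lam * total_mass A \<omega>))) * size_biased_prob (Suc 0) (\<lambda>_. UNIV) (\<lambda>k. A k \<omega>) \<partial>M)"
  proof (rule nn_integral_cong_AE)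
    show "AE \<omega> in M. ennreal (total_mass A \<omega> ^ m * exp (- (lam * total_mass A \<omega>))) * size_biased_prob 0 (\<lambda>_. UNIV) (\<lambda>k. A k \<omega>) =
      ennreal (total_mass A \<omega> ^ m * exp (- (lam * total_mass A \<omega>))) * size_biased_prob (Suc 0) (\<lambda>_. UNIV) (\<lambda>k. A k \<omega>)"
      using ranked_jumps_AE[OF tau A]
    proof eventually_elim
      case (elim \<omega>)
      define a where "a = (\<lambda>k. A k \<omega>)"
      have a: "summable a" "\<And>k. 0 < a k" "0 < suminf a"
        using elim by (auto simp: a_def intro!: suminf_pos)
      have "(\<Sum>j. ennreal (a j / suminf a)) = ennreal (\<Sum>j. a j / suminf a)"
        using a by (intro suminf_ennreal2 summable_divide) (auto intro: less_imp_le)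
      also have "(\<Sum>j. a j / suminf a) = 1" using a by (simp add: suminf_divide)
      finally have "size_biased_prob (Suc 0) (\<lambda>_. UNIV) a = 1" by simp
      then show ?case by (simp add: a_def)
    qed
  qed
  also have "\<dots> = ennreal c * R_chain_expectation \<alpha> m (Suc 0) (\<lambda>l r. emeasure (W_law \<alpha> m r) UNIV) lam"
    unfolding c_def by (rule size_biased_tilted_expectation[OF alpha m f tau A S lam]) simp
  also have "R_chain_expectation \<alpha> m (Suc 0) (\<lambda>l r. emeasure (W_law \<alpha> m r) UNIV) lam = (\<integral>\<^sup>+r. 1 \<partial>R_law \<alpha> m lam)"
    unfolding R_chain_expectation.simps
  proof (rule nn_integral_cong_AE)
    show "AE r in R_law \<alpha> m lam. emeasure (W_law \<alpha> m r) UNIV * 1 = 1"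
      using AE_R_law[OF alpha m, of lam]
    proof eventually_elim
      case (elim r)
      then show ?case using prob_space.emeasure_space_1[OF prob_space_W_law[OF alpha m, of r]] by (simp add: W_law_def)
    qed
  qed
  also have "\<dots> = emeasure (R_law \<alpha> m lam) (space (R_law \<alpha> m lam))" by simp
  finally have "ennreal (1 / c) * ennreal c = (ennreal (1 / c) * ennreal c) * emeasure (R_law \<alpha> m lam) (space (R_law \<alpha> m lam))"
    by (metis mult.assoc)
  then show "emeasure (R_law \<alpha> m lam) (space (R_law \<alpha> m lam)) = 1"
    using c by (simp add: ennreal_mult'[symmetric])
qed

text \<open>The sequences are built in three layers, each conditionally on the previous ones; the integral identities
  express these conditional laws in a form that can be iterated.\<close>
lemma exists_R_N_beta_sequences:
  assumes alpha: "0 < \<alpha>" "\<alpha> < 1" and m: "1 \<le> m" and lam: "0 < lam"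
    and Rp: "\<And>l. 0 < l \<Longrightarrow> prob_space (R_law \<alpha> m l)"
  obtains Q :: "(nat \<Rightarrow> real \<times> nat \<times> real) measure" and R N b where "prob_space Q"
    and "\<And>l. R l \<in> borel_measurable Q" and "\<And>l. N l \<in> measurable Q (count_space UNIV)" and "\<And>l. b l \<in> borel_measurable Q"
    and "AE \<omega> in Q. \<forall>l. 0 < R l \<omega> \<and> R l \<omega> < 1"
    and "\<And>n h. h \<in> borel_measurable (PiM {..<n} (\<lambda>_. borel) \<Otimes>\<^sub>M borel) \<Longrightarrow>
      (\<integral>\<^sup>+\<omega>. h (\<lambda>i\<in>{..<n}. R i \<omega>, R n \<omega>) \<partial>Q) =
      (\<integral>\<^sup>+\<omega>. (\<integral>\<^sup>+y. h (\<lambda>i\<in>{..<n}. R i \<omega>, y) \<partial>R_law \<alpha> m (lam / (\<Prod>i<n. R i \<omega>))) \<partial>Q)"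
    and "\<And>n F g. F \<in> borel_measurable real_seq \<Longrightarrow> (\<forall>l<n. g l \<in> borel_measurable (real_seq \<Otimes>\<^sub>M count_space UNIV)) \<Longrightarrow>
      (\<integral>\<^sup>+\<omega>. F (\<lambda>l. R l \<omega>) * (\<Prod>l<n. g l (\<lambda>l. R l \<omega>, N l \<omega>)) \<partial>Q) =
      (\<integral>\<^sup>+\<omega>. F (\<lambda>l. R l \<omega>) * (\<Prod>l<n. (\<integral>\<^sup>+k. g l (\<lambda>l. R l \<omega>, k) \<partial>N_law \<alpha> m (R l \<omega>))) \<partial>Q)"
    and "\<And>n F g. F \<in> borel_measurable (real_seq \<Otimes>\<^sub>M nat_seq) \<Longrightarrow> (\<forall>l<n. g l \<in> borel_measurable ((real_seq \<Otimes>\<^sub>M nat_seq) \<Otimes>\<^sub>M borel)) \<Longrightarrow>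
      (\<integral>\<^sup>+\<omega>. F (\<lambda>l. R l \<omega>, \<lambda>l. N l \<omega>) * (\<Prod>l<n. g l ((\<lambda>l. R l \<omega>, \<lambda>l. N l \<omega>), b l \<omega>)) \<partial>Q) =
      (\<integral>\<^sup>+\<omega>. F (\<lambda>l. R l \<omega>, \<lambda>l. N l \<omega>) * (\<Prod>l<n. (\<integral>\<^sup>+y. g l ((\<lambda>l. R l \<omega>, \<lambda>l. N l \<omega>), y) \<partial>beta_law (real (N l \<omega>) - \<alpha>) \<alpha>)) \<partial>Q)"
proof -
  \<comment> \<open>Outside the meaningful parameters the kernels are replaced by point masses, to be probability
    kernels everywhere. The value \<open>1/2\<close> in the first one keeps the chain inside the unit interval, and
    then almost surely none of the defaults is used.\<close>
  define RK where "RK l = (if 0 < l then R_law \<alpha> m l else return borel (1 / 2))" for l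
  define NK where "NK r = (if 0 < r \<and> r < 1 then N_law \<alpha> m r else return (count_space UNIV) 1)" for r
  define bK where "bK k = (if 1 \<le> k then beta_law (real k - \<alpha>) \<alpha> else return borel (1 / 2))" for k :: nat
  have RKm [measurable]: "RK \<in> measurable borel (prob_algebra borel)"
  proof (rule measurable_prob_algebraI)
    show pr: "prob_space (RK l)" for l unfolding RK_def using Rp by (auto intro: prob_space_return)
    show "RK \<in> measurable borel (subprob_algebra borel)"
    proof (rule measurable_subprob_algebra)
      fix B :: "real set" assume B [measurable]: "B \<in> sets borel"
      have "emeasure (RK l) B = (if 0 < l then emeasure (R_law \<alpha> m l) B else indicator B (1 / 2))" for l
        by (simp add: RK_def)
      then show "(\<lambda>l. emeasure (RK l) B) \<in> borel_measurable borel"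
        using emeasure_R_law_measurable[OF alpha m B, measurable] by simp
    next
      show "subprob_space (RK a)" for a by (rule prob_space_imp_subprob_space[OF pr])
      show "sets (RK a) = sets borel" for a by (simp add: RK_def)
    qed
  qed
  have NKm [measurable]: "NK \<in> measurable borel (prob_algebra (count_space UNIV))"
  proof (rule measurable_prob_algebraI)
    show pr: "prob_space (NK r)" for r unfolding NK_def using prob_space_N_law[OF alpha m] by (auto intro: prob_space_return)
    show "NK \<in> measurable borel (subprob_algebra (count_space UNIV))"
    proof (rule measurable_subprob_algebra)
      fix B :: "nat set"
      have "emeasure (NK r) B = (if 0 < r \<and> r < 1 then emeasure (N_law \<alpha> m r) B else indicator B 1)" for r
        by (simp add: NK_def)
      then show "(\<lambda>r. emeasure (NK r) B) \<in> borel_measurable borel"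
        using emeasure_N_law_measurable[OF alpha m, measurable] by simp
    next
      show "subprob_space (NK a)" for a by (rule prob_space_imp_subprob_space[OF pr])
      show "sets (NK a) = sets (count_space UNIV)" for a by (simp add: NK_def)
    qed
  qed
  have bKm [measurable]: "bK \<in> measurable (count_space UNIV) (prob_algebra borel)"
    unfolding measurable_count_space_eq1
  proof
    fix k :: nat
    have "prob_space (bK k)" unfolding bK_def using alpha by (auto intro!: prob_space_beta_law prob_space_return)
    moreover have "sets (bK k) = sets borel" by (simp add: bK_def)
    ultimately show "bK k \<in> space (prob_algebra borel)" by (simp add: space_prob_algebra)
  qed
  have "(\<lambda>x. RK (lam / (\<Prod>i<n. x i))) \<in> measurable (PiM {0..<n} (\<lambda>_. borel)) (prob_algebra borel)" for n :: nat
  proof -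
    have "(\<lambda>x. lam / (\<Prod>i<n. x i)) \<in> borel_measurable (PiM {0..<n} (\<lambda>_. borel))"
      by (intro borel_measurable_divide borel_measurable_const borel_measurable_prod measurable_component_singleton) auto
    from measurable_compose[OF this RKm] show ?thesis .
  qed
  from exists_markov_chain[of "\<lambda>n x. RK (lam / (\<Prod>i<n. x i))", OF this]
  obtain Q0 where Q0: "prob_space Q0" "sets Q0 = sets real_seq"
    and chain: "\<And>n h. h \<in> borel_measurable (PiM {0..<n} (\<lambda>_. borel) \<Otimes>\<^sub>M borel) \<Longrightarrow>
      (\<integral>\<^sup>+\<omega>. h (restrict \<omega> {0..<n}, \<omega> n) \<partial>Q0) =
      (\<integral>\<^sup>+\<omega>. (\<integral>\<^sup>+y. h (restrict \<omega> {0..<n}, y) \<partial>RK (lam / (\<Prod>i<n. restrict \<omega> {0..<n} i))) \<partial>Q0)"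
    by auto
  have chain': "(\<integral>\<^sup>+\<omega>. h (restrict \<omega> {..<n}, \<omega> n) \<partial>Q0) =
      (\<integral>\<^sup>+\<omega>. (\<integral>\<^sup>+y. h (restrict \<omega> {..<n}, y) \<partial>RK (lam / (\<Prod>i<n. \<omega> i))) \<partial>Q0)"
    if "h \<in> borel_measurable (PiM {..<n} (\<lambda>_. borel) \<Otimes>\<^sub>M borel)" for n h
    using chain[of h n] that by (simp add: lessThan_atLeast0)
  note [measurable_cong] = Q0(2)
  have AE0: "AE \<omega> in Q0. \<forall>n. 0 < \<omega> n \<and> \<omega> n < 1"
  proof -
    have "AE \<omega> in Q0. 0 < \<omega> n \<and> \<omega> n < 1" for n
    proof -
      define B where "B = - {0<..<1 :: real}"
      have Bm [measurable]: "B \<in> sets borel" by (simp add: B_def)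
      have RB: "emeasure (RK l) B = 0" for l
      proof (cases "0 < l")
        case True
        have "AE r in R_law \<alpha> m l. r \<notin> B" using AE_R_law[OF alpha m, of l] by eventually_elim (auto simp: B_def)
        then show ?thesis using True Bm by (subst (asm) AE_iff_null) (auto simp: RK_def null_sets_def R_law_def)
      qed (auto simp: RK_def B_def)
      have "(\<integral>\<^sup>+\<omega>. indicator B (\<omega> n) \<partial>Q0) = (\<integral>\<^sup>+\<omega>. (\<integral>\<^sup>+y. indicator B y \<partial>RK (lam / (\<Prod>i<n. \<omega> i))) \<partial>Q0)"
        using chain'[of "\<lambda>q. indicator B (snd q)" n] by simp
      also have "(\<lambda>\<omega>. (\<integral>\<^sup>+y. indicator B y \<partial>RK (lam / (\<Prod>i<n. \<omega> i)))) = (\<lambda>\<omega>. 0)"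
        using RB by (auto simp: fun_eq_iff RK_def)
      finally have "(\<integral>\<^sup>+\<omega>. indicator B (\<omega> n) \<partial>Q0) = 0" by simp
      then have "AE \<omega> in Q0. indicator B (\<omega> n) = (0 :: ennreal)"
        by (subst (asm) nn_integral_0_iff_AE) auto
      then show ?thesis by eventually_elim (auto simp: B_def indicator_def split: if_splits)
    qed
    then show ?thesis by (simp add: AE_all_countable)
  qed
  have "(\<lambda>r. NK (r l)) \<in> measurable real_seq (prob_algebra (count_space UNIV))" for l by measurable
  from exists_cond_indep_extension[OF Q0, of "\<lambda>l r. NK (r l)", OF this]
  obtain Q1 where Q1: "prob_space Q1" "sets Q1 = sets (real_seq \<Otimes>\<^sub>M nat_seq)"
    and ext1: "\<And>n F g. F \<in> borel_measurable real_seq \<Longrightarrow> (\<And>l. l < n \<Longrightarrow> g l \<in> borel_measurable (real_seq \<Otimes>\<^sub>M count_space UNIV)) \<Longrightarrow>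
      (\<integral>\<^sup>+q. F (fst q) * (\<Prod>l<n. g l (fst q, snd q l)) \<partial>Q1) = (\<integral>\<^sup>+x. F x * (\<Prod>l<n. (\<integral>\<^sup>+y. g l (x, y) \<partial>NK (x l))) \<partial>Q0)"
    by auto
  have "(\<lambda>q. bK (snd q l)) \<in> measurable (real_seq \<Otimes>\<^sub>M nat_seq) (prob_algebra borel)" for l by measurable
  from exists_cond_indep_extension[OF Q1, of "\<lambda>l q. bK (snd q l)", OF this]
  obtain Q2 where Q2: "prob_space Q2" "sets Q2 = sets ((real_seq \<Otimes>\<^sub>M nat_seq) \<Otimes>\<^sub>M real_seq)"
    and ext2: "\<And>n F g. F \<in> borel_measurable (real_seq \<Otimes>\<^sub>M nat_seq) \<Longrightarrow> (\<And>l. l < n \<Longrightarrow> g l \<in> borel_measurable ((real_seq \<Otimes>\<^sub>M nat_seq) \<Otimes>\<^sub>M borel)) \<Longrightarrow>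
      (\<integral>\<^sup>+q. F (fst q) * (\<Prod>l<n. g l (fst q, snd q l)) \<partial>Q2) = (\<integral>\<^sup>+x. F x * (\<Prod>l<n. (\<integral>\<^sup>+y. g l (x, y) \<partial>bK (snd x l))) \<partial>Q1)"
    by auto
  note [measurable_cong] = Q1(2) Q2(2)
  have marg1: "(\<integral>\<^sup>+q. F (fst q) \<partial>Q1) = (\<integral>\<^sup>+x. F x \<partial>Q0)" if "F \<in> borel_measurable real_seq" for F
    using ext1[of F 0] that by simp
  have marg2: "(\<integral>\<^sup>+q. F (fst q) \<partial>Q2) = (\<integral>\<^sup>+x. F x \<partial>Q1)" if "F \<in> borel_measurable (real_seq \<Otimes>\<^sub>M nat_seq)" for F
    using ext2[of F 0] that by simp
  define MZ where "MZ = PiM UNIV (\<lambda>_ :: nat. (borel :: real measure) \<Otimes>\<^sub>M (count_space (UNIV :: nat set) \<Otimes>\<^sub>M (borel :: real measure)))"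
  define zip3 where "zip3 q = (\<lambda>l. (fst (fst q) l, snd (fst q) l, snd q l))" for q :: "((nat \<Rightarrow> real) \<times> (nat \<Rightarrow> nat)) \<times> (nat \<Rightarrow> real)"
  have zm [measurable]: "zip3 \<in> measurable Q2 MZ"
    unfolding zip3_def MZ_def by (rule measurable_PiM_single') (auto simp: space_PiM space_pair_measure)
  define Q where "Q = distr Q2 MZ zip3"
  define R where "R l \<omega> = fst (\<omega> l)" for l and \<omega> :: "nat \<Rightarrow> real \<times> nat \<times> real"
  define N where "N l \<omega> = fst (snd (\<omega> l))" for l and \<omega> :: "nat \<Rightarrow> real \<times> nat \<times> real"
  define b where "b l \<omega> = snd (snd (\<omega> l))" for l and \<omega> :: "nat \<Rightarrow> real \<times> nat \<times> real"
  have sQ [measurable_cong]: "sets Q = sets MZ" by (simp add: Q_def)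
  have Rm [measurable]: "R l \<in> borel_measurable MZ" for l unfolding R_def MZ_def by measurable
  have Nm [measurable]: "N l \<in> measurable MZ (count_space UNIV)" for l unfolding N_def MZ_def by measurable
  have bm [measurable]: "b l \<in> borel_measurable MZ" for l unfolding b_def MZ_def by measurable
  have proj: "(\<lambda>l. R l (zip3 q)) = fst (fst q)" "(\<lambda>l. N l (zip3 q)) = snd (fst q)" "(\<lambda>l. b l (zip3 q)) = snd q" for q
    by (simp_all add: R_def N_def b_def zip3_def)
  have proj1: "R l (zip3 q) = fst (fst q) l" "N l (zip3 q) = snd (fst q) l" "b l (zip3 q) = snd q l" for q l
    by (simp_all add: R_def N_def b_def zip3_def)
  have Rseq [measurable]: "(\<lambda>\<omega> l. R l \<omega>) \<in> measurable MZ real_seq" by (rule measurable_PiM_single') auto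
  have Nseq [measurable]: "(\<lambda>\<omega> l. N l \<omega>) \<in> measurable MZ nat_seq" by (rule measurable_PiM_single') auto
  have G1: "(\<integral>\<^sup>+\<omega>. F (\<lambda>l. R l \<omega>, \<lambda>l. N l \<omega>) \<partial>Q) = (\<integral>\<^sup>+x. F x \<partial>Q1)"
    if [measurable]: "F \<in> borel_measurable (real_seq \<Otimes>\<^sub>M nat_seq)" for F
  proof -
    have "(\<integral>\<^sup>+\<omega>. F (\<lambda>l. R l \<omega>, \<lambda>l. N l \<omega>) \<partial>Q) = (\<integral>\<^sup>+q. F (fst q) \<partial>Q2)"
      unfolding Q_def by (subst nn_integral_distr, measurable) (simp add: proj)
    then show ?thesis using marg2[OF that] by simp
  qed
  have G0: "(\<integral>\<^sup>+\<omega>. F (\<lambda>l. R l \<omega>) \<partial>Q) = (\<integral>\<^sup>+x. F x \<partial>Q0)"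
    if [measurable]: "F \<in> borel_measurable real_seq" for F
    using G1[of "\<lambda>q. F (fst q)"] marg1[OF that] by simp
  have AER: "AE \<omega> in Q. \<forall>l. 0 < R l \<omega> \<and> R l \<omega> < 1"
  proof -
    have Bm [measurable]: "(\<lambda>x :: nat \<Rightarrow> real. if \<forall>l. 0 < x l \<and> x l < 1 then 0 else 1 :: ennreal) \<in> borel_measurable real_seq"
      by measurable
    have "(\<integral>\<^sup>+\<omega>. (if \<forall>l. 0 < R l \<omega> \<and> R l \<omega> < 1 then 0 else 1) \<partial>Q) = (\<integral>\<^sup>+x. (if \<forall>l. 0 < x l \<and> x l < 1 then 0 else 1) \<partial>Q0)"
      by (rule G0[OF Bm])
    also have "\<dots> = (\<integral>\<^sup>+x. 0 \<partial>Q0)"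
      by (rule nn_integral_cong_AE) (use AE0 in eventually_elim, simp)
    finally have "(\<integral>\<^sup>+\<omega>. (if \<forall>l. 0 < R l \<omega> \<and> R l \<omega> < 1 then 0 else 1) \<partial>Q) = 0" by simp
    then have "AE \<omega> in Q. (if \<forall>l. 0 < R l \<omega> \<and> R l \<omega> < 1 then 0 else 1) = (0 :: ennreal)"
      by (subst (asm) nn_integral_0_iff_AE) auto
    then show ?thesis by eventually_elim (auto split: if_splits)
  qed
  have AEN: "AE \<omega> in Q. \<forall>l. 1 \<le> N l \<omega>"
  proof -
    have "AE \<omega> in Q. 1 \<le> N l \<omega>" for l
    proof -
      \<comment> \<open>Only the coordinate \<open>l\<close> is tested; the factors of the earlier ones are one.\<close>
      define g where "g i = (\<lambda>q :: (nat \<Rightarrow> real) \<times> nat. if i = l \<and> snd q = 0 then 1 else if i = l then 0 else 1 :: ennreal)" for i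
      have gm [measurable]: "g i \<in> borel_measurable (real_seq \<Otimes>\<^sub>M count_space UNIV)" for i unfolding g_def by measurable
      have z: "(\<integral>\<^sup>+y. g l (x, y) \<partial>NK (x l)) = 0" for x
      proof (cases "0 < x l \<and> x l < 1")
        case True
        then show ?thesis by (simp add: NK_def nn_integral_N_law g_def)
      next
        case False
        then have "NK (x l) = return (count_space UNIV) 1" unfolding NK_def by (rule if_not_P)
        then show ?thesis by (simp add: g_def nn_integral_return)
      qed
      have "(\<integral>\<^sup>+q. (\<Prod>i<Suc l. g i (fst q, snd q i)) \<partial>Q1) = 0"
        using ext1[of "\<lambda>_. 1" "Suc l" g] z by simp
      moreover have "(\<Prod>i<l. g i (fst q, snd q i)) = 1" for q by (simp add: g_def)
      ultimately have "(\<integral>\<^sup>+q. g l (fst q, snd q l) \<partial>Q1) = 0" by simp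
      then have "(\<integral>\<^sup>+\<omega>. g l (\<lambda>l. R l \<omega>, N l \<omega>) \<partial>Q) = 0"
        using G1[of "\<lambda>q. g l (fst q, snd q l)"] by simp
      then have "AE \<omega> in Q. g l (\<lambda>l. R l \<omega>, N l \<omega>) = 0"
        by (subst (asm) nn_integral_0_iff_AE) auto
      then show ?thesis by eventually_elim (auto simp: g_def split: if_splits)
    qed
    then show ?thesis by (simp add: AE_all_countable)
  qed
  have c1: "(\<integral>\<^sup>+\<omega>. h (\<lambda>i\<in>{..<n}. R i \<omega>, R n \<omega>) \<partial>Q) =
      (\<integral>\<^sup>+\<omega>. (\<integral>\<^sup>+y. h (\<lambda>i\<in>{..<n}. R i \<omega>, y) \<partial>R_law \<alpha> m (lam / (\<Prod>i<n. R i \<omega>))) \<partial>Q)"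
    if h [measurable]: "h \<in> borel_measurable (PiM {..<n} (\<lambda>_. borel) \<Otimes>\<^sub>M borel)" for n h
  proof -
    have rm [measurable]: "(\<lambda>x. restrict x {..<n}) \<in> measurable real_seq (PiM {..<n} (\<lambda>_. borel :: real measure))"
      by (rule measurable_restrict_subset) auto
    have RKx: "(\<lambda>x. RK (lam / (\<Prod>i<n. x i))) \<in> measurable real_seq (subprob_algebra borel)"
    proof -
      have "(\<lambda>x. lam / (\<Prod>i<n. x i)) \<in> borel_measurable real_seq" by measurable
      from measurable_compose[OF this measurable_prob_algebraD[OF RKm]] show ?thesis .
    qed
    have "(\<integral>\<^sup>+\<omega>. h (restrict (\<lambda>i. R i \<omega>) {..<n}, R n \<omega>) \<partial>Q) = (\<integral>\<^sup>+x. h (restrict x {..<n}, x n) \<partial>Q0)"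
      by (rule G0[of "\<lambda>x. h (restrict x {..<n}, x n)"]) measurable
    also have "\<dots> = (\<integral>\<^sup>+x. (\<integral>\<^sup>+y. h (restrict x {..<n}, y) \<partial>RK (lam / (\<Prod>i<n. x i))) \<partial>Q0)"
      by (rule chain'[OF h])
    also have "\<dots> = (\<integral>\<^sup>+\<omega>. (\<integral>\<^sup>+y. h (restrict (\<lambda>i. R i \<omega>) {..<n}, y) \<partial>RK (lam / (\<Prod>i<n. R i \<omega>))) \<partial>Q)"
    proof (rule G0[symmetric])
      show "(\<lambda>x. \<integral>\<^sup>+y. h (restrict x {..<n}, y) \<partial>RK (lam / (\<Prod>i<n. x i))) \<in> borel_measurable real_seq"
        by (rule nn_integral_measurable_subprob_algebra2[OF _ RKx]) measurable
    qed
    also have "\<dots> = (\<integral>\<^sup>+\<omega>. (\<integral>\<^sup>+y. h (restrict (\<lambda>i. R i \<omega>) {..<n}, y) \<partial>R_law \<alpha> m (lam / (\<Prod>i<n. R i \<omega>))) \<partial>Q)"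
    proof (rule nn_integral_cong_AE)
      show "AE \<omega> in Q. (\<integral>\<^sup>+y. h (restrict (\<lambda>i. R i \<omega>) {..<n}, y) \<partial>RK (lam / (\<Prod>i<n. R i \<omega>))) =
        (\<integral>\<^sup>+y. h (restrict (\<lambda>i. R i \<omega>) {..<n}, y) \<partial>R_law \<alpha> m (lam / (\<Prod>i<n. R i \<omega>)))"
        using AER
      proof eventually_elim
        case (elim \<omega>)
        then have "0 < lam / (\<Prod>i<n. R i \<omega>)" using lam by (intro divide_pos_pos prod_pos) auto
        then show ?case by (simp add: RK_def)
      qed
    qed
    finally show ?thesis .
  qed
  have c2: "(\<integral>\<^sup>+\<omega>. F (\<lambda>l. R l \<omega>) * (\<Prod>l<n. g l (\<lambda>l. R l \<omega>, N l \<omega>)) \<partial>Q) =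
      (\<integral>\<^sup>+\<omega>. F (\<lambda>l. R l \<omega>) * (\<Prod>l<n. (\<integral>\<^sup>+k. g l (\<lambda>l. R l \<omega>, k) \<partial>N_law \<alpha> m (R l \<omega>))) \<partial>Q)"
    if F [measurable]: "F \<in> borel_measurable real_seq" and g: "\<forall>l<n. g l \<in> borel_measurable (real_seq \<Otimes>\<^sub>M count_space UNIV)" for n F g
  proof -
    have [measurable]: "g l \<in> borel_measurable (real_seq \<Otimes>\<^sub>M count_space UNIV)" if "l \<in> {..<n}" for l using g that by simp
    have "(\<integral>\<^sup>+\<omega>. F (\<lambda>l. R l \<omega>) * (\<Prod>l<n. g l (\<lambda>l. R l \<omega>, N l \<omega>)) \<partial>Q) = (\<integral>\<^sup>+q. F (fst q) * (\<Prod>l<n. g l (fst q, snd q l)) \<partial>Q1)"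
      using G1[of "\<lambda>q. F (fst q) * (\<Prod>l<n. g l (fst q, snd q l))"] by simp
    also have "\<dots> = (\<integral>\<^sup>+x. F x * (\<Prod>l<n. (\<integral>\<^sup>+y. g l (x, y) \<partial>NK (x l))) \<partial>Q0)"
      using g by (intro ext1) auto
    also have "\<dots> = (\<integral>\<^sup>+\<omega>. F (\<lambda>l. R l \<omega>) * (\<Prod>l<n. (\<integral>\<^sup>+k. g l (\<lambda>l. R l \<omega>, k) \<partial>NK (R l \<omega>))) \<partial>Q)"
    proof (rule G0[symmetric])
      have "(\<lambda>x. \<integral>\<^sup>+k. g l (x, k) \<partial>NK (x l)) \<in> borel_measurable real_seq" if "l < n" for l
      proof (rule nn_integral_measurable_subprob_algebra2[where N = "count_space UNIV"])
        show "(\<lambda>x. NK (x l)) \<in> measurable real_seq (subprob_algebra (count_space UNIV))"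
          using measurable_prob_algebraD[OF NKm, measurable] by measurable
      qed (use g that in auto)
      then show "(\<lambda>x. F x * (\<Prod>l<n. \<integral>\<^sup>+y. g l (x, y) \<partial>NK (x l))) \<in> borel_measurable real_seq"
        by (intro borel_measurable_times_ennreal F borel_measurable_prod_ennreal) auto
    qed
    also have "\<dots> = (\<integral>\<^sup>+\<omega>. F (\<lambda>l. R l \<omega>) * (\<Prod>l<n. (\<integral>\<^sup>+k. g l (\<lambda>l. R l \<omega>, k) \<partial>N_law \<alpha> m (R l \<omega>))) \<partial>Q)"
      by (rule nn_integral_cong_AE) (use AER in eventually_elim, simp add: NK_def)
    finally show ?thesis .
  qed
  have c3: "(\<integral>\<^sup>+\<omega>. F (\<lambda>l. R l \<omega>, \<lambda>l. N l \<omega>) * (\<Prod>l<n. g l ((\<lambda>l. R l \<omega>, \<lambda>l. N l \<omega>), b l \<omega>)) \<partial>Q) =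
      (\<integral>\<^sup>+\<omega>. F (\<lambda>l. R l \<omega>, \<lambda>l. N l \<omega>) * (\<Prod>l<n. (\<integral>\<^sup>+y. g l ((\<lambda>l. R l \<omega>, \<lambda>l. N l \<omega>), y) \<partial>beta_law (real (N l \<omega>) - \<alpha>) \<alpha>)) \<partial>Q)"
    if F [measurable]: "F \<in> borel_measurable (real_seq \<Otimes>\<^sub>M nat_seq)" and g: "\<forall>l<n. g l \<in> borel_measurable ((real_seq \<Otimes>\<^sub>M nat_seq) \<Otimes>\<^sub>M borel)" for n F g
  proof -
    have [measurable]: "g l \<in> borel_measurable ((real_seq \<Otimes>\<^sub>M nat_seq) \<Otimes>\<^sub>M borel)" if "l \<in> {..<n}" for l using g that by simp
    have "(\<integral>\<^sup>+\<omega>. F (\<lambda>l. R l \<omega>, \<lambda>l. N l \<omega>) * (\<Prod>l<n. g l ((\<lambda>l. R l \<omega>, \<lambda>l. N l \<omega>), b l \<omega>)) \<partial>Q) =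
       (\<integral>\<^sup>+q. F (fst q) * (\<Prod>l<n. g l (fst q, snd q l)) \<partial>Q2)"
      unfolding Q_def by (subst nn_integral_distr, measurable) (simp add: proj proj1)
    also have "\<dots> = (\<integral>\<^sup>+x. F x * (\<Prod>l<n. (\<integral>\<^sup>+y. g l (x, y) \<partial>bK (snd x l))) \<partial>Q1)"
      using g by (intro ext2) auto
    also have "\<dots> = (\<integral>\<^sup>+\<omega>. F (\<lambda>l. R l \<omega>, \<lambda>l. N l \<omega>) * (\<Prod>l<n. (\<integral>\<^sup>+y. g l ((\<lambda>l. R l \<omega>, \<lambda>l. N l \<omega>), y) \<partial>bK (N l \<omega>))) \<partial>Q)"
    proof -
      have "(\<lambda>x. \<integral>\<^sup>+y. g l (x, y) \<partial>bK (snd x l)) \<in> borel_measurable (real_seq \<Otimes>\<^sub>M nat_seq)" if "l < n" for l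
      proof (rule nn_integral_measurable_subprob_algebra2[where N = borel])
        show "(\<lambda>x. bK (snd x l)) \<in> measurable (real_seq \<Otimes>\<^sub>M nat_seq) (subprob_algebra borel)"
          using measurable_prob_algebraD[OF bKm, measurable] by measurable
      qed (use g that in auto)
      then have "(\<lambda>x. F x * (\<Prod>l<n. \<integral>\<^sup>+y. g l (x, y) \<partial>bK (snd x l))) \<in> borel_measurable (real_seq \<Otimes>\<^sub>M nat_seq)"
        by (intro borel_measurable_times_ennreal F borel_measurable_prod_ennreal) auto
      from G1[OF this] show ?thesis by simp
    qed
    also have "\<dots> = (\<integral>\<^sup>+\<omega>. F (\<lambda>l. R l \<omega>, \<lambda>l. N l \<omega>) * (\<Prod>l<n. (\<integral>\<^sup>+y. g l ((\<lambda>l. R l \<omega>, \<lambda>l. N l \<omega>), y) \<partial>beta_law (real (N l \<omega>) - \<alpha>) \<alpha>)) \<partial>Q)"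
      by (rule nn_integral_cong_AE) (use AEN in eventually_elim, simp add: bK_def)
    finally show ?thesis .
  qed
  have pQ: "prob_space Q" unfolding Q_def by (rule prob_space.prob_space_distr[OF Q2(1) zm])
  have RNb: "R l \<in> borel_measurable Q" "N l \<in> measurable Q (count_space UNIV)" "b l \<in> borel_measurable Q" for l
    by measurable
  show thesis by (rule that[OF pQ RNb AER c1 c2 c3])
qed

section \<open>The representation of the size-biased sequence\<close>

lemma cond_indep_lawsI:
  assumes X [measurable]: "X \<in> measurable M MX" and Y [measurable]: "\<And>l. Y l \<in> measurable M MY"
    and K: "\<And>l B. B \<in> sets MY \<Longrightarrow> (\<lambda>\<omega>. emeasure (K l (X \<omega>)) B) \<in> borel_measurable M"
    and eq: "\<And>n A B. A \<in> sets MX \<Longrightarrow> (\<And>l. B l \<in> sets MY) \<Longrightarrow>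
      (\<integral>\<^sup>+\<omega>. indicator A (X \<omega>) * (\<Prod>l<n. indicator (B l) (Y l \<omega>)) \<partial>M) =
      (\<integral>\<^sup>+\<omega>. indicator A (X \<omega>) * (\<Prod>l<n. emeasure (K l (X \<omega>)) (B l)) \<partial>M)"
  shows "cond_indep_laws M X MX K Y MY"
  unfolding cond_indep_laws_def
proof (intro conjI allI ballI impI)
  fix n A and B :: "nat \<Rightarrow> 'c set"
  assume A [measurable]: "A \<in> sets MX" and B: "\<forall>l. B l \<in> sets MY"
  then have [measurable]: "B l \<in> sets MY" for l by simp
  have "{\<omega>\<in>space M. X \<omega> \<in> A \<and> (\<forall>l\<in>{..<n}. Y l \<omega> \<in> B l)} \<in> sets M" by measurable
  then have ms: "{\<omega>\<in>space M. X \<omega> \<in> A \<and> (\<forall>l<n. Y l \<omega> \<in> B l)} \<in> sets M" by (simp add: Ball_def)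
  have "emeasure M {\<omega>\<in>space M. X \<omega> \<in> A \<and> (\<forall>l<n. Y l \<omega> \<in> B l)} =
    (\<integral>\<^sup>+\<omega>. indicator A (X \<omega>) * (\<Prod>l<n. indicator (B l) (Y l \<omega>)) \<partial>M)"
    unfolding nn_integral_indicator[OF ms, symmetric]
    by (intro nn_integral_cong) (auto simp: indicator_def prod_eq_1_iff)
  also have "\<dots> = (\<integral>\<^sup>+\<omega>. indicator A (X \<omega>) * (\<Prod>l<n. emeasure (K l (X \<omega>)) (B l)) \<partial>M)"
    using A B by (intro eq) auto
  finally show "emeasure M {\<omega>\<in>space M. X \<omega> \<in> A \<and> (\<forall>l<n. Y l \<omega> \<in> B l)} =
    (\<integral>\<^sup>+\<omega>. indicator A (X \<omega>) * (\<Prod>l<n. emeasure (K l (X \<omega>)) (B l)) \<partial>M)" .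
qed (use X Y K in auto)

lemma cond_lawI:
  assumes X [measurable]: "X \<in> measurable M MX" and Y [measurable]: "Y \<in> measurable M MY"
    and K: "\<And>B. B \<in> sets MY \<Longrightarrow> (\<lambda>\<omega>. emeasure (K (X \<omega>)) B) \<in> borel_measurable M"
    and eq: "\<And>A B. A \<in> sets MX \<Longrightarrow> B \<in> sets MY \<Longrightarrow>
      (\<integral>\<^sup>+\<omega>. indicator A (X \<omega>) * indicator B (Y \<omega>) \<partial>M) =
      (\<integral>\<^sup>+\<omega>. indicator A (X \<omega>) * emeasure (K (X \<omega>)) B \<partial>M)"
  shows "cond_law M X MX K Y MY"
  unfolding cond_law_def
proof (intro conjI ballI)
  fix A B assume A [measurable]: "A \<in> sets MX" and B [measurable]: "B \<in> sets MY"
  have ms: "{\<omega>\<in>space M. X \<omega> \<in> A \<and> Y \<omega> \<in> B} \<in> sets M" by measurable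
  have "emeasure M {\<omega>\<in>space M. X \<omega> \<in> A \<and> Y \<omega> \<in> B} = (\<integral>\<^sup>+\<omega>. indicator A (X \<omega>) * indicator B (Y \<omega>) \<partial>M)"
    unfolding nn_integral_indicator[OF ms, symmetric]
    by (intro nn_integral_cong) (auto simp: indicator_def)
  then show "emeasure M {\<omega>\<in>space M. X \<omega> \<in> A \<and> Y \<omega> \<in> B} = (\<integral>\<^sup>+\<omega>. indicator A (X \<omega>) * emeasure (K (X \<omega>)) B \<partial>M)"
    using eq[OF A B] by simp
qed (use X Y K in auto)

text \<open>The functional on the right peels off values of the chain from the front, whereas the chain is described by its last step;
  the two are matched by moving factors across one at a time.\<close>
lemma R_chain_expectation_eq:
  assumes alpha: "0 < \<alpha>" "\<alpha> < 1" "1 \<le> m"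
    and R [measurable]: "\<And>l. R l \<in> borel_measurable Q"
    and chain: "\<And>n h. h \<in> borel_measurable (PiM {..<n} (\<lambda>_. borel) \<Otimes>\<^sub>M borel) \<Longrightarrow>
      (\<integral>\<^sup>+\<omega>. h (\<lambda>i\<in>{..<n}. R i \<omega>, R n \<omega>) \<partial>Q) =
      (\<integral>\<^sup>+\<omega>. (\<integral>\<^sup>+y. h (\<lambda>i\<in>{..<n}. R i \<omega>, y) \<partial>R_law \<alpha> m (lam / (\<Prod>i<n. R i \<omega>))) \<partial>Q)"
    and Q: "prob_space Q" and \<phi> [measurable]: "\<And>l. \<phi> l \<in> borel_measurable borel"
  shows "(\<integral>\<^sup>+\<omega>. (\<Prod>l<k. \<phi> l (R l \<omega>)) * R_chain_expectation \<alpha> m n (\<lambda>l. \<phi> (l + k)) (lam / (\<Prod>i<k. R i \<omega>)) \<partial>Q) =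
    R_chain_expectation \<alpha> m (n + k) \<phi> lam"
proof (induction k arbitrary: n)
  case 0
  interpret prob_space Q by fact
  show ?case by (simp add: emeasure_space_1)
next
  case (Suc k)
  define \<psi> where "\<psi> = R_chain_expectation \<alpha> m n (\<lambda>l. \<phi> (l + Suc k))"
  have [measurable]: "\<psi> \<in> borel_measurable borel"
    unfolding \<psi>_def by (rule R_chain_expectation_measurable[OF alpha]) simp
  define h where "h q = (\<Prod>l<k. \<phi> l (fst q l)) * (\<phi> k (snd q) * \<psi> (lam / (\<Prod>i<k. fst q i) / snd q))" for q :: "(nat \<Rightarrow> real) \<times> real"
  have hm: "h \<in> borel_measurable (PiM {..<k} (\<lambda>_. borel) \<Otimes>\<^sub>M borel)"
  proof -
    have [measurable]: "(\<lambda>q. fst q l) \<in> borel_measurable (PiM {..<k} (\<lambda>_. borel) \<Otimes>\<^sub>M (borel :: real measure))" if "l \<in> {..<k}" for l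
      by (rule measurable_compose[OF measurable_fst measurable_component_singleton[OF that]])
    show ?thesis unfolding h_def by measurable
  qed
  have "(\<integral>\<^sup>+\<omega>. (\<Prod>l<Suc k. \<phi> l (R l \<omega>)) * R_chain_expectation \<alpha> m n (\<lambda>l. \<phi> (l + Suc k)) (lam / (\<Prod>i<Suc k. R i \<omega>)) \<partial>Q) =
    (\<integral>\<^sup>+\<omega>. h (\<lambda>i\<in>{..<k}. R i \<omega>, R k \<omega>) \<partial>Q)"
    by (simp add: h_def \<psi>_def mult.assoc)
  also have "\<dots> = (\<integral>\<^sup>+\<omega>. (\<integral>\<^sup>+y. h (\<lambda>i\<in>{..<k}. R i \<omega>, y) \<partial>R_law \<alpha> m (lam / (\<Prod>i<k. R i \<omega>))) \<partial>Q)"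
    by (rule chain[OF hm])
  also have "\<dots> = (\<integral>\<^sup>+\<omega>. (\<Prod>l<k. \<phi> l (R l \<omega>)) * R_chain_expectation \<alpha> m (Suc n) (\<lambda>l. \<phi> (l + k)) (lam / (\<Prod>i<k. R i \<omega>)) \<partial>Q)"
  proof (rule nn_integral_cong)
    fix \<omega>
    have "(\<integral>\<^sup>+y. h (\<lambda>i\<in>{..<k}. R i \<omega>, y) \<partial>R_law \<alpha> m (lam / (\<Prod>i<k. R i \<omega>))) =
      (\<integral>\<^sup>+y. (\<Prod>l<k. \<phi> l (R l \<omega>)) * (\<phi> k y * \<psi> (lam / (\<Prod>i<k. R i \<omega>) / y)) \<partial>R_law \<alpha> m (lam / (\<Prod>i<k. R i \<omega>)))"
      by (simp add: h_def)
    also have "\<dots> = (\<Prod>l<k. \<phi> l (R l \<omega>)) * (\<integral>\<^sup>+y. \<phi> k y * \<psi> (lam / (\<Prod>i<k. R i \<omega>) / y) \<partial>R_law \<alpha> m (lam / (\<Prod>i<k. R i \<omega>)))"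
      by (rule nn_integral_cmult) measurable
    finally show "(\<integral>\<^sup>+y. h (\<lambda>i\<in>{..<k}. R i \<omega>, y) \<partial>R_law \<alpha> m (lam / (\<Prod>i<k. R i \<omega>))) =
      (\<Prod>l<k. \<phi> l (R l \<omega>)) * R_chain_expectation \<alpha> m (Suc n) (\<lambda>l. \<phi> (l + k)) (lam / (\<Prod>i<k. R i \<omega>))"
      by (simp add: \<psi>_def)
  qed
  also have "\<dots> = R_chain_expectation \<alpha> m (Suc n + k) \<phi> lam" by (rule Suc.IH)
  finally show ?case by simp
qed

lemma distr_eqI_of_cylinders:
  fixes W :: "nat \<Rightarrow> 'a \<Rightarrow> real" and W' :: "nat \<Rightarrow> 'b \<Rightarrow> real"
  assumes M: "prob_space M" and [measurable]: "\<And>l. W l \<in> borel_measurable M" "\<And>l. W' l \<in> borel_measurable M'"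
    and eq: "\<And>n B. (\<And>l. B l \<in> sets borel) \<Longrightarrow> emeasure M {\<omega>\<in>space M. \<forall>l<n. W l \<omega> \<in> B l} = emeasure M' {\<omega>\<in>space M'. \<forall>l<n. W' l \<omega> \<in> B l}"
  shows "distr M real_seq (\<lambda>\<omega> l. W l \<omega>) = distr M' real_seq (\<lambda>\<omega> l. W' l \<omega>)"
proof (rule real_seq_measure_eqI)
  have Wm: "(\<lambda>\<omega> l. W l \<omega>) \<in> measurable M real_seq" "(\<lambda>\<omega> l. W' l \<omega>) \<in> measurable M' real_seq"
    by (auto intro!: measurable_PiM_single')
  have "{a :: nat \<Rightarrow> real. \<forall>l<n. c l < a l} \<in> sets real_seq" for n c
    unfolding halfspace_cylinders_generate_real_seq by (intro sigma_sets.Basic) blast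
  then show "emeasure (distr M real_seq (\<lambda>\<omega> l. W l \<omega>)) {a. \<forall>l<n. c l < a l} = emeasure (distr M' real_seq (\<lambda>\<omega> l. W' l \<omega>)) {a. \<forall>l<n. c l < a l}" for n c
    using eq[of "\<lambda>l. {c l<..}" n] by (simp add: emeasure_distr[OF Wm(1)] emeasure_distr[OF Wm(2)] vimage_def Int_def conj_commute)
  interpret D: prob_space "distr M real_seq (\<lambda>\<omega> l. W l \<omega>)" by (rule prob_space.prob_space_distr[OF M Wm(1)])
  show "emeasure (distr M real_seq (\<lambda>\<omega> l. W l \<omega>)) UNIV \<noteq> \<infinity>"
    using D.emeasure_space_1 by (simp add: space_PiM)
qed simp_all

theorem theorem4p1:
  fixes \<alpha> lam :: real and m :: nat and f :: "real \<Rightarrow> real"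
    and M :: "'a measure" and \<tau> :: "real \<Rightarrow> 'a \<Rightarrow> real" and A :: "nat \<Rightarrow> 'a \<Rightarrow> real"
    and \<kappa> :: "real \<Rightarrow> (nat \<Rightarrow> real) measure"
    and M' :: "'b measure" and P :: "nat \<Rightarrow> 'b \<Rightarrow> real" and \<sigma> :: "nat \<Rightarrow> 'b \<Rightarrow> nat"
  assumes alpha: "0 < \<alpha>" "\<alpha> < 1" and lam: "0 < lam" and m: "1 \<le> m"
    and f: "stable_density \<alpha> f"
    and tau: "stable_subordinator M \<alpha> \<tau>"
    and A: "ranked_jumps M \<tau> A"
    and S: "distributed M lborel (total_mass A) (\<lambda>t. ennreal (f t))"
    and kappa: "PD_given M A \<kappa>"
    and M': "prob_space M'"
    and P: "\<And>l. P l \<in> borel_measurable M'"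
      "distr M' real_seq (\<lambda>\<omega> l. P l \<omega>) = PD_tilted f \<kappa> m lam"
    and sigma: "size_biased_sampling M' P \<sigma>"
  shows "\<exists>(Q :: (nat \<Rightarrow> real \<times> nat \<times> real) measure) R N b W.
    prob_space Q \<and>
    RN_sequence Q \<alpha> m lam R N \<and>
    distr M' real_seq (\<lambda>\<omega> k. P (\<sigma> k \<omega>) \<omega>) =
      distr Q real_seq (\<lambda>\<omega> k. (1 - W k \<omega>) * (\<Prod>l<k. W l \<omega>)) \<and>
    \<comment> \<open>(i)\<close>
    cond_indep_laws Q (\<lambda>\<omega> l. R l \<omega>) real_seq
      (\<lambda>l r. density lborel (\<lambda>w. ennreal (indicator {r l<..<1} w * W_density \<alpha> m (r l) w)))
      W borel \<and>
    \<comment> \<open>(ii)\<close>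
    (\<forall>r\<in>{0<..<1}. \<forall>w\<in>{r<..<1}.
      W_density \<alpha> m r w = (\<Sum>k=1..m. N_prob \<alpha> m r k * W_component_density \<alpha> k r w)) \<and>
    cond_law Q (\<lambda>\<omega>. (R 0 \<omega>, N 0 \<omega>)) (borel \<Otimes>\<^sub>M count_space UNIV)
      (\<lambda>(r, k). distr (beta_law (real k - \<alpha>) \<alpha>) borel (\<lambda>b. W_of b r)) (W 0) borel \<and>
    (\<forall>r\<in>{0<..<1}. \<forall>k\<in>{1..m}.
      distr (beta_law (real k - \<alpha>) \<alpha>) borel (\<lambda>b. W_of b r) =
      density lborel (\<lambda>w. ennreal (indicator {r<..<1} w * W_component_density \<alpha> k r w))) \<and>
    \<comment> \<open>(iii)\<close>
    cond_indep_laws Q (\<lambda>\<omega>. (\<lambda>l. R l \<omega>, \<lambda>l. N l \<omega>)) (real_seq \<Otimes>\<^sub>M nat_seq)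
      (\<lambda>l (r, n). beta_law (real (n l) - \<alpha>) \<alpha>) b borel \<and>
    (\<forall>l. \<forall>\<omega>\<in>space Q. W l \<omega> = W_of (b l \<omega>) (R l \<omega>))"
proof -
  have Rp: "prob_space (R_law \<alpha> m l)" if "0 < l" for l
    by (rule prob_space_R_law[OF alpha m f tau A S that])
  obtain Q :: "(nat \<Rightarrow> real \<times> nat \<times> real) measure" and R N b where Q: "prob_space Q"
    and Rm [measurable]: "\<And>l. R l \<in> borel_measurable Q" and Nm [measurable]: "\<And>l. N l \<in> measurable Q (count_space UNIV)"
    and bm [measurable]: "\<And>l. b l \<in> borel_measurable Q"
    and AER: "AE \<omega> in Q. \<forall>l. 0 < R l \<omega> \<and> R l \<omega> < 1"
    and chain: "\<And>n h. h \<in> borel_measurable (PiM {..<n} (\<lambda>_. borel) \<Otimes>\<^sub>M borel) \<Longrightarrow>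
      (\<integral>\<^sup>+\<omega>. h (\<lambda>i\<in>{..<n}. R i \<omega>, R n \<omega>) \<partial>Q) =
      (\<integral>\<^sup>+\<omega>. (\<integral>\<^sup>+y. h (\<lambda>i\<in>{..<n}. R i \<omega>, y) \<partial>R_law \<alpha> m (lam / (\<Prod>i<n. R i \<omega>))) \<partial>Q)"
    and N_given_R: "\<And>n F g. F \<in> borel_measurable real_seq \<Longrightarrow> (\<forall>l<n. g l \<in> borel_measurable (real_seq \<Otimes>\<^sub>M count_space UNIV)) \<Longrightarrow>
      (\<integral>\<^sup>+\<omega>. F (\<lambda>l. R l \<omega>) * (\<Prod>l<n. g l (\<lambda>l. R l \<omega>, N l \<omega>)) \<partial>Q) =
      (\<integral>\<^sup>+\<omega>. F (\<lambda>l. R l \<omega>) * (\<Prod>l<n. (\<integral>\<^sup>+k. g l (\<lambda>l. R l \<omega>, k) \<partial>N_law \<alpha> m (R l \<omega>))) \<partial>Q)"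
    and b_given_RN: "\<And>n F g. F \<in> borel_measurable (real_seq \<Otimes>\<^sub>M nat_seq) \<Longrightarrow> (\<forall>l<n. g l \<in> borel_measurable ((real_seq \<Otimes>\<^sub>M nat_seq) \<Otimes>\<^sub>M borel)) \<Longrightarrow>
      (\<integral>\<^sup>+\<omega>. F (\<lambda>l. R l \<omega>, \<lambda>l. N l \<omega>) * (\<Prod>l<n. g l ((\<lambda>l. R l \<omega>, \<lambda>l. N l \<omega>), b l \<omega>)) \<partial>Q) =
      (\<integral>\<^sup>+\<omega>. F (\<lambda>l. R l \<omega>, \<lambda>l. N l \<omega>) * (\<Prod>l<n. (\<integral>\<^sup>+y. g l ((\<lambda>l. R l \<omega>, \<lambda>l. N l \<omega>), y) \<partial>beta_law (real (N l \<omega>) - \<alpha>) \<alpha>)) \<partial>Q)"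
    by (rule exists_R_N_beta_sequences[OF alpha m lam Rp]) blast+
  define W where "W l \<omega> = W_of (b l \<omega>) (R l \<omega>)" for l \<omega>
  have W_of_m [measurable]: "(\<lambda>q. W_of (snd q) (fst q)) \<in> borel_measurable (borel \<Otimes>\<^sub>M borel)"
    unfolding W_of_def by measurable
  have Wm [measurable]: "W l \<in> borel_measurable Q" for l unfolding W_def W_of_def by measurable
  have Rseq [measurable]: "(\<lambda>\<omega> l. R l \<omega>) \<in> measurable Q real_seq" by (rule measurable_PiM_single') auto
  have Nseq [measurable]: "(\<lambda>\<omega> l. N l \<omega>) \<in> measurable Q nat_seq" by (rule measurable_PiM_single') auto
  have beta_meas: "(\<lambda>\<omega>. emeasure (beta_law (real (N l \<omega>) - \<alpha>) \<alpha>) B) \<in> borel_measurable Q" for l B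
    by (rule measurable_compose[OF Nm]) simp
  have comp_meas: "(\<lambda>(r, k). emeasure (distr (beta_law (real k - \<alpha>) \<alpha>) borel (\<lambda>b. W_of b r)) B) \<in> borel_measurable (borel \<Otimes>\<^sub>M count_space UNIV)"
    if B [measurable]: "B \<in> sets borel" for B
  proof -
    have "(\<lambda>q. emeasure (distr (beta_law (real k - \<alpha>) \<alpha>) borel (\<lambda>b. W_of b (fst q))) B) \<in> borel_measurable (borel \<Otimes>\<^sub>M count_space UNIV)" for k :: nat
      by (rule measurable_compose[OF measurable_fst emeasure_distr_W_of_measurable[OF B]])
    from measurable_compose_countable[OF this, of snd] show ?thesis by (simp add: split_beta')
  qed
  have Wr: "(\<lambda>b. W_of b r) \<in> borel_measurable borel" for r unfolding W_of_def by measurable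
  have beta_W: "(\<integral>\<^sup>+y. indicator B (W_of y r) \<partial>beta_law a c) = emeasure (distr (beta_law a c) borel (\<lambda>b. W_of b r)) B"
    if B [measurable]: "B \<in> sets borel" for B r a c
  proof -
    have [measurable]: "(\<lambda>b. W_of b r) \<in> borel_measurable (beta_law a c)" using Wr by simp
    have "(\<integral>\<^sup>+y. indicator B (W_of y r) \<partial>beta_law a c) = (\<integral>\<^sup>+w. indicator B w \<partial>distr (beta_law a c) borel (\<lambda>b. W_of b r))"
      by (subst nn_integral_distr) auto
    then show ?thesis by simp
  qed
  have RN: "RN_sequence Q \<alpha> m lam R N"
    unfolding RN_sequence_def
  proof (intro conjI allI)
    fix l
    show "cond_law Q (\<lambda>\<omega>. \<lambda>i\<in>{..<l}. R i \<omega>) (\<Pi>\<^sub>M i\<in>{..<l}. borel) (\<lambda>r. R_law \<alpha> m (lam / (\<Prod>i<l. r i))) (R l) borel"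
    proof (rule cond_lawI)
      fix B :: "real set" assume B [measurable]: "B \<in> sets borel"
      have "(\<lambda>\<omega>. lam / (\<Prod>i<l. R i \<omega>)) \<in> borel_measurable Q" by measurable
      from measurable_compose[OF this emeasure_R_law_measurable[OF alpha m B]]
      show "(\<lambda>\<omega>. emeasure (R_law \<alpha> m (lam / (\<Prod>i<l. (\<lambda>i\<in>{..<l}. R i \<omega>) i))) B) \<in> borel_measurable Q" by simp
      fix A :: "(nat \<Rightarrow> real) set" assume A [measurable]: "A \<in> sets (\<Pi>\<^sub>M i\<in>{..<l}. borel)"
      have "(\<integral>\<^sup>+\<omega>. indicator A (\<lambda>i\<in>{..<l}. R i \<omega>) * indicator B (R l \<omega>) \<partial>Q) =
        (\<integral>\<^sup>+\<omega>. (\<integral>\<^sup>+y. indicator A (\<lambda>i\<in>{..<l}. R i \<omega>) * indicator B y \<partial>R_law \<alpha> m (lam / (\<Prod>i<l. R i \<omega>))) \<partial>Q)"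
        using chain[of "\<lambda>q. indicator A (fst q) * indicator B (snd q)" l] by simp
      also have "\<dots> = (\<integral>\<^sup>+\<omega>. indicator A (\<lambda>i\<in>{..<l}. R i \<omega>) * emeasure (R_law \<alpha> m (lam / (\<Prod>i<l. (\<lambda>i\<in>{..<l}. R i \<omega>) i))) B \<partial>Q)"
        by (simp add: nn_integral_cmult)
      finally show "(\<integral>\<^sup>+\<omega>. indicator A (\<lambda>i\<in>{..<l}. R i \<omega>) * indicator B (R l \<omega>) \<partial>Q) =
        (\<integral>\<^sup>+\<omega>. indicator A (\<lambda>i\<in>{..<l}. R i \<omega>) * emeasure (R_law \<alpha> m (lam / (\<Prod>i<l. (\<lambda>i\<in>{..<l}. R i \<omega>) i))) B \<partial>Q)" .
    qed (auto intro!: measurable_restrict)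
  next
    show "cond_indep_laws Q (\<lambda>\<omega> l. R l \<omega>) real_seq (\<lambda>l r. N_law \<alpha> m (r l)) N (count_space UNIV)"
    proof (rule cond_indep_lawsI)
      show "(\<lambda>\<omega>. emeasure (N_law \<alpha> m (R l \<omega>)) B) \<in> borel_measurable Q" for l B
        by (rule measurable_compose[OF Rm emeasure_N_law_measurable[OF alpha m]])
      fix n A and B :: "nat \<Rightarrow> nat set" assume A [measurable]: "A \<in> sets real_seq"
      show "(\<integral>\<^sup>+\<omega>. indicator A (\<lambda>l. R l \<omega>) * (\<Prod>l<n. indicator (B l) (N l \<omega>)) \<partial>Q) =
        (\<integral>\<^sup>+\<omega>. indicator A (\<lambda>l. R l \<omega>) * (\<Prod>l<n. emeasure (N_law \<alpha> m (R l \<omega>)) (B l)) \<partial>Q)"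
        using N_given_R[of "indicator A" n "\<lambda>l q. indicator (B l) (snd q)"] by simp
    qed auto
  qed
  \<comment> \<open>Integrating out the Beta variables gives the component laws, and integrating out \<open>N\<close> their mixture.\<close>
  have W_given_R: "(\<integral>\<^sup>+\<omega>. F (\<lambda>l. R l \<omega>) * (\<Prod>l<n. indicator (B l) (W l \<omega>)) \<partial>Q) =
     (\<integral>\<^sup>+\<omega>. F (\<lambda>l. R l \<omega>) * (\<Prod>l<n. emeasure (W_law \<alpha> m (R l \<omega>)) (B l)) \<partial>Q)"
    if F [measurable]: "F \<in> borel_measurable real_seq" and B: "\<And>l. B l \<in> sets borel" for n F B
  proof -
    have Bm [measurable]: "B l \<in> sets borel" for l by (rule B)
    define H where "H l r k = emeasure (distr (beta_law (real k - \<alpha>) \<alpha>) borel (\<lambda>b. W_of b r)) (B l)" for l r and k :: nat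
    have Hm: "(\<lambda>q. H l (fst q l) (snd q)) \<in> borel_measurable (real_seq \<Otimes>\<^sub>M count_space UNIV)" for l
    proof -
      have "(\<lambda>q. (fst q l, snd q)) \<in> measurable (real_seq \<Otimes>\<^sub>M count_space (UNIV :: nat set)) (borel \<Otimes>\<^sub>M count_space UNIV)" by measurable
      from measurable_compose[OF this comp_meas[OF B]] show ?thesis by (simp add: H_def)
    qed
    have gm: "(\<lambda>q. indicator (B l) (W_of (snd q) (fst (fst q) l)) :: ennreal) \<in> borel_measurable ((real_seq \<Otimes>\<^sub>M nat_seq) \<Otimes>\<^sub>M borel)" for l
      unfolding W_of_def by measurable
    have "(\<integral>\<^sup>+\<omega>. F (\<lambda>l. R l \<omega>) * (\<Prod>l<n. indicator (B l) (W l \<omega>)) \<partial>Q) =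
      (\<integral>\<^sup>+\<omega>. F (\<lambda>l. R l \<omega>) * (\<Prod>l<n. H l (R l \<omega>) (N l \<omega>)) \<partial>Q)"
      using b_given_RN[of "\<lambda>q. F (fst q)" n "\<lambda>l q. indicator (B l) (W_of (snd q) (fst (fst q) l))"] gm
      by (simp add: W_def H_def beta_W)
    also have "\<dots> = (\<integral>\<^sup>+\<omega>. F (\<lambda>l. R l \<omega>) * (\<Prod>l<n. (\<integral>\<^sup>+k. H l (R l \<omega>) k \<partial>N_law \<alpha> m (R l \<omega>))) \<partial>Q)"
      using N_given_R[of F n "\<lambda>l q. H l (fst q l) (snd q)"] Hm by simp
    also have "\<dots> = (\<integral>\<^sup>+\<omega>. F (\<lambda>l. R l \<omega>) * (\<Prod>l<n. emeasure (W_law \<alpha> m (R l \<omega>)) (B l)) \<partial>Q)"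
    proof (rule nn_integral_cong_AE)
      show "AE \<omega> in Q. F (\<lambda>l. R l \<omega>) * (\<Prod>l<n. (\<integral>\<^sup>+k. H l (R l \<omega>) k \<partial>N_law \<alpha> m (R l \<omega>))) =
        F (\<lambda>l. R l \<omega>) * (\<Prod>l<n. emeasure (W_law \<alpha> m (R l \<omega>)) (B l))"
        using AER
      proof eventually_elim
        case (elim \<omega>)
        then have "(\<integral>\<^sup>+k. H l (R l \<omega>) k \<partial>N_law \<alpha> m (R l \<omega>)) = emeasure (W_law \<alpha> m (R l \<omega>)) (B l)" for l
          unfolding nn_integral_N_law H_def by (intro emeasure_W_law_mixture[OF alpha m, symmetric]) auto
        then show ?case by simp
      qed
    qed
    finally show ?thesis .
  qed
  have W_indep: "cond_indep_laws Q (\<lambda>\<omega> l. R l \<omega>) real_seq (\<lambda>l r. W_law \<alpha> m (r l)) W borel"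
  proof (rule cond_indep_lawsI)
    show "(\<lambda>\<omega>. emeasure (W_law \<alpha> m (R l \<omega>)) B) \<in> borel_measurable Q" if "B \<in> sets borel" for l B
      by (rule measurable_compose[OF Rm emeasure_W_law_measurable[OF alpha m that]])
    fix n A and B :: "nat \<Rightarrow> real set" assume A: "A \<in> sets real_seq" and B: "\<And>l. B l \<in> sets borel"
    show "(\<integral>\<^sup>+\<omega>. indicator A (\<lambda>l. R l \<omega>) * (\<Prod>l<n. indicator (B l) (W l \<omega>)) \<partial>Q) =
      (\<integral>\<^sup>+\<omega>. indicator A (\<lambda>l. R l \<omega>) * (\<Prod>l<n. emeasure (W_law \<alpha> m (R l \<omega>)) (B l)) \<partial>Q)"
      using A B by (intro W_given_R) auto
  qed auto
  have W0: "cond_law Q (\<lambda>\<omega>. (R 0 \<omega>, N 0 \<omega>)) (borel \<Otimes>\<^sub>M count_space UNIV)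
      (\<lambda>(r, k). distr (beta_law (real k - \<alpha>) \<alpha>) borel (\<lambda>b. W_of b r)) (W 0) borel"
  proof (rule cond_lawI)
    fix B :: "real set" assume B [measurable]: "B \<in> sets borel"
    have "(\<lambda>\<omega>. (R 0 \<omega>, N 0 \<omega>)) \<in> measurable Q (borel \<Otimes>\<^sub>M count_space UNIV)" by measurable
    from measurable_compose[OF this comp_meas[OF B]]
    show "(\<lambda>\<omega>. emeasure ((\<lambda>(r, k). distr (beta_law (real k - \<alpha>) \<alpha>) borel (\<lambda>b. W_of b r)) (R 0 \<omega>, N 0 \<omega>)) B) \<in> borel_measurable Q" by simp
    fix A :: "(real \<times> nat) set" assume A [measurable]: "A \<in> sets (borel \<Otimes>\<^sub>M count_space UNIV)"
    have gm: "(\<lambda>q. indicator B (W_of (snd q) (fst (fst q) 0)) :: ennreal) \<in> borel_measurable ((real_seq \<Otimes>\<^sub>M nat_seq) \<Otimes>\<^sub>M borel)"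
      unfolding W_of_def by measurable
    show "(\<integral>\<^sup>+\<omega>. indicator A (R 0 \<omega>, N 0 \<omega>) * indicator B (W 0 \<omega>) \<partial>Q) =
      (\<integral>\<^sup>+\<omega>. indicator A (R 0 \<omega>, N 0 \<omega>) * emeasure ((\<lambda>(r, k). distr (beta_law (real k - \<alpha>) \<alpha>) borel (\<lambda>b. W_of b r)) (R 0 \<omega>, N 0 \<omega>)) B \<partial>Q)"
      using b_given_RN[of "\<lambda>q. indicator A (fst q 0, snd q 0)" "Suc 0" "\<lambda>l q. indicator B (W_of (snd q) (fst (fst q) 0))"] gm
      by (simp add: W_def beta_W)
  qed auto
  have b_indep: "cond_indep_laws Q (\<lambda>\<omega>. (\<lambda>l. R l \<omega>, \<lambda>l. N l \<omega>)) (real_seq \<Otimes>\<^sub>M nat_seq)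
      (\<lambda>l (r, n). beta_law (real (n l) - \<alpha>) \<alpha>) b borel"
  proof (rule cond_indep_lawsI)
    show "(\<lambda>\<omega>. emeasure (case (\<lambda>l. R l \<omega>, \<lambda>l. N l \<omega>) of (r, n) \<Rightarrow> beta_law (real (n l) - \<alpha>) \<alpha>) B) \<in> borel_measurable Q" for l B
      using beta_meas by simp
    fix n A and B :: "nat \<Rightarrow> real set" assume A [measurable]: "A \<in> sets (real_seq \<Otimes>\<^sub>M nat_seq)" and B: "\<And>l. B l \<in> sets borel"
    have [measurable]: "B l \<in> sets borel" for l by (rule B)
    show "(\<integral>\<^sup>+\<omega>. indicator A (\<lambda>l. R l \<omega>, \<lambda>l. N l \<omega>) * (\<Prod>l<n. indicator (B l) (b l \<omega>)) \<partial>Q) =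
      (\<integral>\<^sup>+\<omega>. indicator A (\<lambda>l. R l \<omega>, \<lambda>l. N l \<omega>) * (\<Prod>l<n. emeasure (case (\<lambda>l. R l \<omega>, \<lambda>l. N l \<omega>) of (r, n) \<Rightarrow> beta_law (real (n l) - \<alpha>) \<alpha>) (B l)) \<partial>Q)"
      using b_given_RN[of "indicator A" n "\<lambda>l q. indicator (B l) (snd q)"] by simp
  qed auto
  define W' where "W' l \<omega> = stick_ratio l (\<lambda>l. P l \<omega>) (\<lambda>i. \<sigma> i \<omega>)" for l \<omega>
  have \<sigma>m [measurable]: "\<sigma> i \<in> measurable M' (count_space UNIV)" for i
    using sigma by (auto simp: size_biased_sampling_def cond_law_def)
  note [measurable] = P(1)
  have Pseq [measurable]: "(\<lambda>\<omega> l. P l \<omega>) \<in> measurable M' real_seq" by (rule measurable_PiM_single') auto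
  have W'm [measurable]: "W' l \<in> borel_measurable M'" for l unfolding W'_def by measurable
  have W_W': "distr M' real_seq (\<lambda>\<omega> l. W' l \<omega>) = distr Q real_seq (\<lambda>\<omega> l. W l \<omega>)"
  proof (rule distr_eqI_of_cylinders[OF M'])
    fix n and B :: "nat \<Rightarrow> real set" assume B: "\<And>l. B l \<in> sets borel"
    have Bm [measurable]: "B l \<in> sets borel" for l by (rule B)
    have "{\<omega>\<in>space Q. \<forall>l\<in>{..<n}. W l \<omega> \<in> B l} \<in> sets Q" by measurable
    then have ms: "{\<omega>\<in>space Q. \<forall>l<n. W l \<omega> \<in> B l} \<in> sets Q" by (simp add: Ball_def)
    have "emeasure Q {\<omega>\<in>space Q. \<forall>l<n. W l \<omega> \<in> B l} = (\<integral>\<^sup>+\<omega>. 1 * (\<Prod>l<n. indicator (B l) (W l \<omega>)) \<partial>Q)"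
      unfolding nn_integral_indicator[OF ms, symmetric]
      by (intro nn_integral_cong) (auto simp: indicator_def prod_eq_1_iff)
    also have "\<dots> = (\<integral>\<^sup>+\<omega>. 1 * (\<Prod>l<n. emeasure (W_law \<alpha> m (R l \<omega>)) (B l)) \<partial>Q)"
      by (rule W_given_R) (auto simp: B)
    also have "\<dots> = R_chain_expectation \<alpha> m n (\<lambda>l r. emeasure (W_law \<alpha> m r) (B l)) lam"
      using R_chain_expectation_eq[OF alpha m Rm chain Q, of "\<lambda>l r. emeasure (W_law \<alpha> m r) (B l)" n 0]
        emeasure_W_law_measurable[OF alpha m B] by simp
    finally show "emeasure M' {\<omega>\<in>space M'. \<forall>l<n. W' l \<omega> \<in> B l} = emeasure Q {\<omega>\<in>space Q. \<forall>l<n. W l \<omega> \<in> B l}"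
      unfolding W'_def using size_biased_stick_ratio_law(1)[OF alpha m f tau A S kappa lam P sigma, of B n] B by simp
  qed auto
  have stick: "(\<lambda>w k. (1 - w k) * (\<Prod>l<k. w l)) \<in> measurable real_seq real_seq"
    by (rule measurable_PiM_single') (auto simp: space_PiM)
  have "distr M' real_seq (\<lambda>\<omega> k. P (\<sigma> k \<omega>) \<omega>) = distr M' real_seq (\<lambda>\<omega> k. (1 - W' k \<omega>) * (\<Prod>l<k. W' l \<omega>))"
  proof (rule distr_cong_AE)
    have "AE \<omega> in M'. \<forall>k. P (\<sigma> k \<omega>) \<omega> = (1 - W' k \<omega>) * (\<Prod>l<k. W' l \<omega>)"
      unfolding W'_def by (rule size_biased_stick_ratio_law(2)[OF alpha m f tau A S kappa lam P sigma])
    then show "AE \<omega> in M'. (\<lambda>k. P (\<sigma> k \<omega>) \<omega>) = (\<lambda>k. (1 - W' k \<omega>) * (\<Prod>l<k. W' l \<omega>))"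
      by eventually_elim auto
    have "(\<lambda>\<omega>. P (\<sigma> k \<omega>) \<omega>) \<in> borel_measurable M'" for k
      by (rule measurable_compose_countable[OF P(1) \<sigma>m])
    then show "(\<lambda>\<omega> k. P (\<sigma> k \<omega>) \<omega>) \<in> measurable M' real_seq"
      by (intro measurable_PiM_single') auto
    show "(\<lambda>\<omega> k. (1 - W' k \<omega>) * (\<Prod>l<k. W' l \<omega>)) \<in> measurable M' real_seq"
      by (rule measurable_PiM_single') auto
  qed auto
  also have "\<dots> = distr (distr M' real_seq (\<lambda>\<omega> l. W' l \<omega>)) real_seq (\<lambda>w k. (1 - w k) * (\<Prod>l<k. w l))"
    by (subst distr_distr[OF stick]) (auto simp: comp_def intro!: measurable_PiM_single')
  also have "\<dots> = distr Q real_seq (\<lambda>\<omega> k. (1 - W k \<omega>) * (\<Prod>l<k. W l \<omega>))"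
    unfolding W_W' by (subst distr_distr[OF stick]) (auto simp: comp_def intro!: measurable_PiM_single')
  finally have law: "distr M' real_seq (\<lambda>\<omega> k. P (\<sigma> k \<omega>) \<omega>) = distr Q real_seq (\<lambda>\<omega> k. (1 - W k \<omega>) * (\<Prod>l<k. W l \<omega>))" .
  have mix: "\<forall>r\<in>{0<..<1}. \<forall>w\<in>{r<..<1}. W_density \<alpha> m r w = (\<Sum>k=1..m. N_prob \<alpha> m r k * W_component_density \<alpha> k r w)"
    using W_density_mixture[OF alpha m] by auto
  have comp: "\<forall>r\<in>{0<..<1}. \<forall>k\<in>{1..m}. distr (beta_law (real k - \<alpha>) \<alpha>) borel (\<lambda>b. W_of b r) =
      density lborel (\<lambda>w. ennreal (indicator {r<..<1} w * W_component_density \<alpha> k r w))"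
    using distr_W_of_beta_law[OF alpha] by auto
  show ?thesis
    using Q RN law W_indep[unfolded W_law_def] mix W0 comp b_indep
    by (intro exI[of _ Q] exI[of _ R] exI[of _ N] exI[of _ b] exI[of _ W] conjI) (assumption | simp add: W_def)+
qed


end
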